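(* Let $(X,d,f,[\cdot,\cdot])$ be a topologically mixing Smale space. Let $G_1 : X \to \mathbb{R}$ be Hölder continuous, with unique equilibrium state $\mu_{G_1}$, and let $G_2 : X \to \mathbb{R}$ be continuous. For $\mu_{G_1}$-almost every $x \in X$ and every sufficiently small $\delta > 0$, if $\mu_{G_1}^u = \mu_{x,G_1}^u$ is a measure supported on $W_\delta^u(x)$ which has the conditional Gibbs property for $G_1$, then the following limit exists and $$P(G_2) - P(G_1) = \lim_{n \to \infty} \frac{1}{n} \log \int_{W_\delta^u(x)} e^{S_n(G_2 - G_1)(y)}\, d\mu_{G_1}^u(y).$$
   Context: **Smale space.** Let $X$ be a non-empty compact metric space with metric $d$ and $f : X \to X$ a homeomorphism. Assume there are $\epsilon_0 > 0$ and a continuous map $[\cdot,\cdot] : \{(x,y) \in X\times X : d(x,y) < \epsilon_0\} \to X$ with $[x,x]=x$ and (SS1) $[[x,y],z] = [x,z]$, (SS2) $[x,[y,z]] = [x,z]$, (SS3) $f([x,y]) = [f(x),f(y)]$, whenever the two sides of these relations are defined. Assume further that there is $0<\lambda<1$ such that for every $x \in X$: (SS4) if $d(x,y), d(x,z) < \epsilon_0$ and $[y,x]=x=[z,x]$, then $d(f(y),f(z)) \le \lambda d(y,z)$; (SS5) if $d(x,y), d(x,z) < \epsilon_0$ and $[x,y]=x=[x,z]$, then $d(f^{-1}(y),f^{-1}(z)) \le \lambda d(y,z)$. The quadruple $(X,d,f,[\cdot,\cdot])$ is then called a Smale space; it is (topologically) mixing if $f$ is topologically mixing. **Unstable manifolds.**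 For sufficiently small $\delta>0$ (in particular $\delta<\epsilon_0$), $W_\delta^u(x) = \{y \in X : y = [y,x],\ d(x,y)<\delta\}$. The global unstable set is $W^u(x) = \bigcup_{n\ge 0} f^n W^u_\delta(f^{-n}x)$. $d_u$ denotes the induced metric on unstable manifolds, i.e. the restriction of $d$. **Birkhoff sums, pressure, equilibrium states.** For $G : X\to\mathbb{R}$ write $S_nG(y) = \sum_{i=0}^{n-1} G(f^i y)$. For continuous $G$ the pressure is $P(G) = \sup\{h(\mu,f) + \int G\,d\mu\}$, the supremum over $f$-invariant Borel probability measures $\mu$, where $h(\mu,f)$ is the measure-theoretic entropy. Any measure realizing the supremum is an equilibrium state for $G$. It is known that on a topologically mixing Smale space the equilibrium state is unique, denoted $\mu_G$, if $G$ is Hölder continuous. **Conditional Gibbs property.** For $y \in W^u_\delta(x)$, $0<\epsilon<\delta$ and $n \in \mathbb{N}$, the unstable Bowen ball is $B_{d_u}(y,n,\epsilon) = \{z \in W^u(x) : d_u(f^i z, f^i y) < \epsilon \text{ for } 0 \le i \le n-1\}$. A (Borel) measure $\mu^u$ supported on $W_\delta^u(x)$ has the conditional Gibbs property for $G$ if for every small $\epsilon>0$ there is a constant $K = K(\epsilon)>0$ such that for every $y \in W^u_\delta(x)$ and every $n\in\mathbb{N}$, $$K^{-1} \le \frac{\mu^u(B_{d_u}(y,n,\epsilon))}{e^{S_nG(y) - nP(G)}} \le K.$$ *)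

theory Defs
  imports "HOL-Probability.Probability"
begin

section \<open>Smale spaces\<close>

text \<open>
  The space is the whole type, with its metric \<^term>\<open>dist\<close>.  The bracket is a total function of
  which only the values at pairs of distance less than \<open>eps0\<close> matter; in (SS1)--(SS3) the
  distance premises say that all brackets on both sides are defined.
\<close>

locale smale_space =
  fixes f :: "'a::metric_space \<Rightarrow> 'a"
    and br :: "'a \<Rightarrow> 'a \<Rightarrow> 'a"
    and eps0 lam :: real
  assumes compact_space: "compact (UNIV :: 'a set)"
    and homeo: "homeomorphism UNIV UNIV f (inv f)"
    and eps0_pos: "0 < eps0"
    and br_continuous: "continuous_on {(x, y). dist x y < eps0} (\<lambda>(x, y). br x y)"
    and br_diag: "br x x = x"
    and SS1: "\<lbrakk>dist x y < eps0; dist (br x y) z < eps0; dist x z < eps0\<rbrakk>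
                \<Longrightarrow> br (br x y) z = br x z"
    and SS2: "\<lbrakk>dist y z < eps0; dist x (br y z) < eps0; dist x z < eps0\<rbrakk>
                \<Longrightarrow> br x (br y z) = br x z"
    and SS3: "\<lbrakk>dist x y < eps0; dist (f x) (f y) < eps0\<rbrakk>
                \<Longrightarrow> f (br x y) = br (f x) (f y)"
    and lam: "0 < lam" "lam < 1"
    and SS4: "\<lbrakk>dist x y < eps0; dist x z < eps0; br y x = x; br z x = x\<rbrakk>
                \<Longrightarrow> dist (f y) (f z) \<le> lam * dist y z"
    and SS5: "\<lbrakk>dist x y < eps0; dist x z < eps0; br x y = x; br x z = x\<rbrakk>
                \<Longrightarrow> dist (inv f y) (inv f z) \<le> lam * dist y z"

definition topologically_mixing :: "('a::topological_space \<Rightarrow> 'a) \<Rightarrow> bool" where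
  "topologically_mixing f \<longleftrightarrow>
     (\<forall>U V. open U \<and> U \<noteq> {} \<and> open V \<and> V \<noteq> {} \<longrightarrow>
        (\<exists>N. \<forall>n\<ge>N. (f ^^ n) ` U \<inter> V \<noteq> {}))"

definition local_unstable :: "('a::metric_space \<Rightarrow> 'a \<Rightarrow> 'a) \<Rightarrow> real \<Rightarrow> 'a \<Rightarrow> 'a set" where
  "local_unstable br \<delta> x = {y. y = br y x \<and> dist x y < \<delta>}"

definition global_unstable ::
    "('a::metric_space \<Rightarrow> 'a) \<Rightarrow> ('a \<Rightarrow> 'a \<Rightarrow> 'a) \<Rightarrow> real \<Rightarrow> 'a \<Rightarrow> 'a set" where
  "global_unstable f br \<delta> x = (\<Union>n. (f ^^ n) ` local_unstable br \<delta> ((inv f ^^ n) x))"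


section \<open>Potentials, entropy, pressure and equilibrium states\<close>

definition hoelder_continuous :: "('a::metric_space \<Rightarrow> real) \<Rightarrow> bool" where
  "hoelder_continuous G \<longleftrightarrow>
     (\<exists>C \<alpha>. 0 < \<alpha> \<and> \<alpha> \<le> 1 \<and> (\<forall>x y. \<bar>G x - G y\<bar> \<le> C * dist x y powr \<alpha>))"

definition birkhoff_sum :: "('a \<Rightarrow> 'a) \<Rightarrow> ('a \<Rightarrow> real) \<Rightarrow> nat \<Rightarrow> 'a \<Rightarrow> real" where
  "birkhoff_sum f G n y = (\<Sum>i<n. G ((f ^^ i) y))"

definition invariant_prob_measures :: "('a::topological_space \<Rightarrow> 'a) \<Rightarrow> 'a measure set" where
  "invariant_prob_measures f = {\<mu>. prob_space \<mu> \<and> sets \<mu> = sets borel \<and> distr \<mu> borel f = \<mu>}"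

definition partition_entropy :: "'a measure \<Rightarrow> 'a set set \<Rightarrow> real" where
  "partition_entropy \<mu> P = - (\<Sum>A\<in>P. measure \<mu> A * ln (measure \<mu> A))"

text \<open>The partition whose members are the atoms of $\bigvee_{i<n} f^{-i} P$.\<close>

definition dynamical_join :: "('a \<Rightarrow> 'a) \<Rightarrow> nat \<Rightarrow> 'a set set \<Rightarrow> 'a set set" where
  "dynamical_join f n P = common_refinement ((\<lambda>i. (\<lambda>A. (f ^^ i) -` A) ` P) ` {..<n})"

text \<open>The limit exists for invariant \<open>\<mu>\<close>, by subadditivity.\<close>

definition entropy_wrt_partition :: "('a \<Rightarrow> 'a) \<Rightarrow> 'a measure \<Rightarrow> 'a set set \<Rightarrow> real" where
  "entropy_wrt_partition f \<mu> P = lim (\<lambda>n. partition_entropy \<mu> (dynamical_join f n P) / real n)"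

definition measure_entropy :: "('a \<Rightarrow> 'a) \<Rightarrow> 'a measure \<Rightarrow> ereal" where
  "measure_entropy f \<mu> =
     (SUP P \<in> {P. finite P \<and> partition_on (space \<mu>) P \<and> P \<subseteq> sets \<mu>}.
        ereal (entropy_wrt_partition f \<mu> P))"

text \<open>
  The supremum is taken in the extended reals, so that it is meaningful for every homeomorphism;
  it is finite on a Smale space, where \<open>f\<close> is expansive.
\<close>

definition pressure :: "('a::topological_space \<Rightarrow> 'a) \<Rightarrow> ('a \<Rightarrow> real) \<Rightarrow> ereal" where
  "pressure f G = (SUP \<mu> \<in> invariant_prob_measures f. measure_entropy f \<mu> + ereal (\<integral>x. G x \<partial>\<mu>))"

definition equilibrium_state ::
    "('a::topological_space \<Rightarrow> 'a) \<Rightarrow> ('a \<Rightarrow> real) \<Rightarrow> 'a measure \<Rightarrow> bool" where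
  "equilibrium_state f G \<mu> \<longleftrightarrow>
     \<mu> \<in> invariant_prob_measures f \<and> measure_entropy f \<mu> + ereal (\<integral>x. G x \<partial>\<mu>) = pressure f G"


section \<open>The conditional Gibbs property\<close>

definition unstable_bowen_ball ::
    "('a::metric_space \<Rightarrow> 'a) \<Rightarrow> ('a \<Rightarrow> 'a \<Rightarrow> 'a) \<Rightarrow> real \<Rightarrow> 'a \<Rightarrow> 'a \<Rightarrow> nat \<Rightarrow> real \<Rightarrow> 'a set" where
  "unstable_bowen_ball f br \<delta> x y n \<epsilon> =
     {z \<in> global_unstable f br \<delta> x. \<forall>i<n. dist ((f ^^ i) z) ((f ^^ i) y) < \<epsilon>}"

definition borel_measure_supported_on :: "'a::topological_space set \<Rightarrow> 'a measure \<Rightarrow> bool" where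
  "borel_measure_supported_on W \<nu> \<longleftrightarrow> sets \<nu> = sets borel \<and> (AE y in \<nu>. y \<in> W)"

text \<open>
  The real-valued \<^term>\<open>measure\<close> is 0 on sets of infinite measure; the positive lower
  bound excludes these, so no finiteness of \<open>\<nu>\<close> needs to be required.
\<close>

definition conditional_gibbs ::
    "('a::metric_space \<Rightarrow> 'a) \<Rightarrow> ('a \<Rightarrow> 'a \<Rightarrow> 'a) \<Rightarrow> real \<Rightarrow> 'a \<Rightarrow> ('a \<Rightarrow> real) \<Rightarrow> 'a measure \<Rightarrow> bool" where
  "conditional_gibbs f br \<delta> x G \<nu> \<longleftrightarrow>
     (\<forall>\<^sub>F \<epsilon> in at_right 0. \<exists>K>0. \<forall>y \<in> local_unstable br \<delta> x. \<forall>n\<ge>1.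
        inverse K \<le> measure \<nu> (unstable_bowen_ball f br \<delta> x y n \<epsilon>)
                    / exp (birkhoff_sum f G n y - real n * real_of_ereal (pressure f G)) \<and>
        measure \<nu> (unstable_bowen_ball f br \<delta> x y n \<epsilon>)
          / exp (birkhoff_sum f G n y - real n * real_of_ereal (pressure f G)) \<le> K)"

end

theory Submission
  imports Defs
begin

text \<open>
  By the Gibbs property an unstable Bowen ball \<open>B(y,n,\<epsilon>)\<close> has \<open>\<nu>\<close>-mass comparable to
  \<open>exp (S\<^sub>n G1 y - n P(G1))\<close>, so up to a factor \<open>exp (n \<eta>)\<close> with small \<open>\<eta>\<close> the integral is
  \<open>exp (- n P(G1))\<close> times the sum of \<open>exp (S\<^sub>n G2 y)\<close> over a maximal \<open>(n,\<epsilon>)\<close>-separated subset of the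
  unstable leaf. It remains to see that these sums grow at rate \<open>P(G2)\<close>, which is the variational
  principle on a leaf. They grow at most at this rate, since a weak limit of weighted
  empirical measures on separated sets is an invariant measure with large entropy plus integral.
  They grow at least at this rate, since by mixing and the bracket every point of \<open>X\<close> is shadowed
  by the image under \<open>f\<^sup>N\<close> of a point of the leaf, with \<open>N\<close> independent of the point: a spanning set of the leaf
  therefore controls the entropy of every invariant measure.
\<close>

section \<open>Shadowing by unstable leaves\<close>

text \<open>Both comparisons with entropy are applications of Gibbs' inequality: an entropy is at
  most the cross entropy against any explicit subprobability law. Product laws on words give
  subadditivity and the growth bound for separated sets; noisy copies of the itineraries of a
  spanning set give the bound for an invariant measure. Conditional entropies and concavity do not
  enter. The existence of the limit has to be proved along with its value, so both pressure
  inequalities assume their growth bound only for infinitely many n. A weak limit can be taken along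
  any subsequence, and the entropy quotients of an invariant measure converge, so infinitely many n
  suffice in either direction; a rate that strays to one side of P(G2) - P(G1) contradicts the
  inequality for that side. Compactness of the set of measures is obtained by coding the space into
  the real line, where tight sequences have weakly convergent subsequences. The constants that
  depend on the scale (K of the Gibbs property, the shadowing time N) are fixed before n grows and
  vanish after division by n.\<close>

lemma compact_finite_ball_cover:
  assumes "compact (UNIV :: 'a::metric_space set)" "0 < e"
  obtains C :: "'a::metric_space set" where "finite C" "\<And>x. \<exists>c\<in>C. dist c x < e"
proof -
  have "UNIV \<subseteq> (\<Union>c\<in>UNIV. ball (c::'a) e)" using assms(2) by auto
  then obtain C where "finite C" "UNIV \<subseteq> (\<Union>c\<in>C. ball (c::'a) e)"
    using compactE_image[OF assms(1), of UNIV "\<lambda>c. ball c e"] by (metis open_ball)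
  then show thesis using that[of C] by (auto simp: subset_iff)
qed

context smale_space
begin

lemma cont_f: "continuous_on UNIV f"
  and f_inv [simp]: "f (inv f x) = x" and inv_f [simp]: "inv f (f x) = x"
  using homeo by (auto simp: homeomorphism_def)

lemma f_pow_inv_pow [simp]: "(f ^^ n) ((inv f ^^ n) x) = x"
proof (induction n arbitrary: x)
  case (Suc n)
  show ?case by (subst funpow_Suc_right) (simp add: Suc)
qed simp

lemma inv_pow_f_pow [simp]: "(inv f ^^ n) ((f ^^ n) x) = x"
proof (induction n arbitrary: x)
  case (Suc n)
  show ?case by (subst funpow_Suc_right) (simp add: Suc)
qed simp

text \<open>The bracket is uniformly continuous on the compact set of pairs at distance at most
  \<open>eps0 / 2\<close>, and it equals x at the pair (x, x). Halving \<open>eps0\<close> provides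
  a closed set inside the open domain of the bracket.\<close>

lemma br_near:
  assumes "0 < h"
  obtains r where "0 < r" "r \<le> h" "r < eps0"
    "\<And>x z. dist x z < r \<Longrightarrow> dist (br x z) x < h \<and> dist (br x z) z < h"
proof -
  let ?K = "{(x, z). dist x z \<le> eps0 / 2} :: ('a \<times> 'a) set"
  have "closed ?K"
    unfolding split_beta by (intro closed_Collect_le continuous_intros)
  then have "compact ?K"
    using compact_Int_closed[OF compact_Times[OF compact_space compact_space]] by (simp add: Int_def)
  moreover have "continuous_on ?K (\<lambda>(x, y). br x y)"
    by (rule continuous_on_subset[OF br_continuous]) (use eps0_pos in auto)
  ultimately have "uniformly_continuous_on ?K (\<lambda>(x, y). br x y)"
    by (intro compact_uniformly_continuous)
  then obtain d where d: "0 < d"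
    "\<And>p q. p \<in> ?K \<Longrightarrow> q \<in> ?K \<Longrightarrow> dist q p < d \<Longrightarrow>
       dist (case q of (x, y) \<Rightarrow> br x y) (case p of (x, y) \<Rightarrow> br x y) < h / 2"
    unfolding uniformly_continuous_on_def using assms by (meson half_gt_zero)
  define r where "r = min (min d (h / 2)) (eps0 / 2)"
  show thesis
  proof
    show "0 < r" "r \<le> h" "r < eps0" using d(1) assms eps0_pos by (auto simp: r_def)
    fix x z :: 'a assume "dist x z < r"
    then have "dist (br x z) (br x x) < h / 2" "dist x z < h / 2"
      using d(2)[of "(x, x)" "(x, z)"] eps0_pos by (auto simp: r_def dist_Pair_Pair dist_commute)
    then show "dist (br x z) x < h \<and> dist (br x z) z < h"
      using dist_triangle[of "br x z" z x] zero_le_dist[of "br x z" x] unfolding br_diag by linarith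
  qed
qed

text \<open>The relation \<open>br w u = u\<close> puts w on the local stable set of u, and (SS4)
  based at u contracts. Contraction keeps the distance below \<open>eps0\<close>, which is what
  (SS3) needs to carry the relation one step further; so both claims share one induction.\<close>

lemma stable_contraction:
  assumes "br w u = u" "dist w u < eps0"
  shows "dist ((f ^^ i) w) ((f ^^ i) u) \<le> lam ^ i * dist w u \<and> br ((f ^^ i) w) ((f ^^ i) u) = (f ^^ i) u"
proof (induction i)
  case 0
  then show ?case using assms by simp
next
  case (Suc i)
  let ?w = "(f ^^ i) w" and ?u = "(f ^^ i) u"
  have le: "dist ?w ?u \<le> dist w u"
    using Suc lam by (meson mult_left_le_one_le order.trans power_le_one zero_le_dist zero_le_power less_imp_le)
  then have e: "dist ?w ?u < eps0" using assms by simp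
  then have *: "dist (f ?w) (f ?u) \<le> lam * dist ?w ?u"
    using Suc eps0_pos by (intro SS4[of ?u]) (auto simp: dist_commute br_diag)
  then have "dist (f ?w) (f ?u) < eps0"
    using e lam by (smt (verit) mult_left_le_one_le zero_le_dist)
  then have "br (f ?w) (f ?u) = f ?u" using SS3[of ?w ?u] e Suc by simp
  moreover have "lam * dist ?w ?u \<le> lam * (lam ^ i * dist w u)"
    using Suc lam by (intro mult_left_mono) auto
  ultimately show ?case using * by (simp add: mult.assoc)
qed

text \<open>The mirror image in backward time, with (SS5) based at w. Since (SS3) moves the relation
  only forwards, it is applied to the preimages and then undone by the injectivity of f.\<close>

lemma unstable_contraction:
  assumes "br w v = w" "dist w v < eps0"
  shows "dist ((inv f ^^ i) w) ((inv f ^^ i) v) \<le> lam ^ i * dist w v \<and>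
    br ((inv f ^^ i) w) ((inv f ^^ i) v) = (inv f ^^ i) w"
proof (induction i)
  case 0
  then show ?case using assms by simp
next
  case (Suc i)
  let ?w = "(inv f ^^ i) w" and ?v = "(inv f ^^ i) v"
  have le: "dist ?w ?v \<le> dist w v"
    using Suc lam by (meson mult_left_le_one_le order.trans power_le_one zero_le_dist zero_le_power less_imp_le)
  then have e: "dist ?w ?v < eps0" using assms by simp
  then have *: "dist (inv f ?w) (inv f ?v) \<le> lam * dist ?w ?v"
    using Suc eps0_pos by (intro SS5[of ?w]) (auto simp: dist_commute br_diag)
  then have "dist (inv f ?w) (inv f ?v) < eps0"
    using e lam by (smt (verit) mult_left_le_one_le zero_le_dist)
  then have "f (br (inv f ?w) (inv f ?v)) = ?w"
    using SS3[of "inv f ?w" "inv f ?v"] e Suc by simp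
  then have "br (inv f ?w) (inv f ?v) = inv f ?w" by (metis inv_f)
  moreover have "lam * dist ?w ?v \<le> lam * (lam ^ i * dist w v)"
    using Suc lam by (intro mult_left_mono) auto
  ultimately show ?case using * by (simp add: mult.assoc)
qed

text \<open>Mixing gives a hitting time for each single target; finitely many balls of radius
  \<open>r / 2\<close> make it uniform in x. The sum of their times dominates each of them.\<close>

lemma mixing_uniform_hitting:
  assumes "topologically_mixing f" "open U" "U \<noteq> {}" "0 < r"
  obtains N0 where "\<And>N x. N0 \<le> N \<Longrightarrow> \<exists>u\<in>U. dist ((f ^^ N) u) x < r"
proof -
  obtain C :: "'a set" where C: "finite C" "\<And>x. \<exists>c\<in>C. dist c x < r / 2"
    using compact_finite_ball_cover[OF compact_space, of "r / 2"] assms(4) by (metis half_gt_zero)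
  have "\<exists>M. \<forall>n\<ge>M. (f ^^ n) ` U \<inter> ball c (r / 2) \<noteq> {}" for c
    using assms unfolding topologically_mixing_def by simp
  then obtain M where M: "\<And>c n. M c \<le> n \<Longrightarrow> (f ^^ n) ` U \<inter> ball c (r / 2) \<noteq> {}" by metis
  show thesis
  proof (rule that[of "\<Sum>c\<in>C. M c"])
    fix N :: nat and x :: 'a assume N: "(\<Sum>c\<in>C. M c) \<le> N"
    obtain c where c: "c \<in> C" "dist c x < r / 2" using C by blast
    then have "M c \<le> N" using member_le_sum[of c C M] C(1) N by simp
    then obtain u where u: "u \<in> U" "dist c ((f ^^ N) u) < r / 2" using M[of c N] by fastforce
    then show "\<exists>u\<in>U. dist ((f ^^ N) u) x < r"
      using c dist_triangle[of "(f ^^ N) u" x c] by (auto simp: dist_commute intro!: bexI[of _ u])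
  qed
qed

text \<open>Mixing brings a point \<open>u\<close> near \<open>x0\<close> close to \<open>x\<close> at time \<open>N\<close>; bracketing \<open>u\<close> with \<open>x0\<close> moves it to
  the unstable leaf of \<open>x0\<close>, and bracketing \<open>x\<close> with the endpoint gives a point on the stable leaf
  of \<open>x\<close> whose \<open>N\<close>-th preimage is still on the unstable leaf of \<open>x0\<close>.\<close>

lemma unstable_leaf_shadowing:
  assumes mix: "topologically_mixing f" and \<delta>: "0 < \<delta>" and \<epsilon>: "0 < \<epsilon>"
  obtains N where "\<And>x. \<exists>y\<in>local_unstable br \<delta> x0. \<forall>i. dist ((f ^^ i) x) ((f ^^ (N + i)) y) < \<epsilon>"
proof -
  \<comment> \<open>A quarter leaves room for the sums of several moves of size h that the triangle
    inequalities produce.\<close>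
  define h where "h = min (min \<delta> \<epsilon>) eps0 / 4"
  have h: "0 < h" "4 * h \<le> \<delta>" "4 * h \<le> \<epsilon>" "4 * h \<le> eps0"
    using \<delta> \<epsilon> eps0_pos by (auto simp: h_def)
  obtain r where r: "0 < r" "r \<le> h" "r < eps0"
    and r': "\<And>x z. dist x z < r \<Longrightarrow> dist (br x z) x < h \<and> dist (br x z) z < h"
    using br_near[OF h(1)] by metis
  obtain N0 where N0: "\<And>N x. N0 \<le> N \<Longrightarrow> \<exists>u\<in>ball x0 r. dist ((f ^^ N) u) x < r / 2"
    using mixing_uniform_hitting[OF mix, of "ball x0 r" "r / 2"] r(1) by auto
  \<comment> \<open>At time 0 the points w and u below are within h; from time \<open>N1\<close> on,
    stable contraction brings them within \<open>r / 2\<close>, so that z is close enough to x to be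
    bracketed with it.\<close>
  have "(\<lambda>n. lam ^ n * h) \<longlonglongrightarrow> 0"
    using tendsto_mult_left[OF LIMSEQ_power_zero, of lam h] lam by (simp add: mult.commute)
  then have "\<forall>\<^sub>F n in sequentially. lam ^ n * h < r / 2"
    by (rule order_tendstoD(2)) (use r in simp)
  then obtain N1 where N1: "\<And>n. N1 \<le> n \<Longrightarrow> lam ^ n * h < r / 2"
    by (auto simp: eventually_sequentially)
  define N where "N = max N0 N1"
  have lamN: "0 \<le> lam ^ N" "lam ^ N \<le> 1" using lam by (auto intro: power_le_one)
  show thesis
  proof (rule that[of N])
    fix x :: 'a
    obtain u where u: "dist x0 u < r" "dist ((f ^^ N) u) x < r / 2" using N0[of N x] by (auto simp: N_def)
    define w where "w = br u x0"
    have w: "dist w u < h" "dist w x0 < h" using r'[of u x0] u by (auto simp: w_def dist_commute)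
    have wu: "br w u = u"
      using SS1[of u x0 u] u r w h by (simp add: w_def br_diag dist_commute)
    have wx0: "br w x0 = w"
      using SS1[of u x0 x0] u r w h by (simp add: w_def dist_commute)
    define z where "z = (f ^^ N) w"
    have "dist z ((f ^^ N) u) \<le> lam ^ N * dist w u"
      unfolding z_def using stable_contraction[of w u N] wu w h by simp
    also have "\<dots> \<le> lam ^ N * h" using w lamN by (intro mult_left_mono) auto
    also have "\<dots> < r / 2" using N1 by (simp add: N_def)
    finally have xz: "dist x z < r"
      using u(2) dist_triangle[of x z "(f ^^ N) u"] by (simp add: dist_commute)
    define v where "v = br x z"
    have v: "dist v x < h" "dist v z < h" using r'[OF xz] by (auto simp: v_def)
    have vx: "br v x = x"
      using SS1[of x z x] xz r v h by (simp add: v_def br_diag)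
    have zv: "br z v = z"
      using SS2[of x z z] xz r v h by (simp add: v_def br_diag dist_commute)
    \<comment> \<open>Since z lies on the unstable leaf of v, going back N steps contracts their
      distance, and y stays within h of w.\<close>
    define y where "y = (inv f ^^ N) v"
    have wz: "(inv f ^^ N) z = w" by (simp add: z_def)
    have "dist w y \<le> lam ^ N * dist z v" and wy: "br w y = w"
      using unstable_contraction[of z v N] zv v h wz by (simp_all add: y_def dist_commute)
    moreover have "lam ^ N * dist z v \<le> dist z v"
      using lamN by (simp add: mult_left_le_one_le)
    ultimately have dwy: "dist w y < h" using v by (simp add: dist_commute)
    have yw: "br y w = y"
      using SS2[of w y y] wy dwy h by (simp add: br_diag dist_commute)
    have dyx0: "dist x0 y < 2 * h"
      using dist_triangle[of x0 y w] dwy w by (simp add: dist_commute)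
    \<comment> \<open>Unstable relations compose: y is on the leaf of w, w is on the leaf of
      \<open>x0\<close>, and (SS2) joins the two.\<close>
    have "br y x0 = y"
      using SS2[of w x0 y] wx0 w dwy dyx0 yw h by (simp add: dist_commute)
    then have "y \<in> local_unstable br \<delta> x0"
      using dyx0 h by (simp add: local_unstable_def)
    moreover have "dist ((f ^^ i) x) ((f ^^ (N + i)) y) < \<epsilon>" for i
    proof -
      have "(f ^^ (N + i)) y = (f ^^ i) v"
        by (simp add: add.commute[of N] funpow_add y_def)
      moreover have "dist ((f ^^ i) v) ((f ^^ i) x) \<le> lam ^ i * dist v x"
        using stable_contraction[of v x i] vx v h by simp
      moreover have "lam ^ i * dist v x \<le> dist v x"
        using lam by (simp add: mult_left_le_one_le power_le_one)
      ultimately show ?thesis using v h by (simp add: dist_commute)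
    qed
    ultimately show "\<exists>y\<in>local_unstable br \<delta> x0. \<forall>i. dist ((f ^^ i) x) ((f ^^ (N + i)) y) < \<epsilon>"
      by blast
  qed
qed

text \<open>On the open ball the map taking y to \<open>br y x\<close> is continuous, so its fixed
  points form a relatively closed subset: the leaf is the intersection of an open and a closed
  set.\<close>

lemma borel_local_unstable:
  assumes "\<delta> \<le> eps0"
  shows "local_unstable br \<delta> x \<in> sets borel"
proof -
  have "continuous_on (ball x \<delta>) (\<lambda>y. case (y, x) of (a, b) \<Rightarrow> br a b)"
    by (rule continuous_on_compose2[OF br_continuous])
      (use assms in \<open>auto intro!: continuous_intros simp: dist_commute\<close>)
  then have "closedin (top_of_set (ball x \<delta>)) {y \<in> ball x \<delta>. dist (br y x) y \<in> {0}}"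
    by (intro continuous_closedin_preimage[unfolded vimage_def Int_def mem_Collect_eq]
        continuous_intros) (auto simp: Collect_conj_eq)
  then obtain T where "closed T" "{y \<in> ball x \<delta>. dist (br y x) y \<in> {0}} = ball x \<delta> \<inter> T"
    by (auto simp: closedin_closed)
  moreover have "local_unstable br \<delta> x = {y \<in> ball x \<delta>. dist (br y x) y \<in> {0}}"
    by (auto simp: local_unstable_def)
  ultimately show ?thesis by simp
qed

end

section \<open>Words and entropy\<close>

text \<open>Gibbs' inequality, from ln t <= t - 1 at t = q / p. It is stated for q of smaller total
  mass, so that subprobability laws can be used. Positivity of q where p is positive has to be
  assumed because the total logarithm is not minus infinity at 0.\<close>

lemma cross_entropy_le:
  fixes p q :: "'b \<Rightarrow> real"
  assumes "\<And>w. w \<in> W \<Longrightarrow> 0 \<le> p w" "\<And>w. w \<in> W \<Longrightarrow> 0 \<le> q w"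
    "(\<Sum>w\<in>W. q w) \<le> (\<Sum>w\<in>W. p w)" "\<And>w. w \<in> W \<Longrightarrow> 0 < p w \<Longrightarrow> 0 < q w"
  shows "- (\<Sum>w\<in>W. p w * ln (p w)) \<le> - (\<Sum>w\<in>W. p w * ln (q w))"
proof -
  have "p w * ln (q w) - p w * ln (p w) \<le> q w - p w" if w: "w \<in> W" for w
  proof (cases "p w = 0")
    case False
    then have pos: "0 < p w" "0 < q w" using assms(1,4) w by force+
    then have "p w * ln (q w / p w) \<le> p w * (q w / p w - 1)"
      by (intro mult_left_mono ln_le_minus_one) auto
    then show ?thesis using pos by (simp add: ln_div algebra_simps)
  qed (use assms(2) w in simp)
  then have "(\<Sum>w\<in>W. p w * ln (q w) - p w * ln (p w)) \<le> (\<Sum>w\<in>W. q w - p w)" by (rule sum_mono)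
  then show ?thesis using assms(3) by (simp add: sum_subtractf)
qed

text \<open>Fekete's lemma: division of n by m compares a n with n div m copies of a m and one
  remainder.\<close>

lemma subadditive_convergent:
  fixes a :: "nat \<Rightarrow> real"
  assumes nonneg: "\<And>n. 0 \<le> a n" and sub: "\<And>m n. a (m + n) \<le> a m + a n"
  shows "convergent (\<lambda>n. a n / real n)"
proof -
  \<comment> \<open>The index 0 is left out because \<open>a 0 / 0 = 0\<close> would force the
    infimum to be 0.\<close>
  define L where "L = (INF n\<in>{1..}. a n / real n)"
  have bdd: "bdd_below ((\<lambda>n. a n / real n) ` {1..})"
    by (rule bdd_belowI2[of _ 0]) (simp add: nonneg)
  have "(\<lambda>n. a n / real n) \<longlonglongrightarrow> L"
  proof (rule order_tendstoI)
    fix c assume c: "c < L"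
    show "\<forall>\<^sub>F n in sequentially. c < a n / real n"
      using eventually_ge_at_top[of 1]
    proof eventually_elim
      case (elim n)
      then have "L \<le> a n / real n" unfolding L_def by (intro cINF_lower bdd) auto
      with c show ?case by simp
    qed
  next
    fix c assume "L < c"
    then obtain m where m: "1 \<le> m" "a m / real m < c"
      unfolding L_def using bdd by (subst (asm) cINF_less_iff) auto
    \<comment> \<open>Bounds the remainder \<open>a (n mod m)\<close> for all n at once.\<close>
    define C where "C = (\<Sum>r<m. a r)"
    have mult: "a (k * m + r) \<le> real k * a m + a r" for k r
    proof (induction k)
      case (Suc k)
      then show ?case using sub[of m "k * m + r"] by (simp add: algebra_simps)
    qed simp
    have le: "a n / real n \<le> a m / real m + C / real n" if "1 \<le> n" for n
    proof -
      have "a n \<le> real (n div m) * a m + a (n mod m)"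
        using mult[of "n div m" "n mod m"] by simp
      also have "a (n mod m) \<le> C"
        unfolding C_def using m nonneg by (intro member_le_sum) auto
      also have "real (n div m) * a m \<le> real n / real m * a m"
        using nonneg m by (intro mult_right_mono) (simp_all add: of_nat_div_le_of_nat)
      finally show ?thesis using that m by (simp add: field_simps)
    qed
    have "(\<lambda>n. a m / real m + C / real n) \<longlonglongrightarrow> a m / real m + 0"
      by (intro tendsto_intros lim_const_over_n)
    then have "\<forall>\<^sub>F n in sequentially. a m / real m + C / real n < c"
      by (rule order_tendstoD(2)) (use m in simp)
    then show "\<forall>\<^sub>F n in sequentially. a n / real n < c"
      using eventually_ge_at_top[of 1]
      by eventually_elim (use le in \<open>auto intro: order.strict_trans1\<close>)
  qed
  then show ?thesis by (rule convergentI)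
qed

section \<open>Words and laws on words\<close>

definition words :: "'b set \<Rightarrow> nat \<Rightarrow> 'b list set" where
  "words P n = {w. set w \<subseteq> P \<and> length w = n}"

lemma finite_words [simp]: "finite P \<Longrightarrow> finite (words P n)"
  unfolding words_def by (rule finite_lists_length_eq)

lemma card_words: "finite P \<Longrightarrow> card (words P n) = card P ^ n"
  unfolding words_def by (rule card_lists_length_eq)

lemma words_nth: "w \<in> words P n \<Longrightarrow> i < n \<Longrightarrow> w ! i \<in> P"
  by (auto simp: words_def)

text \<open>Independent letters, the letter at position i having the subprobability law
  \<open>r i\<close>. The induction splits off the first letter and shifts the family, which is why
  r stays arbitrary.\<close>

lemma sum_words_prod_le:
  fixes r :: "nat \<Rightarrow> 'b \<Rightarrow> real"
  assumes "finite P" "\<And>i b. b \<in> P \<Longrightarrow> 0 \<le> r i b" "\<And>i. (\<Sum>b\<in>P. r i b) \<le> 1"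
  shows "(\<Sum>w\<in>words P n. \<Prod>i<n. r i (w ! i)) \<le> 1"
  using assms(2,3)
proof (induction n arbitrary: r)
  case 0
  have "words P 0 = {[]}" by (auto simp: words_def)
  then show ?case by simp
next
  case (Suc n)
  have W: "words P (Suc n) = (\<lambda>(b, w). b # w) ` (P \<times> words P n)"
    by (auto simp: words_def length_Suc_conv)
  have "(\<Sum>w\<in>words P (Suc n). \<Prod>i<Suc n. r i (w ! i)) =
      (\<Sum>(b, w)\<in>P \<times> words P n. r 0 b * (\<Prod>i<n. r (Suc i) (w ! i)))"
    unfolding W by (subst sum.reindex) (auto simp: inj_on_def case_prod_beta prod.lessThan_Suc_shift simp del: prod.lessThan_Suc)
  also have "\<dots> = (\<Sum>b\<in>P. r 0 b) * (\<Sum>w\<in>words P n. \<Prod>i<n. r (Suc i) (w ! i))"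
    by (simp add: sum_product sum.cartesian_product)
  also have "\<dots> \<le> 1"
    by (intro mult_le_one Suc.IH Suc.prems sum_nonneg prod_nonneg) (auto intro: Suc.prems simp: words_nth)
  finally show ?case .
qed

text \<open>Cutting at position m is a bijection onto pairs of words, and the double sum factors.
  This is the source of every product law used below.\<close>

lemma sum_words_append_le:
  fixes u v :: "'b list \<Rightarrow> real"
  assumes "finite P" "\<And>w. w \<in> words P m \<Longrightarrow> 0 \<le> u w" "\<And>w. w \<in> words P n \<Longrightarrow> 0 \<le> v w"
    and "(\<Sum>w\<in>words P m. u w) \<le> 1" "(\<Sum>w\<in>words P n. v w) \<le> 1"
  shows "(\<Sum>w\<in>words P (m + n). u (take m w) * v (drop m w)) \<le> 1"
proof -
  have "(\<Sum>w\<in>words P (m + n). u (take m w) * v (drop m w)) =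
      (\<Sum>(w, w')\<in>words P m \<times> words P n. u w * v w')"
    by (rule sum.reindex_bij_witness[of _ "\<lambda>(w, w'). w @ w'" "\<lambda>w. (take m w, drop m w)"])
      (auto simp: words_def dest: in_set_takeD in_set_dropD)
  also have "\<dots> = (\<Sum>w\<in>words P m. u w) * (\<Sum>w\<in>words P n. v w)"
    by (simp add: sum_product sum.cartesian_product)
  also have "\<dots> \<le> 1" using assms by (intro mult_le_one sum_nonneg) auto
  finally show ?thesis .
qed

section \<open>Itineraries and the atoms of dynamical joins\<close>

definition part_label :: "'a set set \<Rightarrow> 'a \<Rightarrow> 'a set" where
  "part_label P x = (THE A. A \<in> P \<and> x \<in> A)"

definition itinerary :: "('a \<Rightarrow> 'a) \<Rightarrow> 'a set set \<Rightarrow> nat \<Rightarrow> 'a \<Rightarrow> 'a set list" where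
  "itinerary f P n x = map (\<lambda>i. part_label P ((f ^^ i) x)) [0..<n]"

lemma part_label_eq: "partition_on UNIV P \<Longrightarrow> A \<in> P \<Longrightarrow> x \<in> A \<Longrightarrow> part_label P x = A"
  unfolding part_label_def partition_on_def disjoint_def by (intro the_equality) blast+

lemma part_label_mem:
  assumes "partition_on UNIV P"
  shows "part_label P x \<in> P" "x \<in> part_label P x"
proof -
  obtain A where "A \<in> P" "x \<in> A" using assms unfolding partition_on_def by blast
  then show "part_label P x \<in> P" "x \<in> part_label P x" using part_label_eq[OF assms] by auto
qed

lemma length_itinerary [simp]: "length (itinerary f P n x) = n"
  by (simp add: itinerary_def)

lemma itinerary_nth [simp]: "i < n \<Longrightarrow> itinerary f P n x ! i = part_label P ((f ^^ i) x)"
  by (simp add: itinerary_def)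

lemma itinerary_in_words: "partition_on UNIV P \<Longrightarrow> itinerary f P n x \<in> words P n"
  by (auto simp: words_def itinerary_def part_label_mem)

lemma take_drop_itinerary:
  "a + b \<le> n \<Longrightarrow> take a (drop b (itinerary f P n x)) = itinerary f P a ((f ^^ b) x)"
  by (rule nth_equalityI) (auto simp: add.commute[of b] funpow_add)

lemma itinerary_eq_iff:
  assumes "partition_on UNIV P" "w \<in> words P n"
  shows "itinerary f P n x = w \<longleftrightarrow> (\<forall>i<n. (f ^^ i) x \<in> w ! i)"
proof
  assume *: "\<forall>i<n. (f ^^ i) x \<in> w ! i"
  have "part_label P ((f ^^ i) x) = w ! i" if "i < n" for i
    using part_label_eq[OF assms(1) words_nth[OF assms(2) that]] * that by blast
  moreover have "length w = n" using assms(2) by (simp add: words_def)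
  ultimately show "itinerary f P n x = w" by (intro nth_equalityI) auto
qed (auto simp: part_label_mem[OF assms(1)])

text \<open>The common refinement intersects the values of choice functions on the set of
  pulled-back partitions. A choice whose values all contain x must pick the cell of x at every time,
  so a nonempty intersection is exactly the set of points sharing the itinerary of x.\<close>

lemma dynamical_join_eq:
  assumes P: "partition_on UNIV P"
  shows "dynamical_join f n P = (\<lambda>w. {x. itinerary f P n x = w}) ` words P n - {{}}"
proof -
  let ?Q = "\<lambda>i. (\<lambda>A. (f ^^ i) -` A) ` P"
  let ?QQ = "?Q ` {..<n}"
  have key: "\<Inter> (\<phi> ` ?QQ) = {z. itinerary f P n z = itinerary f P n x}"
    if \<phi>: "\<phi> \<in> (\<Pi> Q\<in>?QQ. Q)" "\<And>Q. Q \<in> ?QQ \<Longrightarrow> x \<in> \<phi> Q" for \<phi> x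
  proof -
    have "\<phi> (?Q i) = (f ^^ i) -` part_label P ((f ^^ i) x)" if "i < n" for i
    proof -
      have "?Q i \<in> ?QQ" using that by blast
      then have "\<phi> (?Q i) \<in> ?Q i" "x \<in> \<phi> (?Q i)" using \<phi> by (auto simp only: Pi_iff)
      then show ?thesis using part_label_eq[OF P] by auto
    qed
    then show ?thesis
      using itinerary_eq_iff[OF P itinerary_in_words[OF P, of f n x], of f] by auto
  qed
  show ?thesis
  proof (intro set_eqI iffI)
    fix X assume "X \<in> dynamical_join f n P"
    then obtain \<phi> where \<phi>: "\<phi> \<in> (\<Pi> Q\<in>?QQ. Q)" "X = \<Inter> (\<phi> ` ?QQ)" "X \<noteq> {}"
      unfolding dynamical_join_def common_refinement by blast
    then obtain x where "x \<in> X" by blast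
    then have "X = {z. itinerary f P n z = itinerary f P n x}" using key[OF \<phi>(1), of x] \<phi>(2) by blast
    then show "X \<in> (\<lambda>w. {x. itinerary f P n x = w}) ` words P n - {{}}"
      using \<phi>(3) itinerary_in_words[OF P, of f n x] by blast
  next
    fix X assume X: "X \<in> (\<lambda>w. {x. itinerary f P n x = w}) ` words P n - {{}}"
    then obtain x where x: "X = {z. itinerary f P n z = itinerary f P n x}" by auto
    \<comment> \<open>The choice depends on the partition Q and not on a time, since several times
      may produce the same Q.\<close>
    define \<phi> where "\<phi> Q = (SOME B. B \<in> Q \<and> x \<in> B)" for Q
    have \<phi>: "\<phi> Q \<in> Q \<and> x \<in> \<phi> Q" if "Q \<in> ?QQ" for Q
    proof -
      have "\<exists>B. B \<in> Q \<and> x \<in> B"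
        using that part_label_mem[OF P] by fastforce
      then show ?thesis unfolding \<phi>_def by (rule someI_ex)
    qed
    then have "X = \<Inter> (\<phi> ` ?QQ)" using key[of \<phi> x] x by blast
    then show "X \<in> dynamical_join f n P"
      unfolding dynamical_join_def common_refinement
      by (intro DiffI UN_I[of \<phi>] Pi_I) (use X \<phi> in blast)+
  qed
qed

text \<open>The length is read off the word, so that one function serves words, prefixes and
  suffixes of all lengths.\<close>

definition word_prob :: "('a \<Rightarrow> 'a) \<Rightarrow> 'a set set \<Rightarrow> 'a measure \<Rightarrow> 'a set list \<Rightarrow> real" where
  "word_prob f P M w = measure M {x. itinerary f P (length w) x = w}"

definition word_entropy :: "('a \<Rightarrow> 'a) \<Rightarrow> 'a set set \<Rightarrow> 'a measure \<Rightarrow> nat \<Rightarrow> real" where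
  "word_entropy f P M n = - (\<Sum>w\<in>words P n. word_prob f P M w * ln (word_prob f P M w))"

text \<open>Words with empty cylinder contribute 0 * ln 0 = 0, and distinct words with nonempty
  cylinders have distinct cylinders; hence a sum over atoms becomes a sum over all words.\<close>

lemma partition_entropy_eq_word_entropy:
  assumes P: "partition_on UNIV P" "finite P"
  shows "partition_entropy M (dynamical_join f n P) = word_entropy f P M n"
proof -
  let ?g = "\<lambda>w. {x. itinerary f P n x = w}" and ?h = "\<lambda>A. measure M A * ln (measure M A)"
  have "?g ` words P n - {{}} = ?g ` {w \<in> words P n. ?g w \<noteq> {}}" by blast
  then have "(\<Sum>A\<in>dynamical_join f n P. ?h A) = (\<Sum>A\<in>?g ` {w \<in> words P n. ?g w \<noteq> {}}. ?h A)"
    by (simp add: dynamical_join_eq[OF P(1)])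
  also have "\<dots> = (\<Sum>w\<in>{w \<in> words P n. ?g w \<noteq> {}}. ?h (?g w))"
    by (subst sum.reindex) (auto simp: inj_on_def)
  also have "\<dots> = (\<Sum>w\<in>words P n. ?h (?g w))"
    using P by (intro sum.mono_neutral_left) auto
  also have "\<dots> = (\<Sum>w\<in>words P n. word_prob f P M w * ln (word_prob f P M w))"
    by (intro sum.cong) (auto simp: word_prob_def words_def)
  finally show ?thesis by (simp add: partition_entropy_def word_entropy_def)
qed

lemma continuous_funpow:
  fixes f :: "'a::topological_space \<Rightarrow> 'a"
  shows "continuous_on UNIV f \<Longrightarrow> continuous_on UNIV (f ^^ n)"
proof (induction n)
  case (Suc n)
  then show ?case
    using continuous_on_compose[of UNIV "f ^^ n" f] continuous_on_subset by (simp add: o_def) blast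
qed (simp add: id_def)

lemma itinerary_cylinder_borel:
  fixes f :: "'a::topological_space \<Rightarrow> 'a"
  assumes "continuous_on UNIV f" "partition_on UNIV P" "P \<subseteq> sets borel"
  shows "{x. itinerary f P n x = w} \<in> sets borel"
proof (cases "w \<in> words P n")
  case True
  have "(f ^^ i) -` (w ! i) \<in> sets borel" if "i < n" for i
    using measurable_sets[OF borel_measurable_continuous_onI[OF continuous_funpow[OF assms(1)]], of "w ! i" i]
      words_nth[OF True that] assms(3) by auto
  then have "(\<Inter>i\<in>{..<n}. (f ^^ i) -` (w ! i)) \<in> sets borel"
    by (cases "n = 0") (auto intro: sets.finite_INT)
  moreover have "{x. itinerary f P n x = w} = (\<Inter>i\<in>{..<n}. (f ^^ i) -` (w ! i))"
    using itinerary_eq_iff[OF assms(2) True, of f] by auto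
  ultimately show ?thesis by simp
next
  case False
  then have "{x. itinerary f P n x = w} = {}" using itinerary_in_words[OF assms(2)] by blast
  then show ?thesis by simp
qed

text \<open>A function of the itinerary is a finite combination of indicators of cylinders. Passing
  to integrals replaces the computation of marginals of word laws by the invariance of M.\<close>

lemma
  fixes f :: "'a::topological_space \<Rightarrow> 'a" and \<phi> :: "'a set list \<Rightarrow> real"
  assumes "finite_measure M" and M: "sets M = sets borel"
    and f: "continuous_on UNIV f" and P: "partition_on UNIV P" "P \<subseteq> sets borel" "finite P"
  shows integrable_itinerary: "integrable M (\<lambda>x. \<phi> (itinerary f P n x))"
    and integral_itinerary:
      "(\<integral>x. \<phi> (itinerary f P n x) \<partial>M) = (\<Sum>w\<in>words P n. word_prob f P M w * \<phi> w)"
proof -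
  interpret finite_measure M by fact
  let ?A = "\<lambda>w. {x. itinerary f P n x = w}"
  have A: "?A w \<in> sets M" for w using itinerary_cylinder_borel[OF f P(1,2)] M by simp
  have eq: "\<phi> (itinerary f P n x) = (\<Sum>w\<in>words P n. indicator (?A w) x * \<phi> w)" for x
    using itinerary_in_words[OF P(1), of f n x] P(3)
    by (subst sum.remove[of _ "itinerary f P n x"]) (auto simp: indicator_def)
  have int: "integrable M (\<lambda>x. indicator (?A w) x * \<phi> w)" for w
    using A by (intro integrable_mult_left) (simp add: emeasure_finite less_top[symmetric])
  show "integrable M (\<lambda>x. \<phi> (itinerary f P n x))"
    unfolding eq by (intro Bochner_Integration.integrable_sum int)
  have "(\<integral>x. \<phi> (itinerary f P n x) \<partial>M) = (\<Sum>w\<in>words P n. measure M (?A w) * \<phi> w)"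
    unfolding eq using int A by (subst Bochner_Integration.integral_sum) (auto simp: sets_eq_imp_space_eq[OF M])
  also have "\<dots> = (\<Sum>w\<in>words P n. word_prob f P M w * \<phi> w)"
    by (intro sum.cong) (auto simp: word_prob_def words_def)
  finally show "(\<integral>x. \<phi> (itinerary f P n x) \<partial>M) = (\<Sum>w\<in>words P n. word_prob f P M w * \<phi> w)" .
qed

lemma integral_funpow_invariant:
  fixes f :: "'a::topological_space \<Rightarrow> 'a" and h :: "'a \<Rightarrow> real"
  assumes f: "continuous_on UNIV f" and M: "M \<in> invariant_prob_measures f" and h: "h \<in> borel_measurable borel"
  shows "(\<integral>x. h ((f ^^ m) x) \<partial>M) = (\<integral>x. h x \<partial>M)"
    and "integrable M h \<Longrightarrow> integrable M (\<lambda>x. h ((f ^^ m) x))"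
proof -
  have s: "sets M = sets borel" and d: "distr M borel f = M"
    using M by (auto simp: invariant_prob_measures_def)
  have f_meas: "f ^^ m \<in> M \<rightarrow>\<^sub>M borel" for m
    using borel_measurable_continuous_onI[OF continuous_funpow[OF f]] measurable_cong_sets[OF s refl] by blast
  have "distr M borel (f ^^ m) = M"
  proof (induction m)
    case 0
    show ?case using s by (simp add: distr_id2 id_def)
  next
    case (Suc m)
    have "f \<in> borel \<rightarrow>\<^sub>M borel" using borel_measurable_continuous_onI[OF f] .
    then have "distr M borel (f \<circ> f ^^ m) = distr (distr M borel (f ^^ m)) borel f"
      using f_meas by (subst distr_distr) auto
    then show ?case by (simp only: funpow.simps Suc d)
  qed
  then show "(\<integral>x. h ((f ^^ m) x) \<partial>M) = (\<integral>x. h x \<partial>M)"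
    "integrable M h \<Longrightarrow> integrable M (\<lambda>x. h ((f ^^ m) x))"
    using integral_distr[OF f_meas h, of m] integrable_distr_eq[OF f_meas h, of m] by simp_all
qed

text \<open>Fekete's lemma applies once subadditivity is known, and that is Gibbs' inequality for
  the law of words of length m + n against the product of the laws of prefix and suffix. Invariance
  identifies the suffix law with the law of words of length n.\<close>

lemma word_entropy_tendsto:
  fixes f :: "'a::topological_space \<Rightarrow> 'a"
  assumes f: "continuous_on UNIV f" and M: "M \<in> invariant_prob_measures f"
    and P: "partition_on UNIV P" "P \<subseteq> sets borel" "finite P"
  shows "(\<lambda>n. word_entropy f P M n / real n) \<longlonglongrightarrow> entropy_wrt_partition f M P"
proof -
  have s: "sets M = sets borel" and "prob_space M"
    using M by (auto simp: invariant_prob_measures_def)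
  interpret prob_space M by fact
  let ?p = "word_prob f P M"
  have p: "0 \<le> ?p w" "?p w \<le> 1" for w by (auto simp: word_prob_def)
  note int = integral_itinerary[OF finite_measure_axioms s f P]
  have sum1: "(\<Sum>w\<in>words P n. ?p w) = 1" for n
    using int[of "\<lambda>_. 1" n] by (simp add: prob_space)
  have lnp: "ln (?p w) \<le> 0" for w
    using p[of w] by (cases "?p w = 0") (simp_all add: order_less_le)
  have nonneg: "0 \<le> word_entropy f P M n" for n
    unfolding word_entropy_def neg_0_le_iff_le
    using p lnp by (intro sum_nonpos mult_nonneg_nonpos) auto
  have ent: "word_entropy f P M n = - (\<integral>x. ln (?p (itinerary f P n x)) \<partial>M)" for n
    unfolding word_entropy_def using int[of "\<lambda>w. ln (?p w)" n] by simp
  have sub: "word_entropy f P M (m + n) \<le> word_entropy f P M m + word_entropy f P M n" for m n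
  proof -
    let ?q = "\<lambda>w. ?p (take m w) * ?p (drop m w)"
    let ?n = "\<lambda>x. ln (?p (itinerary f P n x))"
    \<comment> \<open>The positivity that Gibbs' inequality asks for: the cylinder of w lies in the
      cylinder of its prefix and in the m-th preimage of the cylinder of its suffix.\<close>
    have pos: "0 < ?p (take m w) \<and> 0 < ?p (drop m w)" if w: "w \<in> words P (m + n)" "0 < ?p w" for w
    proof -
      have l: "length w = m + n" using w by (simp add: words_def)
      have cyl: "{x. itinerary f P k x = v} \<in> sets M" for k v
        using itinerary_cylinder_borel[OF f P(1,2)] s by simp
      have "?p w \<le> ?p (take m w)"
        unfolding word_prob_def using l take_drop_itinerary[of m 0 "m + n" f P] cyl
        by (intro finite_measure_mono) auto
      moreover have "?p w \<le> (\<integral>x. indicator {x. itinerary f P n x = drop m w} ((f ^^ m) x) \<partial>M)"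
      proof -
        have "?p w = (\<integral>x. indicator {x. itinerary f P (m + n) x = w} x \<partial>M)"
          using l by (simp add: word_prob_def sets_eq_imp_space_eq[OF s])
        also have "\<dots> \<le> (\<integral>x. indicator {x. itinerary f P n x = drop m w} ((f ^^ m) x) \<partial>M)"
        proof (rule integral_mono)
          show "integrable M (\<lambda>x. indicator {x. itinerary f P n x = drop m w} ((f ^^ m) x) :: real)"
            using cyl itinerary_cylinder_borel[OF f P(1,2)]
            by (intro integral_funpow_invariant(2)[OF f M]) (auto simp: emeasure_finite less_top[symmetric])
          show "indicator {x. itinerary f P (m + n) x = w} x
              \<le> (indicator {x. itinerary f P n x = drop m w} ((f ^^ m) x) :: real)" for x
            using take_drop_itinerary[of n m "m + n" f P x] l
            by (auto simp: indicator_def)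
        qed (use cyl in \<open>simp add: emeasure_finite less_top[symmetric]\<close>)
        finally show ?thesis .
      qed
      moreover have "(\<integral>x. indicator {x. itinerary f P n x = drop m w} ((f ^^ m) x) \<partial>M) = ?p (drop m w)"
        using itinerary_cylinder_borel[OF f P(1,2)] l
        by (subst integral_funpow_invariant(1)[OF f M]) (auto simp: word_prob_def sets_eq_imp_space_eq[OF s])
      ultimately show ?thesis using w(2) by linarith
    qed
    have "word_entropy f P M (m + n) \<le> - (\<Sum>w\<in>words P (m + n). ?p w * ln (?q w))"
      unfolding word_entropy_def
    proof (rule cross_entropy_le)
      show "(\<Sum>w\<in>words P (m + n). ?q w) \<le> (\<Sum>w\<in>words P (m + n). ?p w)"
        using sum_words_append_le[of P m ?p n ?p] P(3) p(1) sum1 by simp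
    qed (use p pos in auto)
    also have "(\<Sum>w\<in>words P (m + n). ?p w * ln (?q w)) =
        (\<Sum>w\<in>words P (m + n). ?p w * (ln (?p (take m w)) + ln (?p (drop m w))))"
    proof (rule sum.cong)
      fix w assume w: "w \<in> words P (m + n)"
      show "?p w * ln (?q w) = ?p w * (ln (?p (take m w)) + ln (?p (drop m w)))"
      proof (cases "?p w = 0")
        case False
        then have "0 < ?p w" using p(1)[of w] by simp
        from pos[OF w this] show ?thesis by (simp add: ln_mult_pos)
      qed simp
    qed simp
    also have "\<dots> = (\<integral>x. ln (?p (take m (itinerary f P (m + n) x))) + ln (?p (drop m (itinerary f P (m + n) x))) \<partial>M)"
      using int[of "\<lambda>w. ln (?p (take m w)) + ln (?p (drop m w))" "m + n"] by simp
    also have "\<dots> = (\<integral>x. ln (?p (itinerary f P m x)) + ?n ((f ^^ m) x) \<partial>M)"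
      using take_drop_itinerary[of m 0 "m + n" f P] take_drop_itinerary[of n m "m + n" f P] by simp
    also have "\<dots> = - word_entropy f P M m + (\<integral>x. ?n ((f ^^ m) x) \<partial>M)"
    proof -
      have mb: "?n \<in> borel_measurable borel"
        using borel_measurable_integrable[OF integrable_itinerary[OF finite_measure_axioms s f P, of "\<lambda>w. ln (?p w)" n]]
          measurable_cong_sets[OF s refl] by blast
      show ?thesis
        unfolding ent using integral_funpow_invariant(2)[OF f M mb, of m]
        by (subst Bochner_Integration.integral_add)
          (auto intro!: integrable_itinerary[OF finite_measure_axioms s f P, of "\<lambda>w. ln (?p w)"])
    qed
    also have "(\<integral>x. ?n ((f ^^ m) x) \<partial>M) = - word_entropy f P M n"
    proof -
      have mb: "?n \<in> borel_measurable borel"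
        using borel_measurable_integrable[OF integrable_itinerary[OF finite_measure_axioms s f P, of "\<lambda>w. ln (?p w)" n]]
          measurable_cong_sets[OF s refl] by blast
      show ?thesis unfolding ent using integral_funpow_invariant(1)[OF f M mb, of m] by simp
    qed
    finally show ?thesis by simp
  qed
  have "convergent (\<lambda>n. word_entropy f P M n / real n)"
    using nonneg sub by (rule subadditive_convergent)
  then show ?thesis
    unfolding entropy_wrt_partition_def partition_entropy_eq_word_entropy[OF P(1,3)]
    by (simp add: convergent_LIMSEQ_iff)
qed

section \<open>Measures on compact metric spaces\<close>

text \<open>Regularity. The sets with this property form a sigma-algebra; it contains an open set U
  because U is the increasing union of the closed sets of points at distance at least 1 / (n + 1)
  from its complement.\<close>

lemma borel_closed_open_approx:
  fixes M :: "'a::metric_space measure"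
  assumes "finite_measure M" and M: "sets M = sets borel" and A: "A \<in> sets borel"
  shows "\<forall>e>0. \<exists>C U. closed C \<and> open U \<and> C \<subseteq> A \<and> A \<subseteq> U \<and> measure M (U - C) < e"
proof -
  interpret finite_measure M by fact
  have cl: "closed C \<Longrightarrow> C \<in> sets M" and op: "open C \<Longrightarrow> C \<in> sets M" for C
    using M by auto
  have "A \<in> sigma_sets UNIV {S. open S}" using A by (simp add: borel_def)
  then show ?thesis
  proof induction
    case (Basic U)
    then have U: "open U" by simp
    show ?case
    \<comment> \<open>The distance to the empty complement is 0 by convention, so the exhaustion
      below would be empty.\<close>
    proof (cases "U = UNIV")
      case True
      then show ?thesis by (intro allI impI exI[of _ UNIV]) auto
    next
      case False
      define C where "C n = {x. inverse (real (Suc n)) \<le> infdist x (- U)}" for n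
      have C: "closed (C n)" for n
        unfolding C_def by (intro closed_Collect_le continuous_intros)
      have sub: "C n \<subseteq> U" for n
        by (auto simp: C_def intro: ccontr)
      have "decseq (\<lambda>n. U - C n)"
      proof (rule decseq_SucI)
        fix n
        have "inverse (real (Suc (Suc n))) \<le> inverse (real (Suc n))" by (simp add: le_imp_inverse_le)
        then have "x \<in> C n \<Longrightarrow> x \<in> C (Suc n)" for x
          unfolding C_def mem_Collect_eq by (rule order_trans)
        then show "U - C (Suc n) \<subseteq> U - C n" by blast
      qed
      moreover have "(\<Inter>n. U - C n) = {}"
      proof -
        have "\<exists>n. x \<in> C n" if "x \<in> U" for x
        proof -
          have "0 < infdist x (- U)"
            using U False that by (intro infdist_pos_not_in_closed) auto
          then obtain n where "inverse (real (Suc n)) < infdist x (- U)"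
            using reals_Archimedean by blast
          then show ?thesis unfolding C_def by (auto intro: less_imp_le)
        qed
        then show ?thesis by blast
      qed
      moreover have "range (\<lambda>n. U - C n) \<subseteq> sets M" using cl[OF C] op[OF U] by auto
      ultimately have "(\<lambda>n. measure M (U - C n)) \<longlonglongrightarrow> 0"
        using finite_Lim_measure_decseq[of "\<lambda>n. U - C n"] unfolding \<open>(\<Inter>n. U - C n) = {}\<close> measure_empty by blast
      then have "\<exists>n. measure M (U - C n) < e" if "0 < e" for e
        using order_tendstoD(2)[of _ 0 sequentially e] that by (auto simp: eventually_sequentially)
      then have ex: "\<exists>n. measure M (U - C n) < e" if "0 < e" for e using that by blast
      show ?thesis
      proof (intro allI impI)
        fix e :: real assume "0 < e"
        then obtain n where "measure M (U - C n) < e" using ex by blast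
        then show "\<exists>C U'. closed C \<and> open U' \<and> C \<subseteq> U \<and> U \<subseteq> U' \<and> measure M (U' - C) < e"
          using C[of n] sub[of n] U by (intro exI[of _ "C n"] exI[of _ U]) simp
      qed
    qed
  next
    case Empty
    show ?case by (intro allI impI exI[of _ "{}"]) auto
  next
    case (Compl A)
    show ?case
    proof (intro allI impI)
      fix e :: real assume "0 < e"
      then obtain C U where *: "closed C" "open U" "C \<subseteq> A" "A \<subseteq> U" "measure M (U - C) < e"
        using Compl.IH[rule_format, OF \<open>0 < e\<close>] by (elim exE conjE)
      then show "\<exists>C U. closed C \<and> open U \<and> C \<subseteq> UNIV - A \<and> UNIV - A \<subseteq> U \<and> measure M (U - C) < e"
        by (intro exI[of _ "- U"] exI[of _ "- C"]) (auto simp: Diff_eq Int_commute)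
    qed
  next
    case (Union A)
    show ?case
    proof (intro allI impI)
      fix e :: real assume e: "0 < e"
      have "\<forall>i. \<exists>C U. closed C \<and> open U \<and> C \<subseteq> A i \<and> A i \<subseteq> U \<and> measure M (U - C) < e / 2 * (1 / 2) ^ Suc i"
        by (intro allI Union.IH[rule_format]) (use e in simp)
      then obtain C U where CU: "\<And>i. closed (C i)" "\<And>i. open (U i)" "\<And>i. C i \<subseteq> A i" "\<And>i. A i \<subseteq> U i"
        "\<And>i. measure M (U i - C i) < e / 2 * (1 / 2) ^ Suc i" by metis
      have sums: "(\<lambda>i. e / 2 * (1 / 2) ^ Suc i) sums (e / 2 * 1)"
        by (intro sums_mult power_half_series)
      have meas: "U i - C i \<in> sets M" "C i \<in> sets M" for i using CU cl op by auto
      have summ: "summable (\<lambda>i. measure M (U i - C i))"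
        by (rule summable_comparison_test'[OF sums_summable[OF sums], of 0]) (use CU(5) in \<open>auto intro: less_imp_le\<close>)
      have "measure M (\<Union>i. U i - C i) \<le> (\<Sum>i. measure M (U i - C i))"
        by (intro finite_measure_subadditive_countably summ) (use meas in auto)
      also have "\<dots> \<le> (\<Sum>i. e / 2 * (1 / 2) ^ Suc i)"
        by (intro suminf_le summ sums_summable[OF sums]) (use CU(5) in \<open>auto intro: less_imp_le\<close>)
      also have "\<dots> = e / 2" using sums_unique[OF sums] by simp
      finally have 1: "measure M (\<Union>i. U i - C i) \<le> e / 2" .
      \<comment> \<open>An infinite union of closed sets need not be closed, so it is cut off at a
        finite stage; this consumes the second half of e.\<close>
      have "(\<lambda>n. measure M ((\<Union>i. C i) - (\<Union>i<n. C i))) \<longlonglongrightarrow> measure M (\<Inter>n. (\<Union>i. C i) - (\<Union>i<n. C i))"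
        by (intro finite_Lim_measure_decseq) (use meas in \<open>auto simp: decseq_def\<close>)
      moreover have "(\<Inter>n. (\<Union>i. C i) - (\<Union>i<n. C i)) = {}" by auto
      ultimately have "(\<lambda>n. measure M ((\<Union>i. C i) - (\<Union>i<n. C i))) \<longlonglongrightarrow> 0"
        by (simp only: measure_empty)
      then have "\<forall>\<^sub>F n in sequentially. measure M ((\<Union>i. C i) - (\<Union>i<n. C i)) < e / 2"
        by (rule order_tendstoD(2)) (use e in simp)
      then obtain n where n: "measure M ((\<Union>i. C i) - (\<Union>i<n. C i)) < e / 2"
        by (auto simp: eventually_sequentially)
      have "measure M ((\<Union>i. U i) - (\<Union>i<n. C i))
          \<le> measure M ((\<Union>i. U i - C i) \<union> ((\<Union>i. C i) - (\<Union>i<n. C i)))"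
        using meas by (intro finite_measure_mono) auto
      also have "\<dots> \<le> measure M (\<Union>i. U i - C i) + measure M ((\<Union>i. C i) - (\<Union>i<n. C i))"
        using meas by (intro measure_Un_le) auto
      finally have "measure M ((\<Union>i. U i) - (\<Union>i<n. C i)) < e" using 1 n by linarith
      have "closed (\<Union>i<n. C i)" "open (\<Union>i. U i)" using CU by auto
      have "(\<Union>i<n. C i) \<subseteq> (\<Union>i. A i)" "(\<Union>i. A i) \<subseteq> (\<Union>i. U i)"
        using CU(3,4) by (fast, fast)
      show "\<exists>C U. closed C \<and> open U \<and> C \<subseteq> \<Union> (range A) \<and> \<Union> (range A) \<subseteq> U \<and> measure M (U - C) < e"
        by (rule exI[of _ "\<Union>i<n. C i"], rule exI[of _ "\<Union>i. U i"], intro conjI; fact)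
    qed
  qed
qed

lemma integrable_continuous_compact_space:
  fixes g :: "'a::metric_space \<Rightarrow> real"
  assumes "compact (UNIV :: 'a set)" "finite_measure M" "sets M = sets borel" "continuous_on UNIV g"
  shows "integrable M g"
proof -
  interpret finite_measure M by fact
  have "bounded (range g)"
    using compact_continuous_image[OF assms(4,1)] compact_imp_bounded by blast
  then obtain B where "\<And>x. norm (g x) \<le> B" by (auto simp: bounded_iff)
  moreover have "g \<in> borel_measurable M"
    using borel_measurable_continuous_onI[OF assms(4)] measurable_cong_sets[OF assms(3) refl] by blast
  ultimately show ?thesis by (intro integrable_const_bound[of _ B]) auto
qed

text \<open>Closed sets form an intersection-stable generator of the Borel sets, and the indicator
  of a nonempty closed set is the limit of continuous functions falling linearly with the distance
  to it. The empty set is treated apart because of the convention for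
  \<open>infdist\<close>.\<close>

lemma measure_eq_of_continuous_integrals:
  fixes M N :: "'a::metric_space measure"
  assumes "compact (UNIV :: 'a set)" "prob_space M" "prob_space N"
    and s: "sets M = sets borel" "sets N = sets borel"
    and eq: "\<And>g :: 'a \<Rightarrow> real. continuous_on UNIV g \<Longrightarrow> (\<integral>x. g x \<partial>M) = (\<integral>x. g x \<partial>N)"
  shows "M = N"
proof -
  interpret M: prob_space M by fact
  interpret N: prob_space N by fact
  show ?thesis
  proof (rule measure_eqI_generator_eq[of "Collect closed" UNIV M N "\<lambda>_. UNIV"])
    show "sets M = sigma_sets UNIV (Collect closed)" "sets N = sigma_sets UNIV (Collect closed)"
      unfolding s by (simp_all add: borel_eq_closed)
    fix C :: "'a set" assume "C \<in> Collect closed"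
    then have C: "closed C" by simp
    show "emeasure M C = emeasure N C"
    proof (cases "C = {}")
      case False
      define g where "g k x = max 0 (1 - real k * infdist x C)" for k x
      have g: "continuous_on UNIV (g k)" for k unfolding g_def by (intro continuous_intros)
      have lim: "(\<lambda>k. g k x) \<longlonglongrightarrow> indicator C x" for x
      proof (cases "x \<in> C")
        case True
        then show ?thesis by (simp add: g_def)
      next
        case F: False
        then have pos: "0 < infdist x C" using C False by (intro infdist_pos_not_in_closed)
        obtain K where K: "1 < real K * infdist x C" using reals_Archimedean3[OF pos] by blast
        have "g k x = 0" if "K \<le> k" for k
        proof -
          have "real K * infdist x C \<le> real k * infdist x C" using that pos by (intro mult_right_mono) auto
          then show ?thesis using K by (simp add: g_def)
        qed
        then have "\<forall>\<^sub>F k in sequentially. g k x = indicator C x"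
          using F by (auto simp: eventually_sequentially)
        then show ?thesis by (rule tendsto_eventually)
      qed
      have "(\<lambda>k. \<integral>x. g k x \<partial>L) \<longlonglongrightarrow> measure L C" if "prob_space L" "sets L = sets borel" for L
      proof -
        interpret L: prob_space L by fact
        have "(\<lambda>k. \<integral>x. g k x \<partial>L) \<longlonglongrightarrow> (\<integral>x. indicator C x \<partial>L)"
        proof (rule integral_dominated_convergence[where w = "\<lambda>_. 1"])
          show "indicator C \<in> borel_measurable L"
            by (rule borel_measurable_indicator) (simp add: that C)
          show "g k \<in> borel_measurable L" for k
            using borel_measurable_continuous_onI[OF g] measurable_cong_sets[OF that(2) refl] by blast
          show "AE x in L. norm (g k x) \<le> 1" for k by (auto simp: g_def infdist_nonneg)
        qed (use lim in auto)
        then show ?thesis using that C by (simp add: sets_eq_imp_space_eq[OF that(2)])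
      qed
      from this[OF \<open>prob_space M\<close> s(1)] this[OF \<open>prob_space N\<close> s(2)] have "measure M C = measure N C"
        unfolding eq[OF g] by (rule LIMSEQ_unique)
      then show ?thesis by (simp add: M.emeasure_eq_measure N.emeasure_eq_measure)
    qed simp
  next
    show "emeasure M UNIV \<noteq> \<infinity>" for i :: nat by simp
  qed (auto simp: Int_stable_def)
qed

section \<open>Weak compactness of the probability measures\<close>

text \<open>Ternary digits encoding membership in a countable family of small open balls.\<close>

lemma compact_space_real_coding:
  assumes comp: "compact (UNIV :: 'a::metric_space set)"
  obtains s :: "'a::metric_space \<Rightarrow> real" where "s \<in> borel_measurable borel" "\<And>x. 0 \<le> s x" "\<And>x. s x \<le> 3 / 2"
    "\<And>e. 0 < e \<Longrightarrow> \<exists>d>0. \<forall>x y. \<bar>s x - s y\<bar> < d \<longrightarrow> dist x y < e"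
proof -
  have "\<forall>k. \<exists>C :: 'a set. finite C \<and> (\<forall>x. \<exists>c\<in>C. dist c x < inverse (real (Suc k)))"
    using compact_finite_ball_cover[OF comp] by (metis inverse_positive_iff_positive of_nat_0_less_iff zero_less_Suc)
  then obtain C :: "nat \<Rightarrow> 'a set" where C: "\<And>k. finite (C k)" "\<And>k x. \<exists>c\<in>C k. dist c x < inverse (real (Suc k))"
    by metis
  define \<B> where "\<B> = (\<Union>k. (\<lambda>c. ball c (inverse (real (Suc k)))) ` C k)"
  have \<B>: "countable \<B>"
    unfolding \<B>_def using C(1) by (intro countable_UN[OF countableI_type] countable_finite[OF finite_imageI])
  obtain c0 where "c0 \<in> C 0" using C(2)[of 0] by blast
  then have \<B>_ne: "\<B> \<noteq> {}" unfolding \<B>_def by blast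
  define U where "U = from_nat_into \<B>"
  have U: "open (U i)" for i
    using from_nat_into[OF \<B>_ne, of i] unfolding U_def[symmetric] by (auto simp: \<B>_def)
  \<comment> \<open>The code is \<open>t 0\<close>, and \<open>t j\<close> is the expansion that
    remains after j digits. Starting at index 0 gives total weight 3 / 2, so a tail divided by 3 is
    at most 1 / 2.\<close>
  define t where "t j x = (\<Sum>i. (1 / 3) ^ i * (indicator (U (i + j)) x :: real))" for j x
  have geo: "summable (\<lambda>i. (1 / 3 :: real) ^ i)" "(\<Sum>i. (1 / 3 :: real) ^ i) = 3 / 2"
    by (auto simp: suminf_geometric)
  have summ: "summable (\<lambda>i. (1 / 3) ^ i * (indicator (U (i + j)) x :: real))" for j x
    by (rule summable_comparison_test'[OF geo(1), of 0]) (auto simp: indicator_def)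
  have t_bounds: "0 \<le> t j x" "t j x \<le> 3 / 2" for j x
  proof -
    show "0 \<le> t j x" unfolding t_def by (intro suminf_nonneg summ) simp
    have "t j x \<le> (\<Sum>i. (1 / 3 :: real) ^ i)"
      unfolding t_def by (intro suminf_le summ geo) (auto simp: indicator_def)
    then show "t j x \<le> 3 / 2" using geo(2) by simp
  qed
  have t_rec: "t j x = indicator (U j) x + t (Suc j) x / 3" for j x
  proof -
    have "t j x = indicator (U j) x + (\<Sum>i. (1 / 3) ^ Suc i * (indicator (U (Suc i + j)) x :: real))"
      unfolding t_def using suminf_split_head[OF summ[of j x]] by simp
    also have "(\<Sum>i. (1 / 3) ^ Suc i * (indicator (U (Suc i + j)) x :: real)) = t (Suc j) x / 3"
      unfolding t_def using suminf_mult[OF summ[of "Suc j" x], of "1 / 3"] by (simp add: mult.assoc)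
    finally show ?thesis .
  qed
  \<comment> \<open>Two expansions with different leading digits are at least 1 - 1 / 2 apart. Codes
    that are closer than that share the digit, and removing it multiplies their difference by 3;
    closeness 3^(-k) / 2 therefore survives k + 1 rounds.\<close>
  have digits: "(x \<in> U j \<longleftrightarrow> y \<in> U j) \<and> \<bar>t (Suc j) x - t (Suc j) y\<bar> = 3 ^ Suc j * \<bar>t 0 x - t 0 y\<bar>"
    if "\<bar>t 0 x - t 0 y\<bar> < (1 / 3) ^ k / 2" "j \<le> k" for j k x y
    using that(2)
  proof (induction j)
    have step: "(x \<in> U i \<longleftrightarrow> y \<in> U i) \<and> \<bar>t (Suc i) x - t (Suc i) y\<bar> = 3 * \<bar>t i x - t i y\<bar>"
      if "\<bar>t i x - t i y\<bar> < 1 / 2" for i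
    proof -
      have "x \<in> U i \<longleftrightarrow> y \<in> U i"
        using that t_rec[of i x] t_rec[of i y] t_bounds[of "Suc i" x] t_bounds[of "Suc i" y]
        by (cases "x \<in> U i"; cases "y \<in> U i") auto
      moreover from this have eq: "t i x - t i y = (t (Suc i) x - t (Suc i) y) / 3"
        using t_rec[of i x] t_rec[of i y] by (simp add: indicator_def diff_divide_distrib)
      ultimately show ?thesis by (simp add: eq abs_divide)
    qed
    {
      case 0
      have "(1 / 3) ^ k / 2 \<le> (1 / 2 :: real)" by (simp add: power_le_one)
      then show ?case using step[of 0] that(1) by simp
    next
      case (Suc j)
      have "(3 :: real) ^ Suc j * (1 / 3) ^ k \<le> 3 ^ k * (1 / 3) ^ k"
        using Suc.prems by (intro mult_right_mono power_increasing) auto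
      also have "\<dots> = 1" by (simp add: power_mult_distrib[symmetric])
      finally have *: "(3 :: real) ^ Suc j * ((1 / 3) ^ k / 2) \<le> 1 / 2" by simp
      have "3 ^ Suc j * \<bar>t 0 x - t 0 y\<bar> < 3 ^ Suc j * ((1 / 3) ^ k / 2)"
        using that(1) by (intro mult_strict_left_mono) auto
      moreover have "\<bar>t (Suc j) x - t (Suc j) y\<bar> = 3 ^ Suc j * \<bar>t 0 x - t 0 y\<bar>"
        using Suc by (meson Suc_leD)
      ultimately have "\<bar>t (Suc j) x - t (Suc j) y\<bar> < 1 / 2"
        using * by linarith
      then show ?case using step[of "Suc j"] Suc by simp
    }
  qed
  show thesis
  proof (rule that[of "t 0"])
    show "t 0 \<in> borel_measurable borel"
      unfolding t_def using U by (intro borel_measurable_suminf) (auto intro!: borel_measurable_times)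
    show "0 \<le> t 0 x" "t 0 x \<le> 3 / 2" for x using t_bounds by auto
    fix e :: real assume "0 < e"
    then obtain k where k: "inverse (real (Suc k)) < e / 2" using reals_Archimedean[of "e / 2"] by auto
    let ?b = "\<lambda>c. ball c (inverse (real (Suc k)))"
    \<comment> \<open>At least as large as the index of every ball of this radius, so agreement of
      the digits up to \<open>K\<close> decides membership in all of them.\<close>
    define K where "K = (\<Sum>c\<in>C k. to_nat_on \<B> (?b c))"
    show "\<exists>d>0. \<forall>x y. \<bar>t 0 x - t 0 y\<bar> < d \<longrightarrow> dist x y < e"
    proof (intro exI[of _ "(1 / 3) ^ K / 2"] conjI allI impI)
      fix x y assume xy: "\<bar>t 0 x - t 0 y\<bar> < (1 / 3) ^ K / 2"
      obtain c where c: "c \<in> C k" "dist c x < inverse (real (Suc k))" using C(2) by blast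
      have "U (to_nat_on \<B> (?b c)) = ?b c"
        unfolding U_def using \<B> c(1) by (intro from_nat_into_to_nat_on) (auto simp: \<B>_def)
      moreover have "to_nat_on \<B> (?b c) \<le> K"
        unfolding K_def using c(1) C(1) by (intro member_le_sum) auto
      ultimately have "y \<in> ?b c" using digits[OF xy, of "to_nat_on \<B> (?b c)"] c(2) by auto
      then show "dist x y < e" using c(2) k dist_triangle[of x y c] by (simp add: dist_commute)
    qed simp
  qed
qed

text \<open>The hypothesis says that s has a uniformly continuous inverse on its range, which
  extends to the closure by compactness of the space. The code s itself may be discontinuous, so its
  range need not be closed.\<close>

lemma compact_space_coding_inverse:
  fixes s :: "'a::metric_space \<Rightarrow> real"
  assumes comp: "compact (UNIV :: 'a set)"
    and s: "\<And>e. 0 < e \<Longrightarrow> \<exists>d>0. \<forall>x y. \<bar>s x - s y\<bar> < d \<longrightarrow> dist x y < e"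
  obtains \<pi> where "continuous_on (closure (range s)) \<pi>" "\<And>x. \<pi> (s x) = x"
proof -
  have "\<exists>z. \<forall>e>0. \<exists>d>0. \<forall>x. \<bar>s x - t\<bar> < d \<longrightarrow> dist x z < e" if t: "t \<in> closure (range s)" for t
  proof -
    obtain X where X: "\<And>n::nat. X n \<in> range s" "X \<longlonglongrightarrow> t"
      using t unfolding closure_sequential by blast
    have "\<forall>n. \<exists>y. X n = s y" using X(1) by blast
    then obtain x where x: "\<And>n. X n = s (x n)" by metis
    obtain z and r where z: "strict_mono (r :: nat \<Rightarrow> nat)" "(x \<circ> r) \<longlonglongrightarrow> z"
      using seq_compactE[OF compact_imp_seq_compact[OF comp], of x] that by blast
    have lim: "(\<lambda>n. s (x (r n))) \<longlonglongrightarrow> t"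
      using LIMSEQ_subseq_LIMSEQ[OF X(2) z(1)] x by (simp add: o_def)
    show ?thesis
    proof (intro exI[of _ z] allI impI)
      fix e :: real assume "0 < e"
      then obtain d where d: "0 < d" "\<And>x y. \<bar>s x - s y\<bar> < d \<Longrightarrow> dist x y < e / 2"
        using s[of "e / 2"] by auto
      have "\<forall>\<^sub>F n in sequentially. \<bar>s (x (r n)) - t\<bar> < d / 2 \<and> dist (x (r n)) z < e / 2"
        using tendstoD[OF lim, of "d / 2"] tendstoD[OF z(2), of "e / 2"] d(1) \<open>0 < e\<close>
        by (auto simp: dist_real_def eventually_conj_iff)
      then obtain n where n: "\<bar>s (x (r n)) - t\<bar> < d / 2" "dist (x (r n)) z < e / 2"
        using eventually_happens'[OF sequentially_bot] by blast
      show "\<exists>d>0. \<forall>x. \<bar>s x - t\<bar> < d \<longrightarrow> dist x z < e"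
      proof (intro exI[of _ "d / 2"] conjI allI impI)
        fix y assume "\<bar>s y - t\<bar> < d / 2"
        then have "dist y (x (r n)) < e / 2" using n d(2)[of y "x (r n)"] by linarith
        then show "dist y z < e" using n(2) dist_triangle[of y z "x (r n)"] by linarith
      qed (use d in simp)
    qed
  qed
  then obtain \<pi> where \<pi>: "\<And>t e. t \<in> closure (range s) \<Longrightarrow> 0 < e \<Longrightarrow> \<exists>d>0. \<forall>x. \<bar>s x - t\<bar> < d \<longrightarrow> dist x (\<pi> t) < e"
    by metis
  show thesis
  proof (rule that[of \<pi>])
    show "\<pi> (s x) = x" for x
    proof -
      have "dist x (\<pi> (s x)) < e" if "0 < e" for e
        using \<pi>[of "s x" e] that closure_subset[of "range s"] by fastforce
      then show ?thesis by (metis dist_eq_0_iff less_irrefl zero_less_dist_iff)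
    qed
    show "continuous_on (closure (range s)) \<pi>"
      unfolding continuous_on_iff
    proof (intro ballI allI impI)
      fix t and e :: real assume t: "t \<in> closure (range s)" and e: "0 < e"
      then obtain d where d: "0 < d" "\<And>x. \<bar>s x - t\<bar> < d \<Longrightarrow> dist x (\<pi> t) < e / 2"
        using \<pi>[of t "e / 2"] by auto
      show "\<exists>d>0. \<forall>t'\<in>closure (range s). dist t' t < d \<longrightarrow> dist (\<pi> t') (\<pi> t) < e"
      proof (intro exI[of _ "d / 2"] conjI ballI impI)
        fix t' assume t': "t' \<in> closure (range s)" "dist t' t < d / 2"
        then obtain d' where d': "0 < d'" "\<And>x. \<bar>s x - t'\<bar> < d' \<Longrightarrow> dist x (\<pi> t') < e / 2"
          using \<pi>[of t' "e / 2"] e by auto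
        obtain x where x: "dist (s x) t' < min (d / 2) d'"
          using t'(1) d(1) d'(1) unfolding closure_approachable by (metis (no_types) rangeE min_less_iff_conj half_gt_zero)
        then have "\<bar>s x - t'\<bar> < d / 2" by (simp add: dist_real_def)
        then have "\<bar>s x - t\<bar> < d" using t'(2) unfolding dist_real_def by linarith
        then have "dist x (\<pi> t) < e / 2" "dist x (\<pi> t') < e / 2" using d d' x by (auto simp: dist_real_def)
        then show "dist (\<pi> t') (\<pi> t) < e" using dist_triangle[of "\<pi> t'" "\<pi> t" x] by (simp add: dist_commute)
      qed (use d in simp)
    qed
  qed
qed

text \<open>The measures are pushed to the real line by the code, where they are tight because the
  code is bounded; a weak limit of a subsequence is pushed back by the inverse code.\<close>

lemma weak_limit_compact_space:
  fixes M :: "nat \<Rightarrow> 'a::metric_space measure"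
  assumes comp: "compact (UNIV :: 'a set)"
    and M: "\<And>n. prob_space (M n)" "\<And>n. sets (M n) = sets borel"
  obtains r \<mu> where "strict_mono (r :: nat \<Rightarrow> nat)" "prob_space \<mu>" "sets \<mu> = sets borel"
    "\<And>g :: 'a \<Rightarrow> real. continuous_on UNIV g \<Longrightarrow> (\<lambda>n. \<integral>x. g x \<partial>M (r n)) \<longlonglongrightarrow> (\<integral>x. g x \<partial>\<mu>)"
proof -
  obtain s :: "'a \<Rightarrow> real" where s: "s \<in> borel_measurable borel" "\<And>x. 0 \<le> s x" "\<And>x. s x \<le> 3 / 2"
    "\<And>e. 0 < e \<Longrightarrow> \<exists>d>0. \<forall>x y. \<bar>s x - s y\<bar> < d \<longrightarrow> dist x y < e"
    using compact_space_real_coding[OF comp] by blast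
  obtain \<pi> where \<pi>: "continuous_on (closure (range s)) \<pi>" "\<And>x. \<pi> (s x) = x"
    using compact_space_coding_inverse[OF comp s(4)] by blast
  let ?K = "closure (range s)"
  have sM: "s \<in> M n \<rightarrow>\<^sub>M borel" for n using s(1) measurable_cong_sets[OF M(2) refl] by blast
  define m where "m n = distr (M n) borel s" for n
  have m_real: "real_distribution (m n)" for n
    unfolding m_def real_distribution_def real_distribution_axioms_def
    using prob_space.prob_space_distr[OF M(1) sM] by simp
  have "tight m"
    unfolding tight_def
  proof (intro conjI allI impI m_real)
    fix e :: real assume "0 < e"
    have "measure (m n) {-1<..2} > 1 - e" for n
    proof -
      interpret prob_space "M n" by (rule M)
      have "s -` {-1<..2} \<inter> space (M n) = space (M n)"
      proof -
        have "-1 < s x \<and> s x \<le> 2" for x using s(2,3)[of x] by linarith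
        then show ?thesis by auto
      qed
      then have "measure (m n) {-1<..2} = 1" unfolding m_def using sM by (simp add: measure_distr prob_space)
      then show ?thesis using \<open>0 < e\<close> by simp
    qed
    then show "\<exists>a b. a < b \<and> (\<forall>n. measure (m n) {a<..b} > 1 - e)"
      by (intro exI[of _ "-1"] exI[of _ 2]) auto
  qed
  then obtain r L where r: "strict_mono r" and L: "real_distribution L" and wc: "weak_conv_m (m \<circ> id \<circ> r) L"
    using tight_imp_convergent_subsubsequence[of m id] by (auto simp: strict_mono_id)
  interpret L: real_distribution L by (rule L)
  have conv: "(\<lambda>n. \<integral>x. h (s x) \<partial>M (r n)) \<longlonglongrightarrow> (\<integral>t. h t \<partial>L)"
    if h: "continuous_on UNIV h" "\<And>t. \<bar>h t\<bar> \<le> B" for h :: "real \<Rightarrow> real" and B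
  proof -
    have "(\<lambda>n. \<integral>t. h t \<partial>((m \<circ> id \<circ> r) n)) \<longlonglongrightarrow> (\<integral>t. h t \<partial>L)"
      by (rule weak_conv_imp_integral_bdd_continuous_conv[OF _ L wc])
        (use m_real h in \<open>auto simp: continuous_on_eq_continuous_at\<close>)
    moreover have "(\<integral>t. h t \<partial>((m \<circ> id \<circ> r) n)) = (\<integral>x. h (s x) \<partial>M (r n))" for n
      unfolding m_def by (simp add: integral_distr[OF sM borel_measurable_continuous_onI[OF h(1)]])
    ultimately show ?thesis by simp
  qed
  have ne: "?K \<noteq> {}" using closure_subset by fastforce
  \<comment> \<open>The truncated distance to the closure is continuous and vanishes at every code,
    so its integral against the limit is 0.\<close>
  have AE_K: "AE t in L. t \<in> ?K"
  proof -
    let ?k = "\<lambda>t. min 1 (infdist t ?K)"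
    have k: "continuous_on UNIV ?k" by (intro continuous_intros)
    have "(\<lambda>n. \<integral>x. ?k (s x) \<partial>M (r n)) \<longlonglongrightarrow> (\<integral>t. ?k t \<partial>L)"
      by (rule conv[OF k, of 1]) (auto simp: infdist_nonneg)
    moreover have "?k (s x) = 0" for x
      using closure_subset[of "range s"] by (auto simp: infdist_zero subset_iff)
    ultimately have "(\<integral>t. ?k t \<partial>L) = 0" by (simp add: LIMSEQ_const_iff)
    moreover have "integrable L ?k"
      using borel_measurable_continuous_onI[OF k]
      by (intro L.integrable_const_bound[of _ 1]) (auto simp: infdist_nonneg)
    ultimately have "AE t in L. ?k t = 0"
      by (subst (asm) integral_nonneg_eq_0_iff_AE) (auto simp: infdist_nonneg)
    then show ?thesis
      by eventually_elim (use ne in \<open>auto simp: in_closed_iff_infdist_zero min_def split: if_splits\<close>)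
  qed
  \<comment> \<open>Any fixed point of the space serves as value off the closure, which carries no
    mass of \<open>L\<close>.\<close>
  define \<pi>' where "\<pi>' t = (if t \<in> ?K then \<pi> t else \<pi> (s undefined))" for t
  have \<pi>': "\<pi>' \<in> borel \<rightarrow>\<^sub>M borel"
    unfolding \<pi>'_def using \<pi>(1) by (intro borel_measurable_continuous_on_if) auto
  then have \<pi>'L: "\<pi>' \<in> L \<rightarrow>\<^sub>M borel" by simp
  show thesis
  proof (rule that[OF r, of "distr L borel \<pi>'"])
    show "prob_space (distr L borel \<pi>')" by (rule L.prob_space_distr[OF \<pi>'L])
    fix g :: "'a \<Rightarrow> real" assume g: "continuous_on UNIV g"
    have "bounded (range g)"
      using compact_continuous_image[OF g comp] compact_imp_bounded by blast
    then obtain B where B: "\<And>x. norm (g x) \<le> B" by (auto simp: bounded_iff)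
    have "0 \<le> B" using B[of undefined] norm_ge_zero order_trans by blast
    moreover have "continuous_on ?K (\<lambda>t. g (\<pi> t))"
      by (rule continuous_on_compose2[OF g \<pi>(1)]) simp
    \<comment> \<open>Weak convergence on the line tests with functions that are continuous
      everywhere, hence the Tietze extension; the same bound \<open>B\<close> keeps h
      admissible.\<close>
    ultimately obtain h where h: "continuous_on UNIV h" "\<And>t. t \<in> ?K \<Longrightarrow> h t = g (\<pi> t)" "\<And>t. norm (h t) \<le> B"
      using Tietze[of ?K "\<lambda>t. g (\<pi> t)" UNIV B] B by auto
    have "h (s x) = g x" for x
      using h(2)[of "s x"] closure_subset[of "range s"] \<pi>(2) by auto
    moreover have "(\<lambda>n. \<integral>x. h (s x) \<partial>M (r n)) \<longlonglongrightarrow> (\<integral>t. h t \<partial>L)"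
      using h by (intro conv[of _ B]) auto
    moreover have "(\<integral>t. h t \<partial>L) = (\<integral>t. g (\<pi>' t) \<partial>L)"
    proof (rule integral_cong_AE)
      show "h \<in> borel_measurable L" using borel_measurable_continuous_onI[OF h(1)] by simp
      show "(\<lambda>t. g (\<pi>' t)) \<in> borel_measurable L"
        using measurable_compose[OF \<pi>'L borel_measurable_continuous_onI[OF g]] .
      show "AE t in L. h t = g (\<pi>' t)"
        using AE_K by eventually_elim (simp add: \<pi>'_def h(2))
    qed
    ultimately show "(\<lambda>n. \<integral>x. g x \<partial>M (r n)) \<longlonglongrightarrow> (\<integral>x. g x \<partial>distr L borel \<pi>')"
      by (simp add: integral_distr[OF \<pi>'L borel_measurable_continuous_onI[OF g]])
  qed simp
qed

section \<open>Sets whose mass passes to weak limits\<close>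

text \<open>Plays the part of sets with null boundary in the portmanteau theorem. Squeezing the
  indicator between continuous functions makes stability under Boolean operations and preimages a
  matter of algebra, without any computation of boundaries.\<close>

definition jordan_measurable :: "'a::metric_space measure \<Rightarrow> 'a set \<Rightarrow> bool" where
  "jordan_measurable M A \<longleftrightarrow> A \<in> sets borel \<and>
     (\<forall>e>0. \<exists>g h. continuous_on UNIV g \<and> continuous_on UNIV h \<and>
        (\<forall>x. 0 \<le> g x \<and> g x \<le> indicator A x \<and> indicator A x \<le> h x \<and> h x \<le> 1) \<and>
        (\<integral>x. h x \<partial>M) - (\<integral>x. g x \<partial>M) < (e :: real))"

lemma jordan_measurable_borel: "jordan_measurable M A \<Longrightarrow> A \<in> sets borel"
  by (simp add: jordan_measurable_def)

lemma jordan_measurableE: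
  assumes "jordan_measurable M A" "0 < e"
  obtains g h where "continuous_on UNIV g" "continuous_on UNIV h"
    "\<And>x. 0 \<le> g x" "\<And>x. g x \<le> indicator A x" "\<And>x. indicator A x \<le> h x" "\<And>x. h x \<le> 1"
    "(\<integral>x. h x \<partial>M) - (\<integral>x. g x \<partial>M) < (e :: real)"
  using assms unfolding jordan_measurable_def by metis

locale compact_prob_space = prob_space M for M :: "'a::metric_space measure" +
  assumes comp: "compact (UNIV :: 'a set)" and sets_M: "sets M = sets borel"
begin

lemma integrable_cont: "continuous_on UNIV g \<Longrightarrow> integrable M (g :: 'a \<Rightarrow> real)"
  by (rule integrable_continuous_compact_space[OF comp finite_measure_axioms sets_M])

lemma space_M: "space M = UNIV"
  using sets_eq_imp_space_eq[OF sets_M] by simp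

lemma measurable_cont: "continuous_on UNIV g \<Longrightarrow> (g :: 'a \<Rightarrow> 'b::topological_space) \<in> M \<rightarrow>\<^sub>M borel"
  using borel_measurable_continuous_onI measurable_cong_sets[OF sets_M refl] by blast

lemma jordan_measurable_UNIV: "jordan_measurable M UNIV"
  unfolding jordan_measurable_def
  by (intro conjI allI impI exI[of _ "\<lambda>_. 1"]) auto

lemma jordan_measurable_Compl:
  assumes "jordan_measurable M A"
  shows "jordan_measurable M (- A)"
  unfolding jordan_measurable_def
proof (intro conjI allI impI)
  show "- A \<in> sets borel" using jordan_measurable_borel[OF assms] by (simp add: borel_comp)
  fix e :: real assume "0 < e"
  then obtain g h where gh: "continuous_on UNIV g" "continuous_on UNIV h"
    "\<And>x. 0 \<le> g x" "\<And>x. g x \<le> indicator A x" "\<And>x. indicator A x \<le> h x" "\<And>x. h x \<le> 1"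
    "(\<integral>x. h x \<partial>M) - (\<integral>x. g x \<partial>M) < e"
    using jordan_measurableE[OF assms] by metis
  show "\<exists>g h. continuous_on UNIV g \<and> continuous_on UNIV h \<and>
        (\<forall>x. 0 \<le> g x \<and> g x \<le> indicator (- A) x \<and> indicator (- A) x \<le> h x \<and> h x \<le> 1) \<and>
        (\<integral>x. h x \<partial>M) - (\<integral>x. g x \<partial>M) < e"
  proof (rule exI[of _ "\<lambda>x. 1 - h x"], rule exI[of _ "\<lambda>x. 1 - g x"], intro conjI allI)
    fix x
    show "0 \<le> 1 - h x" "1 - h x \<le> indicator (- A) x" "indicator (- A) x \<le> 1 - g x" "1 - g x \<le> 1"
      using gh(3-6)[of x] by (auto simp: indicator_def split: if_splits)
  qed (use gh integrable_cont in \<open>auto intro!: continuous_intros\<close>)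
qed

lemma jordan_measurable_Int:
  assumes "jordan_measurable M A" "jordan_measurable M B"
  shows "jordan_measurable M (A \<inter> B)"
  unfolding jordan_measurable_def
proof (intro conjI allI impI)
  show "A \<inter> B \<in> sets borel" using assms[THEN jordan_measurable_borel] by blast
  fix e :: real assume e: "0 < e"
  obtain g h where gh: "continuous_on UNIV g" "continuous_on UNIV h"
    "\<And>x. 0 \<le> g x" "\<And>x. g x \<le> indicator A x" "\<And>x. indicator A x \<le> h x" "\<And>x. h x \<le> 1"
    "(\<integral>x. h x \<partial>M) - (\<integral>x. g x \<partial>M) < e / 2"
    using jordan_measurableE[OF assms(1), of "e / 2"] e by (metis half_gt_zero)
  obtain g' h' where gh': "continuous_on UNIV g'" "continuous_on UNIV h'"
    "\<And>x. 0 \<le> g' x" "\<And>x. g' x \<le> indicator B x" "\<And>x. indicator B x \<le> h' x" "\<And>x. h' x \<le> 1"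
    "(\<integral>x. h' x \<partial>M) - (\<integral>x. g' x \<partial>M) < e / 2"
    using jordan_measurableE[OF assms(2), of "e / 2"] e by (metis half_gt_zero)
  note cont = gh(1,2) gh'(1,2)
  have bounds: "0 \<le> g x \<and> g x \<le> h x \<and> h x \<le> 1" "0 \<le> g' x \<and> g' x \<le> h' x \<and> h' x \<le> 1" for x
    using gh(3-6)[of x] gh'(3-6)[of x] by linarith+
  show "\<exists>g h. continuous_on UNIV g \<and> continuous_on UNIV h \<and>
        (\<forall>x. 0 \<le> g x \<and> g x \<le> indicator (A \<inter> B) x \<and> indicator (A \<inter> B) x \<le> h x \<and> h x \<le> 1) \<and>
        (\<integral>x. h x \<partial>M) - (\<integral>x. g x \<partial>M) < e"
  proof (rule exI[of _ "\<lambda>x. g x * g' x"], rule exI[of _ "\<lambda>x. h x * h' x"], intro conjI allI)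
    show "continuous_on UNIV (\<lambda>x. g x * g' x)" "continuous_on UNIV (\<lambda>x. h x * h' x)"
      by (intro continuous_intros cont)+
    fix x
    show "0 \<le> g x * g' x" "h x * h' x \<le> 1"
      using bounds[of x] by (auto intro: mult_le_one)
    have "g x * g' x \<le> indicator A x * indicator B x"
      using gh(3,4) gh'(3,4) by (intro mult_mono) auto
    then show "g x * g' x \<le> indicator (A \<inter> B) x" by (simp add: indicator_inter_arith)
    have "indicator A x * indicator B x \<le> h x * h' x"
      using bounds[of x] gh(5) gh'(5) by (intro mult_mono) auto
    then show "indicator (A \<inter> B) x \<le> h x * h' x" by (simp add: indicator_inter_arith)
  next
    \<comment> \<open>The factors lie between 0 and 1, so the gap of the products is at most the sum
      of the two gaps.\<close>
    have "h x * h' x - g x * g' x \<le> (h x - g x) + (h' x - g' x)" for x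
    proof -
      have "h x * h' x - g x * g' x = h x * (h' x - g' x) + g' x * (h x - g x)"
        by (simp add: algebra_simps)
      also have "\<dots> \<le> (h' x - g' x) + (h x - g x)"
        using bounds[of x] by (intro add_mono mult_left_le_one_le) auto
      finally show ?thesis by simp
    qed
    then have "(\<integral>x. h x * h' x - g x * g' x \<partial>M) \<le> (\<integral>x. (h x - g x) + (h' x - g' x) \<partial>M)"
      by (intro integral_mono integrable_cont continuous_intros cont)
    moreover have "(\<integral>x. h x * h' x - g x * g' x \<partial>M) = (\<integral>x. h x * h' x \<partial>M) - (\<integral>x. g x * g' x \<partial>M)"
      by (intro Bochner_Integration.integral_diff integrable_cont continuous_intros cont)
    moreover have "(\<integral>x. (h x - g x) + (h' x - g' x) \<partial>M) =
        ((\<integral>x. h x \<partial>M) - (\<integral>x. g x \<partial>M)) + ((\<integral>x. h' x \<partial>M) - (\<integral>x. g' x \<partial>M))"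
      by (simp add: integrable_cont cont)
    ultimately show "(\<integral>x. h x * h' x \<partial>M) - (\<integral>x. g x * g' x \<partial>M) < e"
      using gh(7) gh'(7) by linarith
  qed
qed

lemma jordan_measurable_finite_INT:
  assumes "finite I" "\<And>i. i \<in> I \<Longrightarrow> jordan_measurable M (A i)"
  shows "jordan_measurable M (\<Inter>i\<in>I. A i)"
  using assms by (induction I) (auto intro: jordan_measurable_UNIV jordan_measurable_Int)

lemma jordan_measurable_finite_UN:
  assumes "finite I" "\<And>i. i \<in> I \<Longrightarrow> jordan_measurable M (A i)"
  shows "jordan_measurable M (\<Union>i\<in>I. A i)"
proof -
  have "jordan_measurable M (- (\<Inter>i\<in>I. - A i))"
    using assms by (intro jordan_measurable_Compl jordan_measurable_finite_INT)
  then show ?thesis by simp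
qed

text \<open>Composing both bounding functions with f leaves their integrals unchanged, since M is
  invariant.\<close>

lemma jordan_measurable_vimage:
  assumes f: "continuous_on UNIV f" "distr M borel f = M" and A: "jordan_measurable M A"
  shows "jordan_measurable M (f -` A)"
  unfolding jordan_measurable_def
proof (intro conjI allI impI)
  show "f -` A \<in> sets borel"
    using measurable_sets[OF borel_measurable_continuous_onI[OF f(1)] jordan_measurable_borel[OF A]] by simp
  fix e :: real assume "0 < e"
  then obtain g h where gh: "continuous_on UNIV g" "continuous_on UNIV h"
    "\<And>x. 0 \<le> g x" "\<And>x. g x \<le> indicator A x" "\<And>x. indicator A x \<le> h x" "\<And>x. h x \<le> 1"
    "(\<integral>x. h x \<partial>M) - (\<integral>x. g x \<partial>M) < e"
    using jordan_measurableE[OF A] by metis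
  have "(\<integral>x. k (f x) \<partial>M) = (\<integral>x. k x \<partial>M)" if "continuous_on UNIV k" for k :: "'a \<Rightarrow> real"
    using integral_distr[OF measurable_cont[OF f(1)] borel_measurable_continuous_onI[OF that]] f(2) by simp
  moreover have "continuous_on UNIV (\<lambda>x. k (f x))" if "continuous_on UNIV k" for k :: "'a \<Rightarrow> real"
    by (rule continuous_on_compose2[OF that f(1)]) simp
  ultimately show "\<exists>g h. continuous_on UNIV g \<and> continuous_on UNIV h \<and>
        (\<forall>x. 0 \<le> g x \<and> g x \<le> indicator (f -` A) x \<and> indicator (f -` A) x \<le> h x \<and> h x \<le> 1) \<and>
        (\<integral>x. h x \<partial>M) - (\<integral>x. g x \<partial>M) < e"
    using gh by (rule_tac exI[of _ "\<lambda>x. g (f x)"], rule_tac exI[of _ "\<lambda>x. h (f x)"]) (simp add: indicator_vimage o_def)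
qed

text \<open>Piecewise linear cut-offs of the distance just inside and just outside the radius; their
  difference tends to the indicator of the sphere, which is null.\<close>

lemma jordan_measurable_ball:
  assumes null: "measure M {z. dist x z = r} = 0"
  shows "jordan_measurable M (ball x r)"
  unfolding jordan_measurable_def
proof (intro conjI allI impI)
  show "ball x r \<in> sets borel" by simp
  define h where "h k z = max 0 (min 1 (1 - real k * (dist x z - r)))" for k z
  define g where "g k z = max 0 (min 1 (real k * (r - dist x z)))" for k z
  have cont: "continuous_on UNIV (h k)" "continuous_on UNIV (g k)" for k
    unfolding h_def g_def by (intro continuous_intros)+
  have bounds: "0 \<le> g k z" "g k z \<le> indicator (ball x r) z" "indicator (ball x r) z \<le> h k z" "h k z \<le> 1" for k z
  proof -
    show "0 \<le> g k z" "h k z \<le> 1" by (auto simp: g_def h_def)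
    show "g k z \<le> indicator (ball x r) z"
      using mult_nonneg_nonpos[of "real k" "r - dist x z"] by (cases "dist x z < r") (auto simp: g_def)
    show "indicator (ball x r) z \<le> h k z"
      using mult_nonneg_nonpos[of "real k" "dist x z - r"] by (cases "dist x z < r") (auto simp: h_def)
  qed
  have lim: "(\<lambda>k. h k z - g k z) \<longlonglongrightarrow> indicator {z. dist x z = r} z" for z
  proof (cases "dist x z = r")
    case True
    then show ?thesis by (simp add: h_def g_def)
  next
    case False
    then have pos: "0 < \<bar>dist x z - r\<bar>" by simp
    obtain K where K: "1 < real K * \<bar>dist x z - r\<bar>" using reals_Archimedean3[OF pos] by blast
    have "h k z - g k z = 0" if "K \<le> k" for k
    proof -
      have "real K * \<bar>dist x z - r\<bar> \<le> real k * \<bar>dist x z - r\<bar>" using that by (intro mult_right_mono) auto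
      with K have 1: "1 < real k * \<bar>dist x z - r\<bar>" by linarith
      show ?thesis
      proof (cases "dist x z < r")
        case True
        then have "1 < real k * (r - dist x z)" using 1 by simp
        moreover from this have "real k * (dist x z - r) < 0" by (simp add: algebra_simps)
        ultimately show ?thesis by (simp add: h_def g_def)
      next
        case F: False
        then have "1 < real k * (dist x z - r)" using 1 by simp
        moreover from this have "real k * (r - dist x z) < 0" by (simp add: algebra_simps)
        ultimately show ?thesis by (simp add: h_def g_def)
      qed
    qed
    then have "\<forall>\<^sub>F k in sequentially. h k z - g k z = indicator {z. dist x z = r} z"
      using False by (auto simp: eventually_sequentially)
    then show ?thesis by (rule tendsto_eventually)
  qed
  have sphere: "{z. dist x z = r} \<in> sets M"
    unfolding sets_M by (intro borel_closed closed_Collect_eq continuous_intros)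
  have "(\<lambda>k. \<integral>z. h k z - g k z \<partial>M) \<longlonglongrightarrow> (\<integral>z. indicator {z. dist x z = r} z \<partial>M)"
  proof (rule integral_dominated_convergence[where w = "\<lambda>_. 1"])
    show "(\<lambda>z. h k z - g k z) \<in> borel_measurable M" for k
      by (intro measurable_cont continuous_intros cont)
    have "norm (h k z - g k z) \<le> 1" for k z
      using bounds(1)[of k z] bounds(2)[of k z] bounds(3)[of z k] bounds(4)[of k z] by (simp add: indicator_def split: if_splits)
    then show "AE z in M. norm (h k z - g k z) \<le> 1" for k by simp
  qed (use lim sphere in auto)
  then have lim0: "(\<lambda>k. \<integral>z. h k z - g k z \<partial>M) \<longlonglongrightarrow> 0"
    using null sphere by (simp add: space_M)
  fix e :: real assume "0 < e"
  then obtain k where "(\<integral>z. h k z - g k z \<partial>M) < e"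
    using order_tendstoD(2)[OF lim0] by (auto simp: eventually_sequentially)
  then have "(\<integral>z. h k z \<partial>M) - (\<integral>z. g k z \<partial>M) < e" by (simp add: integrable_cont cont)
  then show "\<exists>g h. continuous_on UNIV g \<and> continuous_on UNIV h \<and>
        (\<forall>z. 0 \<le> g z \<and> g z \<le> indicator (ball x r) z \<and> indicator (ball x r) z \<le> h z \<and> h z \<le> 1) \<and>
        (\<integral>x. h x \<partial>M) - (\<integral>x. g x \<partial>M) < e"
    using cont bounds by (rule_tac exI[of _ "g k"], rule_tac exI[of _ "h k"]) auto
qed

text \<open>Only countably many spheres about a given centre have positive mass, since these are
  atoms of the law of the distance. So null radii exist between e / 4 and e / 2: large enough that
  finitely many balls cover, small enough for diameter below e. The balls are then made disjoint in
  order.\<close>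

lemma jordan_measurable_small_partition:
  assumes e: "0 < e"
  obtains P where "finite P" "partition_on UNIV P" "\<And>A. A \<in> P \<Longrightarrow> jordan_measurable M A"
    "\<And>A u v. A \<in> P \<Longrightarrow> u \<in> A \<Longrightarrow> v \<in> A \<Longrightarrow> dist u v < e"
proof -
  have "\<exists>r. e / 4 < r \<and> r < e / 2 \<and> measure M {z. dist x z = r} = 0" for x
  proof -
    have d: "dist x \<in> M \<rightarrow>\<^sub>M borel" by (intro measurable_cont continuous_intros)
    interpret N: finite_measure "distr M borel (dist x)" by (rule finite_measure_distr[OF d])
    have "\<exists>r\<in>{e / 4<..<e / 2}. r \<notin> {r. measure (distr M borel (dist x)) {r} \<noteq> 0}"
      using open_minus_countable[OF N.countable_support, of "{e / 4<..<e / 2}"] e by auto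
    then obtain r where r: "r \<in> {e / 4<..<e / 2}" "measure (distr M borel (dist x)) {r} = 0" by blast
    have "dist x -` {r} \<inter> space M = {z. dist x z = r}" by (auto simp: space_M)
    then have "measure M {z. dist x z = r} = 0" using r(2) d by (simp add: measure_distr)
    then show ?thesis using r(1) by auto
  qed
  then obtain r where r: "\<And>x. e / 4 < r x" "\<And>x. r x < e / 2" "\<And>x. measure M {z. dist x z = r x} = 0"
    by metis
  obtain C :: "'a set" where C: "finite C" "\<And>x. \<exists>c\<in>C. dist c x < e / 4"
    using compact_finite_ball_cover[OF comp, of "e / 4"] e by auto
  obtain xs where xs: "set xs = C" using finite_list[OF C(1)] by blast
  define B where "B i = (if i < length xs then ball (xs ! i) (r (xs ! i)) else {})" for i
  have "jordan_measurable M {}" using jordan_measurable_Compl[OF jordan_measurable_UNIV] by simp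
  then have B: "jordan_measurable M (B i)" for i
    unfolding B_def using r(3) by (simp add: jordan_measurable_ball)
  have D: "jordan_measurable M (disjointed B i)" for i
  proof -
    have "disjointed B i = B i \<inter> - (\<Union>j\<in>{0..<i}. B j)" by (auto simp: disjointed_def)
    then show ?thesis
      by (simp only:) (intro jordan_measurable_Int jordan_measurable_Compl jordan_measurable_finite_UN B finite_atLeastLessThan)
  qed
  have sub: "disjointed B i \<subseteq> B i" for i by (auto simp: disjointed_def)
  have U: "(\<Union>i. disjointed B i) = UNIV"
  proof -
    have "\<exists>i. x \<in> B i" for x
    proof -
      obtain c where c: "c \<in> C" "dist c x < e / 4" using C(2) by blast
      then obtain i where "i < length xs" "xs ! i = c" using xs by (metis in_set_conv_nth)
      then show ?thesis using c r(1)[of c] by (intro exI[of _ i]) (auto simp: B_def)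
    qed
    then show ?thesis by (auto simp: UN_disjointed_eq)
  qed
  define P where "P = disjointed B ` {..<length xs} - {{}}"
  show thesis
  proof (rule that[of P])
    show "finite P" by (simp add: P_def)
    show "partition_on UNIV P"
    proof (rule partition_onI)
      have "disjointed B i = {}" if "\<not> i < length xs" for i using sub[of i] that by (auto simp: B_def)
      then have "\<exists>i<length xs. x \<in> disjointed B i" for x
        using U by (metis UN_E UNIV_I empty_iff)
      then show "\<Union> P = UNIV" unfolding P_def by blast
      fix A A' assume "A \<in> P" "A' \<in> P" "A \<noteq> A'"
      then obtain i i' where "A = disjointed B i" "A' = disjointed B i'" "i \<noteq> i'" by (auto simp: P_def)
      then show "disjnt A A'"
        using disjoint_family_disjointed[of B] by (auto simp: disjoint_family_on_def disjnt_def)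
    qed (simp add: P_def)
    show "jordan_measurable M A" if "A \<in> P" for A using that D by (auto simp: P_def)
    fix A u v assume "A \<in> P" "u \<in> A" "v \<in> A"
    then obtain i where "u \<in> B i" "v \<in> B i" using sub by (force simp: P_def)
    then have "dist (xs ! i) u < r (xs ! i)" "dist (xs ! i) v < r (xs ! i)"
      by (auto simp: B_def split: if_splits)
    then show "dist u v < e"
      using r(2)[of "xs ! i"] dist_triangle[of u v "xs ! i"] by (simp add: dist_commute)
  qed
qed

lemma jordan_measurable_cylinder:
  assumes f: "continuous_on UNIV f" "distr M borel f = M"
    and P: "partition_on UNIV P" "\<And>A. A \<in> P \<Longrightarrow> jordan_measurable M A"
  shows "jordan_measurable M {x. itinerary f P n x = w}"
proof (cases "w \<in> words P n")
  case True
  have "jordan_measurable M ((f ^^ i) -` A)" if "A \<in> P" for i A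
  proof (induction i)
    case (Suc i)
    have "(f ^^ Suc i) -` A = f -` ((f ^^ i) -` A)"
      by (subst funpow_Suc_right) (auto simp: vimage_def)
    then show ?case using jordan_measurable_vimage[OF f Suc] by (simp only:)
  qed (use P(2) that in simp)
  then have "jordan_measurable M (\<Inter>i\<in>{..<n}. (f ^^ i) -` (w ! i))"
    using words_nth[OF True] by (intro jordan_measurable_finite_INT) auto
  moreover have "{x. itinerary f P n x = w} = (\<Inter>i\<in>{..<n}. (f ^^ i) -` (w ! i))"
    using itinerary_eq_iff[OF P(1) True, of f] by auto
  ultimately show ?thesis by simp
next
  case False
  then have "{x. itinerary f P n x = w} = - UNIV" using itinerary_in_words[OF P(1)] by auto
  then show ?thesis using jordan_measurable_Compl[OF jordan_measurable_UNIV] by simp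
qed

text \<open>The two bounding integrals converge and enclose the mass of A both along the sequence
  and in the limit.\<close>

lemma jordan_measurable_tendsto:
  assumes N: "\<And>n. prob_space (N n)" "\<And>n. sets (N n) = sets borel"
    and conv: "\<And>g :: 'a \<Rightarrow> real. continuous_on UNIV g \<Longrightarrow> (\<lambda>n. \<integral>x. g x \<partial>N n) \<longlonglongrightarrow> (\<integral>x. g x \<partial>M)"
    and A: "jordan_measurable M A"
  shows "(\<lambda>n. measure (N n) A) \<longlonglongrightarrow> measure M A"
proof (rule tendstoI)
  fix e :: real assume "0 < e"
  then obtain g h where gh: "continuous_on UNIV g" "continuous_on UNIV h"
    "\<And>x. 0 \<le> g x" "\<And>x. g x \<le> indicator A x" "\<And>x. indicator A x \<le> h x" "\<And>x. h x \<le> 1"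
    "(\<integral>x. h x \<partial>M) - (\<integral>x. g x \<partial>M) < e / 2"
    using jordan_measurableE[OF A, of "e / 2"] by (metis half_gt_zero)
  have sandwich: "(\<integral>x. g x \<partial>L) \<le> measure L A \<and> measure L A \<le> (\<integral>x. h x \<partial>L)"
    if "prob_space L" "sets L = sets borel" for L
  proof -
    interpret L: prob_space L by fact
    note i = integrable_continuous_compact_space[OF comp L.finite_measure_axioms that(2)]
    have A': "A \<in> sets L" using jordan_measurable_borel[OF A] that(2) by simp
    then have ind: "integrable L (indicator A :: 'a \<Rightarrow> real)" by (simp add: L.emeasure_finite less_top[symmetric])
    have "(\<integral>x. g x \<partial>L) \<le> (\<integral>x. indicator A x \<partial>L)" "(\<integral>x. indicator A x \<partial>L) \<le> (\<integral>x. h x \<partial>L)"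
      by (rule integral_mono; use i gh ind in simp)+
    then show ?thesis using A' by (simp add: sets_eq_imp_space_eq[OF that(2)])
  qed
  have "\<forall>\<^sub>F n in sequentially. \<bar>(\<integral>x. g x \<partial>N n) - (\<integral>x. g x \<partial>M)\<bar> < e / 2"
    "\<forall>\<^sub>F n in sequentially. \<bar>(\<integral>x. h x \<partial>N n) - (\<integral>x. h x \<partial>M)\<bar> < e / 2"
    using tendstoD[OF conv[OF gh(1)], of "e / 2"] tendstoD[OF conv[OF gh(2)], of "e / 2"] \<open>0 < e\<close>
    by (auto simp: dist_real_def)
  then show "\<forall>\<^sub>F n in sequentially. dist (measure (N n) A) (measure M A) < e"
  proof eventually_elim
    case (elim n)
    then show ?case
      using sandwich[OF N, of n] sandwich[OF prob_space_axioms sets_M] gh(7)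
      unfolding dist_real_def by linarith
  qed
qed

end

section \<open>Separated sets and pressure\<close>

text \<open>Each time p is hit at most once as j + i * q, j being its remainder modulo q. Times that
  start no full block are lost, whence the inequality and the need for nonnegative terms.\<close>

lemma sum_blocks_le:
  fixes g :: "nat \<Rightarrow> real"
  assumes "1 \<le> q" "\<And>p. 0 \<le> g p"
  shows "(\<Sum>j<q. \<Sum>i<(n - j) div q. g (j + i * q)) \<le> (\<Sum>p<n. g p)"
proof -
  let ?I = "SIGMA j:{..<q}. {..<(n - j) div q}" and ?h = "\<lambda>(j, i). j + i * q"
  have inj: "inj_on ?h ?I"
  proof (rule inj_onI, clarsimp)
    fix j i j' i' assume "j < q" "j' < q" "j + i * q = j' + i' * q"
    moreover from this have "j = j'" by (metis mod_less mod_mult_self1)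
    ultimately show "j = j' \<and> i = i'" by auto
  qed
  have "(\<Sum>j<q. \<Sum>i<(n - j) div q. g (j + i * q)) = (\<Sum>x\<in>?I. g (?h x))"
    by (subst sum.Sigma) (auto simp: case_prod_beta)
  also have "\<dots> = (\<Sum>p\<in>?h ` ?I. g p)" using inj by (simp add: sum.reindex)
  also have "\<dots> \<le> (\<Sum>p<n. g p)"
  proof (intro sum_mono2)
    show "?h ` ?I \<subseteq> {..<n}"
    proof clarsimp
      fix j i assume *: "j < q" "i < (n - j) div q"
      then have "Suc i * q \<le> (n - j) div q * q" by (intro mult_right_mono) auto
      also have "\<dots> \<le> n - j" by simp
      finally show "j + i * q < n" using * assms(1) by simp
    qed
  qed (use assms in auto)
  finally show ?thesis .
qed

lemma sum_words_const:
  assumes "finite P" "P \<noteq> {}"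
  shows "(\<Sum>w\<in>words P m. (1 / real (card P)) ^ m) = 1"
proof -
  have "real (card P) \<noteq> 0" using assms by simp
  then have "real (card P) ^ m * (1 / real (card P)) ^ m = 1"
    by (simp add: power_mult_distrib[symmetric])
  then show ?thesis using assms by (simp add: card_words)
qed

text \<open>Independent blocks of length q with common law \<rho>; the induction splits off the last
  block.\<close>

lemma sum_words_blocks_le:
  fixes \<rho> :: "'b list \<Rightarrow> real"
  assumes P: "finite P" and \<rho>: "\<And>w. w \<in> words P q \<Longrightarrow> 0 \<le> \<rho> w" "(\<Sum>w\<in>words P q. \<rho> w) \<le> 1"
  shows "(\<Sum>w\<in>words P (r * q). \<Prod>i<r. \<rho> (take q (drop (i * q) w))) \<le> 1"
proof (induction r)
  case 0
  have "words P 0 = {[]}" by (auto simp: words_def)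
  then show ?case by simp
next
  case (Suc r)
  let ?B = "\<lambda>r w. \<Prod>i<r. \<rho> (take q (drop (i * q) w))"
  have nonneg: "0 \<le> ?B r w" if w: "w \<in> words P (r * q)" for w
  proof (intro prod_nonneg \<rho>(1))
    fix i assume "i \<in> {..<r}"
    then have "Suc i * q \<le> r * q" by (intro mult_right_mono) auto
    then show "take q (drop (i * q) w) \<in> words P q"
      using w by (auto simp: words_def dest!: in_set_takeD in_set_dropD)
  qed
  have "(\<Sum>w\<in>words P (Suc r * q). ?B (Suc r) w) =
      (\<Sum>w\<in>words P (r * q + q). ?B r (take (r * q) w) * \<rho> (drop (r * q) w))"
  proof (rule sum.cong)
    fix w assume w: "w \<in> words P (r * q + q)"
    have "take q (drop (i * q) (take (r * q) w)) = take q (drop (i * q) w)" if "i < r" for i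
    proof -
      have "Suc i * q \<le> r * q" using that by (intro mult_right_mono) auto
      then have "q \<le> r * q - i * q" by simp
      then show ?thesis by (simp add: drop_take min_def)
    qed
    then have "?B r (take (r * q) w) = ?B r w" by (intro prod.cong) auto
    moreover have "take q (drop (r * q) w) = drop (r * q) w" using w by (simp add: words_def)
    ultimately show "?B (Suc r) w = ?B r (take (r * q) w) * \<rho> (drop (r * q) w)" by simp
  qed (simp add: add.commute)
  also have "\<dots> \<le> 1"
    by (rule sum_words_append_le[OF P nonneg \<rho>(1) Suc \<rho>(2)])
  finally show ?case .
qed

text \<open>Comparison of the weights with product weights along blocks of length \<open>q\<close> starting at offset
  \<open>j\<close>, averaged over \<open>j < q\<close>: this replaces the subadditivity argument of Misiurewicz.\<close>

lemma entropy_block_bound: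
  fixes f :: "'a \<Rightarrow> 'a" and wt :: "'a \<Rightarrow> real" and \<rho> :: "'a set list \<Rightarrow> real"
  assumes P: "finite P" "partition_on UNIV P"
    and E: "finite E" "inj_on (itinerary f P n) E"
    and wt: "\<And>y. y \<in> E \<Longrightarrow> 0 \<le> wt y" "(\<Sum>y\<in>E. wt y) = 1"
    and \<rho>: "\<And>w. w \<in> words P q \<Longrightarrow> 0 < \<rho> w" "(\<Sum>w\<in>words P q. \<rho> w) \<le> 1"
    and q: "1 \<le> q" "q \<le> n"
  shows "real q * - (\<Sum>y\<in>E. wt y * ln (wt y)) \<le>
    (\<Sum>y\<in>E. wt y * (\<Sum>p<n. - ln (\<rho> (itinerary f P q ((f ^^ p) y))))) + 2 * real q * real q * ln (real (card P))"
proof -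
  define k where "k = real (card P)"
  define \<phi> where "\<phi> x = - ln (\<rho> (itinerary f P q x))" for x
  define H where "H = - (\<Sum>y\<in>E. wt y * ln (wt y))"
  have ne: "P \<noteq> {}" using part_label_mem(1)[OF P(2)] by auto
  then have k: "1 \<le> k" unfolding k_def using P(1) by (simp add: Suc_le_eq card_gt_0_iff)
  have \<rho>1: "\<rho> w \<le> 1" if "w \<in> words P q" for w
    using member_le_sum[of w "words P q" \<rho>] that \<rho> P(1) by (auto intro: less_imp_le order_trans)
  have \<phi>: "0 \<le> \<phi> x" for x
    unfolding \<phi>_def using \<rho>(1) \<rho>1 itinerary_in_words[OF P(2), of f q x] by (simp add: ln_le_zero_iff)
  have j_bound: "H \<le> (\<Sum>y\<in>E. wt y * (\<Sum>i<(n - j) div q. \<phi> ((f ^^ (j + i * q)) y))) + 2 * real q * ln k"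
    if j: "j < q" for j
  proof -
    \<comment> \<open>After the offset j there is room for r full blocks, and t letters are left
      over at the end.\<close>
    define r where "r = (n - j) div q"
    define t where "t = (n - j) mod q"
    have n: "n = j + (r * q + t)" using j q by (simp add: r_def t_def)
    define B where "B w = (\<Prod>i<r. \<rho> (take q (drop (i * q) w)))" for w
    \<comment> \<open>Uniform letters on the incomplete ends and law \<rho> on each full block. The
      ends have fewer than 2 * q letters and cost at most ln k each, which is the error term for one
      offset.\<close>
    define Q where "Q w = (1 / k) ^ j * (B (take (r * q) (drop j w)) * (1 / k) ^ t)" for w
    have B_nonneg: "0 \<le> B w" if w: "w \<in> words P (r * q)" for w
      unfolding B_def
    proof (intro prod_nonneg less_imp_le[OF \<rho>(1)])
      fix i assume "i \<in> {..<r}"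
      then have "Suc i * q \<le> r * q" by (intro mult_right_mono) auto
      then show "take q (drop (i * q) w) \<in> words P q"
        using w by (auto simp: words_def dest!: in_set_takeD in_set_dropD)
    qed
    have 1: "(\<Sum>w\<in>words P (r * q + t). B (take (r * q) w) * (1 / k) ^ t) \<le> 1"
    proof (rule sum_words_append_le[where m = "r * q" and n = t and u = B and v = "\<lambda>_. (1 / k) ^ t", OF P(1) B_nonneg])
      show "(\<Sum>w\<in>words P (r * q). B w) \<le> 1"
        unfolding B_def using \<rho> by (intro sum_words_blocks_le[OF P(1)]) (auto intro: less_imp_le)
      show "(\<Sum>w\<in>words P t. (1 / k) ^ t) \<le> 1" unfolding k_def sum_words_const[OF P(1) ne] by simp
    qed (use k in auto)
    have take_in: "take (r * q) w \<in> words P (r * q)" if "w \<in> words P (r * q + t)" for w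
      using that by (auto simp: words_def dest: in_set_takeD)
    have sumQ: "(\<Sum>w\<in>words P n. Q w) \<le> 1"
      unfolding Q_def n
    proof (rule sum_words_append_le[where m = j and u = "\<lambda>_. (1 / k) ^ j" and n = "r * q + t"
          and v = "\<lambda>w. B (take (r * q) w) * (1 / k) ^ t", OF P(1)])
      show "(\<Sum>w\<in>words P j. (1 / k) ^ j) \<le> 1" unfolding k_def sum_words_const[OF P(1) ne] by simp
    qed (use k 1 B_nonneg take_in in auto)
    have Q_it: "Q (itinerary f P n y) = (1 / k) ^ j * ((\<Prod>i<r. \<rho> (itinerary f P q ((f ^^ (j + i * q)) y))) * (1 / k) ^ t)" for y
    proof -
      have "take (r * q) (drop j (itinerary f P n y)) = itinerary f P (r * q) ((f ^^ j) y)"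
        using n by (intro take_drop_itinerary) simp
      moreover have "take q (drop (i * q) (itinerary f P (r * q) ((f ^^ j) y))) = itinerary f P q ((f ^^ (j + i * q)) y)"
        if "i < r" for i
      proof -
        have "Suc i * q \<le> r * q" using that by (intro mult_right_mono) auto
        then have "take q (drop (i * q) (itinerary f P (r * q) ((f ^^ j) y))) = itinerary f P q ((f ^^ (i * q)) ((f ^^ j) y))"
          by (intro take_drop_itinerary) simp
        also have "(f ^^ (i * q)) ((f ^^ j) y) = (f ^^ (j + i * q)) y"
          by (simp add: add.commute[of j] funpow_add)
        finally show ?thesis .
      qed
      ultimately show ?thesis by (simp add: Q_def B_def)
    qed
    have \<rho>_pos: "0 < \<rho> (itinerary f P q x)" for x using \<rho>(1) itinerary_in_words[OF P(2)] by blast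
    then have Q_pos: "0 < Q (itinerary f P n y)" for y
      unfolding Q_it using k by (intro mult_pos_pos prod_pos) auto
    have ln_Q: "- ln (Q (itinerary f P n y)) \<le> (\<Sum>i<r. \<phi> ((f ^^ (j + i * q)) y)) + 2 * real q * ln k" for y
    proof -
      let ?X = "\<Prod>i<r. \<rho> (itinerary f P q ((f ^^ (j + i * q)) y))"
      have X: "0 < ?X" using \<rho>_pos by (intro prod_pos) auto
      have lnX: "ln ?X = (\<Sum>i<r. ln (\<rho> (itinerary f P q ((f ^^ (j + i * q)) y))))"
        by (rule ln_prod[OF finite_lessThan]) (metis \<rho>_pos less_irrefl)
      have "ln (Q (itinerary f P n y)) = real j * ln (1 / k) + ((\<Sum>i<r. ln (\<rho> (itinerary f P q ((f ^^ (j + i * q)) y)))) + real t * ln (1 / k))"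
        unfolding Q_it using k X by (simp add: ln_mult_pos ln_realpow lnX)
      then have "- ln (Q (itinerary f P n y)) = real (j + t) * ln k + (\<Sum>i<r. \<phi> ((f ^^ (j + i * q)) y))"
        using k by (simp add: \<phi>_def ln_div sum_negf algebra_simps)
      moreover have "t < q" unfolding t_def using q by simp
      then have "real (j + t) * ln k \<le> (2 * real q) * ln k"
        using j k by (intro mult_right_mono) auto
      ultimately show ?thesis by simp
    qed
    have "H \<le> - (\<Sum>y\<in>E. wt y * ln (Q (itinerary f P n y)))"
      unfolding H_def
    proof (rule cross_entropy_le)
      \<comment> \<open>Injectivity of the itinerary turns the law \<open>Q\<close> on words into a
        subprobability law on \<open>E\<close>.\<close>
      have "(\<Sum>y\<in>E. Q (itinerary f P n y)) = (\<Sum>w\<in>itinerary f P n ` E. Q w)"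
        using E by (simp add: sum.reindex)
      also have "\<dots> \<le> (\<Sum>w\<in>words P n. Q w)"
      proof (rule sum_mono2)
        fix w assume "w \<in> words P n - itinerary f P n ` E"
        then have "drop j w \<in> words P (r * q + t)" using n by (auto simp: words_def dest: in_set_dropD)
        then show "0 \<le> Q w" unfolding Q_def using k B_nonneg[OF take_in] by simp
      qed (use P itinerary_in_words[OF P(2)] in auto)
      finally show "(\<Sum>y\<in>E. Q (itinerary f P n y)) \<le> (\<Sum>y\<in>E. wt y)" using sumQ wt(2) by simp
    qed (use wt(1) Q_pos less_imp_le[OF Q_pos] in simp_all)
    also have "\<dots> = (\<Sum>y\<in>E. wt y * - ln (Q (itinerary f P n y)))" by (simp add: sum_negf)
    also have "\<dots> \<le> (\<Sum>y\<in>E. wt y * ((\<Sum>i<r. \<phi> ((f ^^ (j + i * q)) y)) + 2 * real q * ln k))"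
      using ln_Q wt(1) by (intro sum_mono mult_left_mono) auto
    also have "\<dots> = (\<Sum>y\<in>E. wt y * (\<Sum>i<r. \<phi> ((f ^^ (j + i * q)) y))) + 2 * real q * ln k"
      using wt(2) by (simp add: distrib_left sum.distrib sum_distrib_right[symmetric])
    finally show ?thesis unfolding r_def .
  qed
  have "real q * H = (\<Sum>j<q. H)" by simp
  also have "\<dots> \<le> (\<Sum>j<q. (\<Sum>y\<in>E. wt y * (\<Sum>i<(n - j) div q. \<phi> ((f ^^ (j + i * q)) y))) + 2 * real q * ln k)"
    using j_bound by (intro sum_mono) auto
  also have "\<dots> = (\<Sum>y\<in>E. wt y * (\<Sum>j<q. \<Sum>i<(n - j) div q. \<phi> ((f ^^ (j + i * q)) y))) + 2 * real q * real q * ln k"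
    by (simp add: sum.distrib sum_distrib_left) (subst sum.swap, simp)
  also have "\<dots> \<le> (\<Sum>y\<in>E. wt y * (\<Sum>p<n. \<phi> ((f ^^ p) y))) + 2 * real q * real q * ln k"
    using wt(1) \<phi> q by (intro add_right_mono sum_mono mult_left_mono sum_blocks_le) auto
  finally show ?thesis unfolding H_def \<phi>_def k_def .
qed

section \<open>From separated sets to an invariant measure\<close>

text \<open>The image of a point measure on pairs (point, time). Pairs are used because orbit
  segments may overlap, and then their masses add up.\<close>

lemma empirical_measure_exists:
  fixes f :: "'a::metric_space \<Rightarrow> 'a" and wt :: "'a \<Rightarrow> real"
  assumes "finite E" "\<And>y. y \<in> E \<Longrightarrow> 0 \<le> wt y" "(\<Sum>y\<in>E. wt y) = 1" "1 \<le> n"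
  obtains M where "prob_space M" "sets M = sets borel"
    "\<And>g :: 'a \<Rightarrow> real. g \<in> borel_measurable borel \<Longrightarrow>
      (\<integral>x. g x \<partial>M) = (\<Sum>y\<in>E. wt y * (\<Sum>i<n. g ((f ^^ i) y))) / real n"
proof -
  let ?S = "E \<times> {..<n}"
  define p where "p = (\<lambda>(y, i :: nat). wt y / real n)"
  define L where "L = point_measure ?S p"
  let ?h = "\<lambda>(y, i). (f ^^ i) y"
  have p: "0 \<le> p s" if "s \<in> ?S" for s using that assms(2) by (auto simp: p_def)
  have "(\<Sum>s\<in>?S. p s) = 1"
    unfolding p_def sum.cartesian_product[symmetric] using assms(3,4) by simp
  then have L: "prob_space L" unfolding L_def using assms(1) p by (intro prob_space_point_measure) auto
  have h: "?h \<in> L \<rightarrow>\<^sub>M borel" unfolding L_def by (simp add: measurable_point_measure_eq1)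
  show thesis
  proof (rule that[of "distr L borel ?h"])
    show "prob_space (distr L borel ?h)" by (rule prob_space.prob_space_distr[OF L h])
    fix g :: "'a \<Rightarrow> real" assume g: "g \<in> borel_measurable borel"
    have "(\<integral>x. g x \<partial>distr L borel ?h) = (\<Sum>s\<in>?S. p s * g (?h s))"
      unfolding integral_distr[OF h g] unfolding L_def
      using assms(1) p by (subst lebesgue_integral_point_measure_finite) auto
    also have "\<dots> = (\<Sum>y\<in>E. \<Sum>i<n. wt y / real n * g ((f ^^ i) y))"
      by (subst sum.cartesian_product) (simp add: p_def case_prod_beta)
    also have "\<dots> = (\<Sum>y\<in>E. wt y * (\<Sum>i<n. g ((f ^^ i) y))) / real n"
      by (simp add: sum_distrib_left sum_divide_distrib)
    finally show "(\<integral>x. g x \<partial>distr L borel ?h) = (\<Sum>y\<in>E. wt y * (\<Sum>i<n. g ((f ^^ i) y))) / real n" .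
  qed simp
qed

lemma distr_eq_of_almost_invariant_limit:
  fixes f :: "'a::metric_space \<Rightarrow> 'a"
  assumes comp: "compact (UNIV :: 'a set)" and f: "continuous_on UNIV f"
    and \<mu>: "prob_space \<mu>" "sets \<mu> = sets borel"
    and lim: "\<And>g :: 'a \<Rightarrow> real. continuous_on UNIV g \<Longrightarrow> (\<lambda>k. \<integral>x. g x \<partial>M k) \<longlonglongrightarrow> (\<integral>x. g x \<partial>\<mu>)"
    and inv: "\<And>g :: 'a \<Rightarrow> real. continuous_on UNIV g \<Longrightarrow> (\<lambda>k. (\<integral>x. g (f x) \<partial>M k) - (\<integral>x. g x \<partial>M k)) \<longlonglongrightarrow> 0"
  shows "distr \<mu> borel f = \<mu>"
proof -
  have f\<mu>: "f \<in> \<mu> \<rightarrow>\<^sub>M borel"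
    using borel_measurable_continuous_onI[OF f] measurable_cong_sets[OF \<mu>(2) refl] by blast
  show ?thesis
  proof (rule measure_eq_of_continuous_integrals[OF comp prob_space.prob_space_distr[OF \<mu>(1) f\<mu>] \<mu>(1) _ \<mu>(2)])
    fix g :: "'a \<Rightarrow> real" assume g: "continuous_on UNIV g"
    have "continuous_on UNIV (\<lambda>x. g (f x))" by (rule continuous_on_compose2[OF g f]) simp
    from tendsto_diff[OF lim[OF this] lim[OF g]] inv[OF g]
    have "(\<integral>x. g (f x) \<partial>\<mu>) - (\<integral>x. g x \<partial>\<mu>) = 0" by (rule LIMSEQ_unique)
    then show "(\<integral>x. g x \<partial>distr \<mu> borel f) = (\<integral>x. g x \<partial>\<mu>)"
      by (simp add: integral_distr[OF f\<mu> borel_measurable_continuous_onI[OF g]])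
  qed simp
qed

lemma continuous_compact_space_bounded:
  fixes g :: "'a::metric_space \<Rightarrow> real"
  assumes "compact (UNIV :: 'a set)" "continuous_on UNIV g"
  obtains B where "0 \<le> B" "\<And>x. \<bar>g x\<bar> \<le> B"
proof -
  have "bounded (range g)"
    using compact_continuous_image[OF assms(2,1)] compact_imp_bounded by blast
  then obtain B where B: "\<And>x. \<bar>g x\<bar> \<le> B" by (auto simp: bounded_iff)
  then have "0 \<le> B" using abs_ge_zero order_trans by blast
  with B that show thesis by blast
qed

text \<open>For weights proportional to exp of the Birkhoff sum, the entropy of the weights plus the
  mean Birkhoff sum is exactly ln of the normalising sum. The block bound converts this into a bound
  by word entropies, which passes to a weak limit of the empirical measures; that limit is invariant
  because f changes an empirical integral by only O(1 / n).\<close>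

lemma separated_sums_le_pressure:
  fixes f :: "'a::metric_space \<Rightarrow> 'a" and G :: "'a \<Rightarrow> real"
  assumes comp: "compact (UNIV :: 'a set)" and f: "continuous_on UNIV f" and G: "continuous_on UNIV G"
    and e: "0 < e"
    and freq: "\<exists>\<^sub>F n in sequentially. \<exists>E. finite E \<and> E \<noteq> {} \<and>
      (\<forall>y\<in>E. \<forall>z\<in>E. y \<noteq> z \<longrightarrow> (\<exists>i<n. e \<le> dist ((f ^^ i) y) ((f ^^ i) z))) \<and>
      real n * b - C \<le> ln (\<Sum>y\<in>E. exp (birkhoff_sum f G n y))"
  shows "ereal b \<le> pressure f G"
proof -
  let ?good = "\<lambda>n E. finite E \<and> E \<noteq> {} \<and>
      (\<forall>y\<in>E. \<forall>z\<in>E. y \<noteq> z \<longrightarrow> (\<exists>i<n. e \<le> dist ((f ^^ i) y) ((f ^^ i) z))) \<and>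
      real n * b - C \<le> ln (\<Sum>y\<in>E. exp (birkhoff_sum f G n y))"
  have "infinite {n. \<exists>E. ?good n E}"
    using freq by (simp add: frequently_cofinite[symmetric] cofinite_eq_sequentially)
  then obtain s0 :: "nat \<Rightarrow> nat" where s0: "strict_mono s0" "\<And>k. \<exists>E. ?good (s0 k) E"
    using infinite_enumerate[of "{n. \<exists>E. ?good n E}"] by auto
  \<comment> \<open>The shift by one makes every length positive.\<close>
  define s where "s k = s0 (Suc k)" for k
  have s_ge: "Suc k \<le> s k" for k unfolding s_def using seq_suble[OF s0(1)] .
  have "\<exists>E. ?good (s k) E" for k using s0(2) by (simp only: s_def)
  then obtain E where E: "\<And>k. ?good (s k) (E k)" by metis
  define Z where "Z k = (\<Sum>y\<in>E k. exp (birkhoff_sum f G (s k) y))" for k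
  define wt where "wt k y = exp (birkhoff_sum f G (s k) y) / Z k" for k y
  have Z: "0 < Z k" for k unfolding Z_def using E[of k] by (intro sum_pos) auto
  have wt: "0 < wt k y" "(\<Sum>y\<in>E k. wt k y) = 1" for k y
    using Z[of k] by (auto simp: wt_def sum_divide_distrib[symmetric] Z_def[symmetric])
  have "\<forall>k. \<exists>M. prob_space M \<and> sets M = sets borel \<and> (\<forall>g :: 'a \<Rightarrow> real. g \<in> borel_measurable borel \<longrightarrow>
      (\<integral>x. g x \<partial>M) = (\<Sum>y\<in>E k. wt k y * (\<Sum>i<s k. g ((f ^^ i) y))) / real (s k))"
  proof
    fix k
    have fin: "finite (E k)" and n1: "1 \<le> s k" using E[of k] s_ge[of k] by auto
    obtain M where "prob_space M" "sets M = sets borel"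
      "\<And>g :: 'a \<Rightarrow> real. g \<in> borel_measurable borel \<Longrightarrow>
        (\<integral>x. g x \<partial>M) = (\<Sum>y\<in>E k. wt k y * (\<Sum>i<s k. g ((f ^^ i) y))) / real (s k)"
      using empirical_measure_exists[OF fin less_imp_le[OF wt(1)] wt(2) n1, of f] by blast
    then show "\<exists>M. prob_space M \<and> sets M = sets borel \<and> (\<forall>g :: 'a \<Rightarrow> real. g \<in> borel_measurable borel \<longrightarrow>
      (\<integral>x. g x \<partial>M) = (\<Sum>y\<in>E k. wt k y * (\<Sum>i<s k. g ((f ^^ i) y))) / real (s k))"
      by (intro exI[of _ M]) simp
  qed
  from choice[OF this] obtain M where "\<forall>k. prob_space (M k) \<and> sets (M k) = sets borel \<and> (\<forall>g :: 'a \<Rightarrow> real.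
      g \<in> borel_measurable borel \<longrightarrow> (\<integral>x. g x \<partial>M k) = (\<Sum>y\<in>E k. wt k y * (\<Sum>i<s k. g ((f ^^ i) y))) / real (s k))" ..
  then have M: "\<And>k. prob_space (M k)" "\<And>k. sets (M k) = sets borel"
    and M_int: "\<And>k g. (g :: 'a \<Rightarrow> real) \<in> borel_measurable borel \<Longrightarrow>
      (\<integral>x. g x \<partial>M k) = (\<Sum>y\<in>E k. wt k y * (\<Sum>i<s k. g ((f ^^ i) y))) / real (s k)"
    by simp_all
  obtain r \<mu> where r: "strict_mono (r :: nat \<Rightarrow> nat)" and \<mu>: "prob_space \<mu>" "sets \<mu> = sets borel"
    and lim: "\<And>g :: 'a \<Rightarrow> real. continuous_on UNIV g \<Longrightarrow> (\<lambda>k. \<integral>x. g x \<partial>M (r k)) \<longlonglongrightarrow> (\<integral>x. g x \<partial>\<mu>)"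
    using weak_limit_compact_space[OF comp M, of "\<lambda>k. k"] by blast
  define N where "N k = s (r k)" for k
  have N_ge: "Suc k \<le> N k" for k
    using s_ge[of "r k"] seq_suble[OF r, of k] unfolding N_def by linarith
  have N_top: "filterlim N at_top sequentially"
    by (rule filterlim_at_top_mono[OF filterlim_ident always_eventually]) (use N_ge Suc_leD in blast)
  have over_N: "(\<lambda>k. c / real (N k)) \<longlonglongrightarrow> 0" for c
    by (intro real_tendsto_divide_at_top[OF tendsto_const] filterlim_compose[OF filterlim_real_sequentially N_top])
  have inv: "distr \<mu> borel f = \<mu>"
  proof (rule distr_eq_of_almost_invariant_limit[OF comp f \<mu> lim])
    fix g :: "'a \<Rightarrow> real" assume g: "continuous_on UNIV g"
    obtain B where B: "0 \<le> B" "\<And>x. \<bar>g x\<bar> \<le> B" using continuous_compact_space_bounded[OF comp g] by blast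
    have gf: "continuous_on UNIV (\<lambda>x. g (f x))" by (rule continuous_on_compose2[OF g f]) simp
    show "(\<lambda>k. (\<integral>x. g (f x) \<partial>M (r k)) - (\<integral>x. g x \<partial>M (r k))) \<longlonglongrightarrow> 0"
    proof (rule Lim_null_comparison[OF always_eventually over_N[of "2 * B"]], rule allI)
      fix k
      let ?k = "r k"
      have telescope: "(\<Sum>i<N k. g ((f ^^ Suc i) y)) - (\<Sum>i<N k. g ((f ^^ i) y)) = g ((f ^^ N k) y) - g y" for y
        using sum_lessThan_telescope[of "\<lambda>i. g ((f ^^ i) y)" "N k"] by (simp add: sum_subtractf)
      have "(\<integral>x. g (f x) \<partial>M ?k) - (\<integral>x. g x \<partial>M ?k) =
        (\<Sum>y\<in>E ?k. wt ?k y * ((\<Sum>i<N k. g ((f ^^ Suc i) y)) - (\<Sum>i<N k. g ((f ^^ i) y)))) / real (N k)"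
        using M_int[OF borel_measurable_continuous_onI[OF g], of ?k] M_int[OF borel_measurable_continuous_onI[OF gf], of ?k]
        by (simp add: N_def diff_divide_distrib sum_subtractf right_diff_distrib)
      also have "\<dots> = (\<Sum>y\<in>E ?k. wt ?k y * (g ((f ^^ N k) y) - g y)) / real (N k)"
        unfolding telescope ..
      finally have "norm ((\<integral>x. g (f x) \<partial>M ?k) - (\<integral>x. g x \<partial>M ?k)) =
          \<bar>\<Sum>y\<in>E ?k. wt ?k y * (g ((f ^^ N k) y) - g y)\<bar> / real (N k)" by simp
      also have "\<bar>\<Sum>y\<in>E ?k. wt ?k y * (g ((f ^^ N k) y) - g y)\<bar> \<le> (\<Sum>y\<in>E ?k. wt ?k y * (2 * B))"
      proof (rule order_trans[OF sum_abs], rule sum_mono)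
        fix y
        have "\<bar>g ((f ^^ N k) y) - g y\<bar> \<le> 2 * B"
          using B(2)[of "(f ^^ N k) y"] B(2)[of y] by linarith
        then show "\<bar>wt ?k y * (g ((f ^^ N k) y) - g y)\<bar> \<le> wt ?k y * (2 * B)"
          using wt(1)[of ?k y] by (simp add: abs_mult mult_left_mono)
      qed
      also have "\<dots> = 2 * B" using wt(2)[of ?k] by (simp add: sum_distrib_right[symmetric])
      finally show "norm ((\<integral>x. g (f x) \<partial>M ?k) - (\<integral>x. g x \<partial>M ?k)) \<le> 2 * B / real (N k)"
        by (simp add: divide_right_mono)
    qed
  qed
  then have \<mu>_inv: "\<mu> \<in> invariant_prob_measures f" using \<mu> by (simp add: invariant_prob_measures_def)
  interpret compact_prob_space \<mu>
    using \<mu> comp by (simp add: compact_prob_space_def compact_prob_space_axioms_def)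
  \<comment> \<open>Diameter below e makes itineraries injective on each \<open>E k\<close>. Jordan
    measurability with respect to the limit makes the mass of every cylinder converge.\<close>
  obtain P where P: "finite P" "partition_on UNIV P" "\<And>A. A \<in> P \<Longrightarrow> jordan_measurable \<mu> A"
    "\<And>A u v. A \<in> P \<Longrightarrow> u \<in> A \<Longrightarrow> v \<in> A \<Longrightarrow> dist u v < e"
    using jordan_measurable_small_partition[OF e] by metis
  have P_borel: "P \<subseteq> sets borel" using P(3) jordan_measurable_borel by blast
  have inj: "inj_on (itinerary f P (s k)) (E k)" for k
  proof (rule inj_onI, rule ccontr)
    fix y z assume yz: "y \<in> E k" "z \<in> E k" "itinerary f P (s k) y = itinerary f P (s k) z" "y \<noteq> z"
    then obtain i where i: "i < s k" "e \<le> dist ((f ^^ i) y) ((f ^^ i) z)" using E[of k] by blast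
    have "part_label P ((f ^^ i) y) = part_label P ((f ^^ i) z)"
      using yz(3) itinerary_nth[OF i(1)] by metis
    then show False
      using P(4)[of "part_label P ((f ^^ i) y)" "(f ^^ i) y" "(f ^^ i) z"] part_label_mem[OF P(2)] i(2) by force
  qed
  define K where "K = real (card P)"
  have P_ne: "P \<noteq> {}" using part_label_mem(1)[OF P(2)] by auto
  then have K: "1 \<le> K" unfolding K_def using P(1) by (simp add: Suc_le_eq card_gt_0_iff)
  let ?p = "word_prob f P \<mu>"
  have p: "0 \<le> ?p w" "?p w \<le> 1" for w by (auto simp: word_prob_def)
  have p_sum: "(\<Sum>w\<in>words P q. ?p w) = 1" for q
    using integral_itinerary[OF finite_measure_axioms \<mu>(2) f P(2) P_borel P(1), of "\<lambda>_. 1" q] by (simp add: prob_space)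
  have bound: "real q * b \<le> real q * (\<integral>x. G x \<partial>\<mu>) + word_entropy f P \<mu> q + \<eta>"
    if q: "1 \<le> q" and \<eta>: "0 < \<eta>" for q \<eta>
  proof -
    \<comment> \<open>The empirical measures may charge words that \<mu> does not, so the word law
      of \<mu> is mixed with the uniform law to keep ln \<rho> under control; with this a the mixing
      costs at most \<eta>.\<close>
    define a where "a = exp (- \<eta>)"
    have a: "0 < a" "a < 1" using \<eta> by (auto simp: a_def)
    define \<rho> where "\<rho> w = a * ?p w + (1 - a) * (1 / K) ^ q" for w
    have \<rho>_pos: "0 < \<rho> w" for w
      unfolding \<rho>_def using a p K by (intro add_nonneg_pos mult_nonneg_nonneg mult_pos_pos) auto
    have \<rho>_sum: "(\<Sum>w\<in>words P q. \<rho> w) = 1"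
    proof -
      have "(\<Sum>w\<in>words P q. \<rho> w) = a * (\<Sum>w\<in>words P q. ?p w) + (1 - a) * (\<Sum>w\<in>words P q. (1 / K) ^ q)"
        unfolding \<rho>_def sum.distrib sum_distrib_left ..
      then show ?thesis unfolding p_sum K_def sum_words_const[OF P(1) P_ne] by simp
    qed
    let ?\<phi> = "\<lambda>x. - ln (\<rho> (itinerary f P q x))"
    have \<phi>_int: "(\<integral>x. ?\<phi> x \<partial>L) = (\<Sum>w\<in>words P q. word_prob f P L w * - ln (\<rho> w))"
      if "prob_space L" "sets L = sets borel" for L
      using integral_itinerary[OF prob_space.finite_measure[OF that(1)] that(2) f P(2) P_borel P(1), of "\<lambda>w. - ln (\<rho> w)" q]
      by simp
    have \<phi>_meas: "?\<phi> \<in> borel_measurable borel"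
    proof -
      have "?\<phi> \<in> borel_measurable \<mu>"
        using integrable_itinerary[OF finite_measure_axioms \<mu>(2) f P(2) P_borel P(1), of "\<lambda>w. - ln (\<rho> w)" q]
        by (rule borel_measurable_integrable)
      then show ?thesis using measurable_cong_sets[OF \<mu>(2) refl] by blast
    qed
    \<comment> \<open>Growth hypothesis and block bound, divided by \<open>N k\<close>; the last
      term collects everything that does not grow with k.\<close>
    have step: "real q * b \<le> real q * (\<integral>x. G x \<partial>M (r k)) + (\<integral>x. ?\<phi> x \<partial>M (r k)) + (real q * C + 2 * real q * real q * ln K) / real (N k)"
      if k: "q \<le> N k" for k
    proof -
      let ?k = "r k"
      have n: "0 < real (N k)" using N_ge[of k] by simp
      let ?S = "\<lambda>y. birkhoff_sum f G (N k) y"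
      have "ln (wt ?k y) = ?S y - ln (Z ?k)" for y
        using Z[of ?k] by (simp add: wt_def ln_div N_def)
      then have "- (\<Sum>y\<in>E ?k. wt ?k y * ln (wt ?k y)) = ln (Z ?k) - (\<Sum>y\<in>E ?k. wt ?k y * ?S y)"
        using wt(2)[of ?k] by (simp add: right_diff_distrib sum_subtractf sum_distrib_right[symmetric])
      then have "real q * (ln (Z ?k) - (\<Sum>y\<in>E ?k. wt ?k y * ?S y)) \<le>
          (\<Sum>y\<in>E ?k. wt ?k y * (\<Sum>p<N k. ?\<phi> ((f ^^ p) y))) + 2 * real q * real q * ln K"
        using entropy_block_bound[of P "E ?k" f "N k" "wt ?k" q \<rho>] P(1,2) E[of ?k] inj[of ?k] wt \<rho>_pos \<rho>_sum q k
        by (simp add: N_def K_def less_imp_le)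
      moreover have "(\<Sum>y\<in>E ?k. wt ?k y * (\<Sum>p<N k. ?\<phi> ((f ^^ p) y))) = real (N k) * (\<integral>x. ?\<phi> x \<partial>M ?k)"
        using M_int[OF \<phi>_meas, of ?k] n by (simp add: N_def)
      moreover have "(\<Sum>y\<in>E ?k. wt ?k y * ?S y) = real (N k) * (\<integral>x. G x \<partial>M ?k)"
        using M_int[OF borel_measurable_continuous_onI[OF G], of ?k] n by (simp add: N_def birkhoff_sum_def)
      moreover have "real (N k) * b - C \<le> ln (Z ?k)" using E[of ?k] by (simp add: Z_def N_def)
      then have "real q * (real (N k) * b - C) \<le> real q * ln (Z ?k)" by (intro mult_left_mono) auto
      ultimately have "real (N k) * (real q * b) \<le> real (N k) * (real q * (\<integral>x. G x \<partial>M ?k) + (\<integral>x. ?\<phi> x \<partial>M ?k))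
          + (real q * C + 2 * real q * real q * ln K)"
        by (simp add: algebra_simps)
      then show ?thesis using n by (simp add: field_simps)
    qed
    have "(\<lambda>k. \<integral>x. ?\<phi> x \<partial>M (r k)) \<longlonglongrightarrow> (\<Sum>w\<in>words P q. ?p w * - ln (\<rho> w))"
      unfolding \<phi>_int[OF M] word_prob_def
      by (intro tendsto_sum tendsto_mult tendsto_const jordan_measurable_tendsto M lim
          jordan_measurable_cylinder[OF f inv P(2,3)])
    then have "(\<lambda>k. real q * (\<integral>x. G x \<partial>M (r k)) + (\<integral>x. ?\<phi> x \<partial>M (r k)) + (real q * C + 2 * real q * real q * ln K) / real (N k))
        \<longlonglongrightarrow> real q * (\<integral>x. G x \<partial>\<mu>) + (\<Sum>w\<in>words P q. ?p w * - ln (\<rho> w)) + 0"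
      by (intro tendsto_add tendsto_mult tendsto_const lim G over_N)
    moreover have "\<forall>\<^sub>F k in sequentially. q \<le> N k" using N_top by (simp add: filterlim_at_top)
    then have "\<forall>\<^sub>F k in sequentially. real q * b \<le> real q * (\<integral>x. G x \<partial>M (r k)) + (\<integral>x. ?\<phi> x \<partial>M (r k)) + (real q * C + 2 * real q * real q * ln K) / real (N k)"
      by eventually_elim (rule step)
    ultimately have 1: "real q * b \<le> real q * (\<integral>x. G x \<partial>\<mu>) + (\<Sum>w\<in>words P q. ?p w * - ln (\<rho> w)) + 0"
      by (rule tendsto_lowerbound) simp
    have "?p w * - ln (\<rho> w) \<le> - (?p w * ln (?p w)) + ?p w * \<eta>" for w
    proof (cases "?p w = 0")
      case False
      then have pos: "0 < ?p w" using p(1)[of w] by simp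
      have "a * ?p w \<le> \<rho> w" unfolding \<rho>_def using a K by simp
      then have "ln (a * ?p w) \<le> ln (\<rho> w)" using a pos \<rho>_pos by simp
      then have "- ln (\<rho> w) \<le> \<eta> - ln (?p w)" using a pos by (simp add: ln_mult_pos a_def)
      then have "?p w * - ln (\<rho> w) \<le> ?p w * (\<eta> - ln (?p w))" using p by (intro mult_left_mono)
      then show ?thesis by (simp add: algebra_simps)
    qed simp
    then have "(\<Sum>w\<in>words P q. ?p w * - ln (\<rho> w)) \<le> (\<Sum>w\<in>words P q. - (?p w * ln (?p w)) + ?p w * \<eta>)"
      by (intro sum_mono)
    also have "\<dots> = word_entropy f P \<mu> q + \<eta>"
      unfolding sum.distrib sum_negf sum_distrib_right[symmetric] p_sum word_entropy_def by simp
    finally show ?thesis using 1 by simp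
  qed
  \<comment> \<open>First \<eta> tends to 0 with q fixed; then division by q and q to infinity turn
    word entropy into entropy of the partition.\<close>
  have "b \<le> (\<integral>x. G x \<partial>\<mu>) + word_entropy f P \<mu> q / real q" if q: "1 \<le> q" for q
  proof -
    have "real q * b \<le> real q * (\<integral>x. G x \<partial>\<mu>) + word_entropy f P \<mu> q"
      by (rule field_le_epsilon) (use bound[OF q] in simp)
    then show ?thesis using q by (simp add: field_simps)
  qed
  then have "\<forall>\<^sub>F q in sequentially. b \<le> (\<integral>x. G x \<partial>\<mu>) + word_entropy f P \<mu> q / real q"
    using eventually_ge_at_top[of 1] by (rule eventually_mono[rotated])
  moreover have "(\<lambda>q. (\<integral>x. G x \<partial>\<mu>) + word_entropy f P \<mu> q / real q) \<longlonglongrightarrow> (\<integral>x. G x \<partial>\<mu>) + entropy_wrt_partition f \<mu> P"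
    by (intro tendsto_add tendsto_const word_entropy_tendsto[OF f \<mu>_inv P(2) P_borel P(1)])
  ultimately have "b \<le> (\<integral>x. G x \<partial>\<mu>) + entropy_wrt_partition f \<mu> P"
    by (intro tendsto_lowerbound[OF _ _ sequentially_bot])
  then have "ereal b \<le> ereal (entropy_wrt_partition f \<mu> P) + ereal (\<integral>x. G x \<partial>\<mu>)" by simp
  also have "ereal (entropy_wrt_partition f \<mu> P) \<le> measure_entropy f \<mu>"
    unfolding measure_entropy_def using P(1,2) P_borel \<mu>(2) space_M by (intro SUP_upper) auto
  then have "ereal (entropy_wrt_partition f \<mu> P) + ereal (\<integral>x. G x \<partial>\<mu>) \<le> measure_entropy f \<mu> + ereal (\<integral>x. G x \<partial>\<mu>)"
    by (rule add_right_mono)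
  also have "\<dots> \<le> pressure f G" unfolding pressure_def using \<mu>_inv by (rule SUP_upper)
  finally show ?thesis .
qed

section \<open>Spanning sets and entropy\<close>

text \<open>The distance to one closed set attains a positive minimum on another, and only finitely
  many pairs occur.\<close>

lemma disjoint_closed_sets_separated:
  fixes C :: "'i \<Rightarrow> 'a::metric_space set"
  assumes comp: "compact (UNIV :: 'a set)" and I: "finite I"
    and C: "\<And>i. i \<in> I \<Longrightarrow> closed (C i)" "\<And>i j. i \<in> I \<Longrightarrow> j \<in> I \<Longrightarrow> i \<noteq> j \<Longrightarrow> C i \<inter> C j = {}"
  obtains d where "0 < d" "\<And>i j u v. i \<in> I \<Longrightarrow> j \<in> I \<Longrightarrow> u \<in> C i \<Longrightarrow> v \<in> C j \<Longrightarrow> dist u v < d \<Longrightarrow> i = j"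
proof -
  have "\<exists>d>0. \<forall>u\<in>C i. \<forall>v\<in>C j. d \<le> dist u v" if "i \<in> I" "j \<in> I" "i \<noteq> j" for i j
  proof (cases "C i = {} \<or> C j = {}")
    case True
    then show ?thesis by (intro exI[of _ 1]) auto
  next
    case False
    have "compact (C i)" using compact_Int_closed[OF comp C(1)[OF that(1)]] by simp
    moreover have "continuous_on (C i) (\<lambda>u. infdist u (C j))" by (intro continuous_intros)
    ultimately obtain u0 where u0: "u0 \<in> C i" "\<And>u. u \<in> C i \<Longrightarrow> infdist u0 (C j) \<le> infdist u (C j)"
      using continuous_attains_inf[of "C i" "\<lambda>u. infdist u (C j)"] False by blast
    have "0 < infdist u0 (C j)"
      using u0(1) C(1)[OF that(2)] C(2)[OF that] False by (intro infdist_pos_not_in_closed) auto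
    moreover have "infdist u0 (C j) \<le> dist u v" if "u \<in> C i" "v \<in> C j" for u v
      using u0(2)[OF that(1)] infdist_le[OF that(2), of u] by linarith
    ultimately show ?thesis by blast
  qed
  then obtain d where d: "\<And>i j. i \<in> I \<Longrightarrow> j \<in> I \<Longrightarrow> i \<noteq> j \<Longrightarrow> 0 < d i j"
    "\<And>i j u v. i \<in> I \<Longrightarrow> j \<in> I \<Longrightarrow> i \<noteq> j \<Longrightarrow> u \<in> C i \<Longrightarrow> v \<in> C j \<Longrightarrow> d i j \<le> dist u v"
    by metis
  \<comment> \<open>The element 1 keeps \<open>S\<close> nonempty when there are no two distinct
    indices.\<close>
  define S where "S = insert 1 ((\<lambda>(i, j). d i j) ` {(i, j). i \<in> I \<and> j \<in> I \<and> i \<noteq> j})"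
  have "{(i, j). i \<in> I \<and> j \<in> I \<and> i \<noteq> j} \<subseteq> I \<times> I" by auto
  then have S: "finite S" unfolding S_def using I by (meson finite_SigmaI finite_imageI finite_insert finite_subset)
  show thesis
  proof (rule that[of "Min S"])
    show "0 < Min S" using S d(1) by (subst Min_gr_iff) (auto simp: S_def)
    fix i j u v assume *: "i \<in> I" "j \<in> I" "u \<in> C i" "v \<in> C j" "dist u v < Min S"
    show "i = j"
    proof (rule ccontr)
      assume "i \<noteq> j"
      then have "d i j \<in> S" using * by (auto simp: S_def)
      then have "Min S \<le> d i j" using S by simp
      then show False using d(2)[of i j u v] * \<open>i \<noteq> j\<close> by simp
    qed
  qed
qed

lemma birkhoff_sum_add:
  "birkhoff_sum f G (m + n) x = birkhoff_sum f G m x + birkhoff_sum f G n ((f ^^ m) x)"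
proof (induction n)
  case (Suc n)
  have "(f ^^ (m + n)) x = (f ^^ n) ((f ^^ m) x)" by (simp add: add.commute[of m] funpow_add)
  then show ?case using Suc by (simp add: birkhoff_sum_def)
qed (simp add: birkhoff_sum_def)

lemma birkhoff_sum_diff_le:
  assumes "\<And>u v. dist u v < \<epsilon> \<Longrightarrow> \<bar>G u - G v\<bar> \<le> \<eta>" "\<And>i. i < n \<Longrightarrow> dist ((f ^^ i) x) ((f ^^ i) y) < \<epsilon>"
  shows "\<bar>birkhoff_sum f G n x - birkhoff_sum f G n y\<bar> \<le> real n * \<eta>"
proof -
  have "\<bar>birkhoff_sum f G n x - birkhoff_sum f G n y\<bar> \<le> (\<Sum>i<n. \<bar>G ((f ^^ i) x) - G ((f ^^ i) y)\<bar>)"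
    unfolding birkhoff_sum_def sum_subtractf[symmetric] by (rule sum_abs)
  also have "\<dots> \<le> (\<Sum>i<n. \<eta>)" using assms by (intro sum_mono) auto
  finally show ?thesis by simp
qed

lemma birkhoff_sum_abs_le:
  assumes "\<And>x. \<bar>G x\<bar> \<le> B"
  shows "\<bar>birkhoff_sum f G n x\<bar> \<le> real n * B"
proof -
  have "\<bar>birkhoff_sum f G n x\<bar> \<le> (\<Sum>i<n. \<bar>G ((f ^^ i) x)\<bar>)" unfolding birkhoff_sum_def by (rule sum_abs)
  also have "\<dots> \<le> (\<Sum>i<n. B)" using assms by (intro sum_mono) auto
  finally show ?thesis by simp
qed

lemma
  fixes f :: "'a::topological_space \<Rightarrow> 'a" and h :: "'a \<Rightarrow> real"
  assumes f: "continuous_on UNIV f" and M: "M \<in> invariant_prob_measures f"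
    and h: "h \<in> borel_measurable borel" "integrable M h"
  shows integrable_birkhoff_sum: "integrable M (birkhoff_sum f h n)"
    and integral_birkhoff_sum: "(\<integral>x. birkhoff_sum f h n x \<partial>M) = real n * (\<integral>x. h x \<partial>M)"
proof -
  note * = integral_funpow_invariant(1)[OF f M h(1)] integral_funpow_invariant(2)[OF f M h(1) h(2)]
  have eq: "birkhoff_sum f h n = (\<lambda>x. \<Sum>i<n. h ((f ^^ i) x))" by (simp add: birkhoff_sum_def fun_eq_iff)
  show "integrable M (birkhoff_sum f h n)"
    unfolding eq by (intro Bochner_Integration.integrable_sum *(2))
  show "(\<integral>x. birkhoff_sum f h n x \<partial>M) = real n * (\<integral>x. h x \<partial>M)"
    unfolding eq by (subst Bochner_Integration.integral_sum) (auto simp: *)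
qed

lemma uniform_oscillation:
  fixes G :: "'a::metric_space \<Rightarrow> real"
  assumes "compact (UNIV :: 'a set)" "continuous_on UNIV G" "0 < \<eta>"
  obtains d where "0 < d" "\<And>u v. dist u v < d \<Longrightarrow> \<bar>G u - G v\<bar> \<le> \<eta>"
proof -
  have "uniformly_continuous_on UNIV G" using assms by (intro compact_uniformly_continuous)
  then obtain d where "0 < d" "\<And>u v. dist u v < d \<Longrightarrow> dist (G u) (G v) < \<eta>"
    unfolding uniformly_continuous_on_def using assms(3) by (metis UNIV_I dist_commute)
  then show thesis using that[of d] by (auto simp: dist_real_def less_imp_le)
qed

text \<open>Cross entropy against an explicit law on words: pick a point of \<open>E\<close> with its normalised weight,
  copy its coarse itinerary, and resample each letter with small probability. The coarse itinerary is
  read off closed subsets of the atoms, which are at positive mutual distance and miss little mass.\<close>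

lemma word_entropy_le_spanning_sum:
  fixes f :: "'a::metric_space \<Rightarrow> 'a" and G :: "'a \<Rightarrow> real"
  assumes comp: "compact (UNIV :: 'a set)" and f: "continuous_on UNIV f" and G: "continuous_on UNIV G"
    and M: "M \<in> invariant_prob_measures f"
    and P: "partition_on UNIV P" "P \<subseteq> sets borel" "finite P" and \<eta>: "0 < \<eta>"
  obtains \<epsilon> B where "0 < \<epsilon>"
    "\<And>N n E. finite E \<Longrightarrow> (\<And>x. \<exists>y\<in>E. \<forall>i<n. dist ((f ^^ i) x) ((f ^^ (N + i)) y) < \<epsilon>) \<Longrightarrow>
      word_entropy f P M n + real n * (\<integral>x. G x \<partial>M)
        \<le> ln (\<Sum>y\<in>E. exp (birkhoff_sum f G (N + n) y)) + real n * \<eta> + real N * B"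
proof -
  have sM: "sets M = sets borel" and "prob_space M"
    using M by (auto simp: invariant_prob_measures_def)
  interpret compact_prob_space M
    using sM comp \<open>prob_space M\<close> by (simp add: compact_prob_space_def compact_prob_space_axioms_def)
  obtain B where B: "0 \<le> B" "\<And>x. \<bar>G x\<bar> \<le> B" using continuous_compact_space_bounded[OF comp G] by blast
  define K where "K = real (card P)"
  have ne: "P \<noteq> {}" using part_label_mem(1)[OF P(1)] by auto
  then have K: "1 \<le> K" unfolding K_def using P(3) by (simp add: Suc_le_eq card_gt_0_iff)
  \<comment> \<open>A letter is copied with probability a and otherwise resampled uniformly, which
    gives every letter at least the probability c below. A correct copy then costs at most
    \<open>\<eta> / 3\<close>, a wrong one at most \<Lambda>.\<close>
  define a where "a = exp (- (\<eta> / 3))"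
  have a: "0 < a" "a < 1" using \<eta> by (auto simp: a_def)
  define c where "c = (1 - a) / K"
  have "1 - a < K" using a K by linarith
  then have c: "0 < c" "c < 1" using a K by (auto simp: c_def divide_less_eq)
  define \<Lambda> where "\<Lambda> = - ln c"
  have \<Lambda>: "0 < \<Lambda>" using c by (simp add: \<Lambda>_def)
  \<comment> \<open>Points outside the closed parts may be misread at cost \<Lambda>; their total
    mass is chosen so small that this costs at most \<open>\<eta> / 3\<close> per step on
    average.\<close>
  have "\<forall>A\<in>P. \<exists>C. closed C \<and> C \<subseteq> A \<and> measure M (A - C) < \<eta> / 3 / \<Lambda> / K"
  proof
    fix A assume "A \<in> P"
    then have A: "A \<in> sets borel" using P(2) by blast
    have "0 < \<eta> / 3 / \<Lambda> / K" using \<eta> \<Lambda> K by simp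
    then obtain C U where CU: "closed C" "open U" "C \<subseteq> A" "A \<subseteq> U" "measure M (U - C) < \<eta> / 3 / \<Lambda> / K"
      using borel_closed_open_approx[OF finite_measure_axioms sM A] by metis
    have "measure M (A - C) \<le> measure M (U - C)"
      using CU A sM by (intro finite_measure_mono) auto
    then show "\<exists>C. closed C \<and> C \<subseteq> A \<and> measure M (A - C) < \<eta> / 3 / \<Lambda> / K" using CU by (intro exI[of _ C]) simp
  qed
  then obtain C where C: "\<And>A. A \<in> P \<Longrightarrow> closed (C A)" "\<And>A. A \<in> P \<Longrightarrow> C A \<subseteq> A"
    "\<And>A. A \<in> P \<Longrightarrow> measure M (A - C A) < \<eta> / 3 / \<Lambda> / K" by metis
  define B0 where "B0 = (\<Union>A\<in>P. A - C A)"
  have AC: "A - C A \<in> sets M" if "A \<in> P" for A using that P(2) C(1)[OF that] sM by auto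
  have B0: "B0 \<in> sets borel" unfolding B0_def sM[symmetric] using P(3) AC by (intro sets.finite_UN) auto
  have "measure M B0 \<le> (\<Sum>A\<in>P. measure M (A - C A))"
    unfolding B0_def using P(3) AC by (intro finite_measure_subadditive_finite) auto
  also have "\<dots> \<le> (\<Sum>A\<in>P. \<eta> / 3 / \<Lambda> / K)" using C(3) by (intro sum_mono less_imp_le)
  also have "\<dots> = \<eta> / 3 / \<Lambda>" using K by (simp add: K_def)
  finally have mB0: "\<Lambda> * measure M B0 \<le> \<eta> / 3" using \<Lambda> by (simp add: field_simps)
  obtain d where d: "0 < d"
    "\<And>A A' u v. A \<in> P \<Longrightarrow> A' \<in> P \<Longrightarrow> u \<in> C A \<Longrightarrow> v \<in> C A' \<Longrightarrow> dist u v < d \<Longrightarrow> A = A'"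
  proof (rule disjoint_closed_sets_separated[OF comp P(3), of C])
    fix A A' assume A: "A \<in> P" "A' \<in> P" "A \<noteq> A'"
    have "A \<inter> A' = {}" using disjointD[OF partition_onD2[OF P(1)] A] .
    then show "C A \<inter> C A' = {}" using C(2)[OF A(1)] C(2)[OF A(2)] by blast
  qed (use C(1) in auto)
  obtain d' where d': "0 < d'" "\<And>u v. dist u v < d' \<Longrightarrow> \<bar>G u - G v\<bar> \<le> \<eta> / 3"
    using uniform_oscillation[OF comp G, of "\<eta> / 3"] \<eta> by auto
  \<comment> \<open>With d / 2, two closed parts within \<epsilon> of a common point must be the
    same part; d' bounds the oscillation of G.\<close>
  define \<epsilon> where "\<epsilon> = min (d / 2) d'"
  show thesis
  proof (rule that[of \<epsilon> B])
    show "0 < \<epsilon>" using d d' by (simp add: \<epsilon>_def)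
    fix N n and E :: "'a set"
    assume E: "finite E" and span: "\<And>x. \<exists>y\<in>E. \<forall>i<n. dist ((f ^^ i) x) ((f ^^ (N + i)) y) < \<epsilon>"
    define Z where "Z = (\<Sum>y\<in>E. exp (birkhoff_sum f G (N + n) y))"
    have "E \<noteq> {}" using span by blast
    then have Z: "0 < Z" unfolding Z_def using E by (intro sum_pos) auto
    define wt where "wt y = exp (birkhoff_sum f G (N + n) y) / Z" for y
    have wt: "0 < wt y" "(\<Sum>y\<in>E. wt y) = 1" for y
      using Z by (auto simp: wt_def sum_divide_distrib[symmetric] Z_def[symmetric])
    \<comment> \<open>At most one atom qualifies, by the choice of \<epsilon>. If none does, the
      value is unspecified and may lie outside P, so the sum of \<open>R\<close> over P is only
      bounded by 1.\<close>
    define J where "J y i = (SOME A. A \<in> P \<and> (\<exists>u\<in>C A. dist u ((f ^^ (N + i)) y) < \<epsilon>))" for y i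
    have J: "J y i = A" if "A \<in> P" "u \<in> C A" "dist u ((f ^^ (N + i)) y) < \<epsilon>" for y i A u
    proof -
      have "J y i \<in> P \<and> (\<exists>u\<in>C (J y i). dist u ((f ^^ (N + i)) y) < \<epsilon>)"
        unfolding J_def using that by (intro someI[of "\<lambda>A. A \<in> P \<and> (\<exists>u\<in>C A. dist u ((f ^^ (N + i)) y) < \<epsilon>)"]) auto
      then obtain v where v: "J y i \<in> P" "v \<in> C (J y i)" "dist v ((f ^^ (N + i)) y) < \<epsilon>" by blast
      have "dist v u < d"
        using v(3) that(3) dist_triangle2[of v u "(f ^^ (N + i)) y"] by (simp add: \<epsilon>_def)
      then show ?thesis using d(2)[OF v(1) that(1) v(2) that(2)] by simp
    qed
    define R where "R y i b = a * of_bool (b = J y i) + c" for y i and b :: "'a set"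
    have R_pos: "0 < R y i b" for y i b using a c by (auto simp: R_def)
    have R_sum: "(\<Sum>b\<in>P. R y i b) \<le> 1" for y i
    proof -
      have "(\<Sum>b\<in>P. R y i b) = a * (\<Sum>b\<in>P. of_bool (b = J y i)) + K * c"
        by (simp add: R_def sum.distrib sum_distrib_left K_def)
      also have "(\<Sum>b\<in>P. of_bool (b = J y i)) \<le> (1 :: real)"
        using P(3) by (simp add: of_bool_def sum.delta')
      then have "a * (\<Sum>b\<in>P. of_bool (b = J y i)) \<le> a" using a by (simp add: mult_left_le)
      finally show ?thesis using K by (simp add: c_def)
    qed
    define q where "q w = (\<Sum>y\<in>E. wt y * (\<Prod>i<n. R y i (w ! i)))" for w
    have q_term: "0 < wt y * (\<Prod>i<n. R y i (w ! i))" for y w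
      using wt(1) R_pos by (intro mult_pos_pos prod_pos) auto
    have q_pos: "0 < q w" for w unfolding q_def using E \<open>E \<noteq> {}\<close> q_term by (intro sum_pos) auto
    have q_sum: "(\<Sum>w\<in>words P n. q w) \<le> 1"
    proof -
      have "(\<Sum>w\<in>words P n. q w) = (\<Sum>y\<in>E. wt y * (\<Sum>w\<in>words P n. \<Prod>i<n. R y i (w ! i)))"
        unfolding q_def by (subst sum.swap) (simp add: sum_distrib_left)
      also have "\<dots> \<le> (\<Sum>y\<in>E. wt y * 1)"
        using wt(1) R_pos R_sum P(3)
        by (intro sum_mono mult_left_mono sum_words_prod_le) (auto intro: less_imp_le)
      finally show ?thesis using wt(2) by simp
    qed
    \<comment> \<open>The two shares \<open>\<eta> / 3\<close> per step pay for the oscillation of G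
      and for correct copies; integrating the visits to \<open>B0\<close> yields the third. The term
      \<open>real N * B\<close> pays for the first N steps of y, during which it shadows
      nothing.\<close>
    let ?F = "\<lambda>x. ln Z + real N * B + 2 * real n * (\<eta> / 3) - birkhoff_sum f G n x + \<Lambda> * birkhoff_sum f (indicator B0) n x"
    have pointwise: "- ln (q (itinerary f P n x)) \<le> ?F x" for x
    proof -
      obtain y where y: "y \<in> E" "\<And>i. i < n \<Longrightarrow> dist ((f ^^ i) x) ((f ^^ (N + i)) y) < \<epsilon>" using span by blast
      let ?b = "\<lambda>i. part_label P ((f ^^ i) x)"
      have R_bound: "- (\<eta> / 3) - \<Lambda> * indicator B0 ((f ^^ i) x) \<le> ln (R y i (?b i))" if "i < n" for i
      proof (cases "(f ^^ i) x \<in> B0")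
        case True
        have "ln c \<le> ln (R y i (?b i))" using c a R_pos by (simp add: R_def)
        then show ?thesis using True \<eta> by (simp add: \<Lambda>_def)
      next
        case False
        then have "(f ^^ i) x \<in> C (?b i)"
          using part_label_mem[OF P(1), of "(f ^^ i) x"] by (auto simp: B0_def)
        then have "J y i = ?b i" using J y(2)[OF that] part_label_mem(1)[OF P(1)] by blast
        then have "a \<le> R y i (?b i)" using c by (simp add: R_def)
        then have "ln a \<le> ln (R y i (?b i))" using a R_pos by simp
        then show ?thesis using False by (simp add: a_def)
      qed
      have "(\<Sum>i<n. - (\<eta> / 3) - \<Lambda> * indicator B0 ((f ^^ i) x)) \<le> (\<Sum>i<n. ln (R y i (?b i)))"
        using R_bound by (intro sum_mono) auto
      then have ln_prod: "- real n * (\<eta> / 3) - \<Lambda> * birkhoff_sum f (indicator B0) n x \<le> ln (\<Prod>i<n. R y i (?b i))"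
        using R_pos by (subst ln_prod) (auto simp: sum_subtractf birkhoff_sum_def sum_distrib_left order_less_imp_not_eq2)
      have "ln (wt y) = birkhoff_sum f G N y + birkhoff_sum f G n ((f ^^ N) y) - ln Z"
        using Z by (simp add: wt_def ln_div birkhoff_sum_add)
      moreover have "- (real N * B) \<le> birkhoff_sum f G N y"
        using birkhoff_sum_abs_le[where G = G, OF B(2), where f = f and n = N and x = y] by linarith
      moreover have "\<bar>birkhoff_sum f G n x - birkhoff_sum f G n ((f ^^ N) y)\<bar> \<le> real n * (\<eta> / 3)"
      proof (rule birkhoff_sum_diff_le[where G = G, OF d'(2)])
        fix i assume "i < n"
        then show "dist ((f ^^ i) x) ((f ^^ i) ((f ^^ N) y)) < d'"
          using y(2)[of i] by (simp add: \<epsilon>_def add.commute[of N] funpow_add)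
      qed
      ultimately have ln_wt: "birkhoff_sum f G n x - real n * (\<eta> / 3) - real N * B - ln Z \<le> ln (wt y)"
        by linarith
      have it: "(\<Prod>i<n. R y i (itinerary f P n x ! i)) = (\<Prod>i<n. R y i (?b i))"
        by (intro prod.cong) auto
      have "wt y * (\<Prod>i<n. R y i (?b i)) \<le> q (itinerary f P n x)"
        unfolding q_def it[symmetric]
        by (rule member_le_sum[of y E "\<lambda>y. wt y * (\<Prod>i<n. R y i (itinerary f P n x ! i))",
              OF y(1) less_imp_le[OF q_term] E])
      then have "ln (wt y * (\<Prod>i<n. R y i (?b i))) \<le> ln (q (itinerary f P n x))"
        using q_term[of y "itinerary f P n x"] q_pos by (simp add: it)
      moreover have "ln (wt y * (\<Prod>i<n. R y i (?b i))) = ln (wt y) + ln (\<Prod>i<n. R y i (?b i))"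
        using wt(1) R_pos by (intro ln_mult_pos prod_pos) auto
      ultimately show ?thesis using ln_wt ln_prod by linarith
    qed
    let ?p = "word_prob f P M"
    note int = integral_itinerary[OF finite_measure_axioms sM f P]
    have p_sum: "(\<Sum>w\<in>words P n. ?p w) = 1" using int[of "\<lambda>_. 1" n] by (simp add: prob_space)
    have G': "G \<in> borel_measurable borel" "integrable M G"
      using borel_measurable_continuous_onI[OF G] integrable_cont[OF G] by auto
    have ind: "(indicator B0 :: 'a \<Rightarrow> real) \<in> borel_measurable borel" "integrable M (indicator B0 :: 'a \<Rightarrow> real)"
      using B0 sM by (auto simp: emeasure_finite less_top[symmetric])
    have "word_entropy f P M n \<le> - (\<Sum>w\<in>words P n. ?p w * ln (q w))"
      unfolding word_entropy_def
      by (rule cross_entropy_le) (use q_pos q_sum p_sum less_imp_le[OF q_pos] in \<open>auto simp: word_prob_def\<close>)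
    also have "\<dots> = (\<integral>x. - ln (q (itinerary f P n x)) \<partial>M)"
      using int[of "\<lambda>w. - ln (q w)" n] by (simp add: sum_negf)
    also have "\<dots> \<le> (\<integral>x. ?F x \<partial>M)"
    proof (rule integral_mono[OF _ _ pointwise])
      show "integrable M (\<lambda>x. - ln (q (itinerary f P n x)))"
        by (rule integrable_itinerary[OF finite_measure_axioms sM f P, of "\<lambda>w. - ln (q w)"])
      show "integrable M ?F"
        using integrable_birkhoff_sum[OF f M G'] integrable_birkhoff_sum[OF f M ind] by simp
    qed
    also have "\<dots> = ln Z + real N * B + 2 * real n * (\<eta> / 3) - real n * (\<integral>x. G x \<partial>M) + \<Lambda> * (real n * measure M B0)"
      using integrable_birkhoff_sum[OF f M G', of n] integrable_birkhoff_sum[OF f M ind, of n]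
        integral_birkhoff_sum[OF f M G', of n] integral_birkhoff_sum[OF f M ind, of n]
      by (simp add: prob_space[unfolded space_M] space_M)
    also have "\<Lambda> * (real n * measure M B0) \<le> real n * (\<eta> / 3)"
      using mult_left_mono[OF mB0, of "real n"] by (simp add: mult.left_commute)
    finally show "word_entropy f P M n + real n * (\<integral>x. G x \<partial>M)
        \<le> ln (\<Sum>y\<in>E. exp (birkhoff_sum f G (N + n) y)) + real n * \<eta> + real N * B"
      by (simp add: Z_def algebra_simps)
  qed
qed

section \<open>Gibbs measures on unstable leaves\<close>

definition bowen_separated :: "('a::metric_space \<Rightarrow> 'a) \<Rightarrow> nat \<Rightarrow> real \<Rightarrow> 'a set \<Rightarrow> bool" where
  "bowen_separated f n \<epsilon> E \<longleftrightarrow> (\<forall>y\<in>E. \<forall>z\<in>E. y \<noteq> z \<longrightarrow> (\<exists>i<n. \<epsilon> \<le> dist ((f ^^ i) y) ((f ^^ i) z)))"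

definition bowen_spanning :: "('a::metric_space \<Rightarrow> 'a) \<Rightarrow> nat \<Rightarrow> real \<Rightarrow> 'a set \<Rightarrow> 'a set \<Rightarrow> bool" where
  "bowen_spanning f n \<epsilon> W E \<longleftrightarrow> (\<forall>z\<in>W. \<exists>y\<in>E. \<forall>i<n. dist ((f ^^ i) z) ((f ^^ i) y) < \<epsilon>)"

text \<open>A separated set of maximal cardinality is spanning, since a point far from it could be
  added. Cardinalities are bounded because a Bowen ball of radius \<open>\<epsilon> / 2\<close>
  holds at most one point of a separated set, and finitely many such balls cover the space.\<close>

lemma separated_spanning_exists:
  fixes f :: "'a::metric_space \<Rightarrow> 'a"
  assumes comp: "compact (UNIV :: 'a set)" and f: "continuous_on UNIV f" and \<epsilon>: "0 < \<epsilon>"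
  obtains E where "finite E" "E \<subseteq> W" "bowen_separated f n \<epsilon> E" "bowen_spanning f n \<epsilon> W E"
proof -
  define U where "U y = {z. \<forall>i\<in>{..<n}. dist ((f ^^ i) z) ((f ^^ i) y) < \<epsilon> / 2}" for y
  have "open (U y)" for y
  proof -
    have "U y = (\<Inter>i\<in>{..<n}. {z. dist ((f ^^ i) z) ((f ^^ i) y) < \<epsilon> / 2})" by (auto simp: U_def)
    moreover have "open {z. dist ((f ^^ i) z) ((f ^^ i) y) < \<epsilon> / 2}" for i
      by (intro open_Collect_less continuous_on_dist continuous_on_const continuous_funpow[OF f])
    ultimately show ?thesis by (simp add: open_INT)
  qed
  moreover have "UNIV \<subseteq> (\<Union>y\<in>UNIV. U y)" using \<epsilon> by (auto simp: U_def)
  ultimately obtain C where C: "finite C" "UNIV \<subseteq> (\<Union>y\<in>C. U y)"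
    using compactE_image[OF comp, of UNIV U] by metis
  let ?Q = "\<lambda>E. finite E \<and> E \<subseteq> W \<and> bowen_separated f n \<epsilon> E"
  have card_le: "card E \<le> card C" if E: "?Q E" for E
  proof -
    have "\<forall>z. \<exists>c. c \<in> C \<and> z \<in> U c" using C(2) by blast
    from choice[OF this] obtain h where h: "\<And>z. h z \<in> C" "\<And>z. z \<in> U (h z)" by blast
    have "inj_on h E"
    proof (rule inj_onI, rule ccontr)
      fix y z assume yz: "y \<in> E" "z \<in> E" "h y = h z" "y \<noteq> z"
      then obtain i where i: "i < n" "\<epsilon> \<le> dist ((f ^^ i) y) ((f ^^ i) z)"
        using E unfolding bowen_separated_def by blast
      have "dist ((f ^^ i) y) ((f ^^ i) (h y)) < \<epsilon> / 2" "dist ((f ^^ i) z) ((f ^^ i) (h y)) < \<epsilon> / 2"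
        using h(2)[of y] h(2)[of z] i(1) yz(3) by (auto simp: U_def)
      then show False using i(2) dist_triangle2[of "(f ^^ i) y" "(f ^^ i) z" "(f ^^ i) (h y)"] by linarith
    qed
    then show ?thesis using C(1) h(1) by (intro card_inj_on_le[of h]) auto
  qed
  have "?Q {}" by (simp add: bowen_separated_def)
  moreover have "\<forall>E. ?Q E \<longrightarrow> card E < Suc (card C)" using card_le by (simp add: less_Suc_eq_le)
  ultimately have "\<exists>E. ?Q E \<and> (\<forall>E'. ?Q E' \<longrightarrow> card E' \<le> card E)"
    by (rule Lattices_Big.ex_has_greatest_nat)
  then obtain E where E: "?Q E" "\<And>E'. ?Q E' \<Longrightarrow> card E' \<le> card E" by blast
  have "bowen_spanning f n \<epsilon> W E"
    unfolding bowen_spanning_def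
  proof (rule ballI, rule ccontr)
    fix z assume z: "z \<in> W" and far: "\<not> (\<exists>y\<in>E. \<forall>i<n. dist ((f ^^ i) z) ((f ^^ i) y) < \<epsilon>)"
    then have far': "\<exists>i<n. \<epsilon> \<le> dist ((f ^^ i) z) ((f ^^ i) y)" if "y \<in> E" for y using that by (meson not_le)
    then have "z \<notin> E" using \<epsilon> by fastforce
    moreover have "bowen_separated f n \<epsilon> (insert z E)"
      unfolding bowen_separated_def
    proof (intro ballI impI)
      fix u v assume uv: "u \<in> insert z E" "v \<in> insert z E" "u \<noteq> v"
      then consider "u = z" "v \<in> E" | "v = z" "u \<in> E" | "u \<in> E" "v \<in> E" by blast
      then show "\<exists>i<n. \<epsilon> \<le> dist ((f ^^ i) u) ((f ^^ i) v)"
      proof cases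
        case 2
        then show ?thesis using far'[of u] by (simp add: dist_commute)
      qed (use far' E(1) uv(3) in \<open>auto simp: bowen_separated_def\<close>)
    qed
    ultimately show False using E(2)[of "insert z E"] E(1) z by simp
  qed
  then show thesis using that E(1) by blast
qed

lemma continuous_birkhoff_sum:
  fixes f :: "'a::topological_space \<Rightarrow> 'a"
  assumes "continuous_on UNIV f" "continuous_on UNIV G"
  shows "continuous_on UNIV (birkhoff_sum f G n)"
proof -
  have "birkhoff_sum f G n = (\<lambda>y. \<Sum>i<n. G ((f ^^ i) y))" by (simp add: birkhoff_sum_def fun_eq_iff)
  moreover have "continuous_on UNIV (\<lambda>y. G ((f ^^ i) y))" for i
    by (rule continuous_on_compose2[OF assms(2) continuous_funpow[OF assms(1)]]) simp
  ultimately show ?thesis by (simp add: continuous_on_sum)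
qed

lemma local_subset_global_unstable: "local_unstable br \<delta> x \<subseteq> global_unstable f br \<delta> x"
  unfolding global_unstable_def by (rule order_trans[OF _ UN_upper[of 0]]) auto

locale gibbs_leaf = smale_space f br eps0 lam for f :: "'a::metric_space \<Rightarrow> 'a" and br eps0 lam +
  fixes \<delta> :: real and x0 :: 'a and G :: "'a \<Rightarrow> real" and \<nu> :: "'a measure"
  assumes mixing: "topologically_mixing f" and \<delta>: "0 < \<delta>" "\<delta> < eps0"
    and supp: "borel_measure_supported_on (local_unstable br \<delta> x0) \<nu>"
    and gibbs: "conditional_gibbs f br \<delta> x0 G \<nu>"
begin

abbreviation "W \<equiv> local_unstable br \<delta> x0"
abbreviation "ball_u \<equiv> unstable_bowen_ball f br \<delta> x0"
abbreviation "p \<equiv> real_of_ereal (pressure f G)"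

lemma sets_nu: "sets \<nu> = sets borel" and AE_W: "AE y in \<nu>. y \<in> W"
  using supp by (auto simp: borel_measure_supported_on_def)

lemma x0_in_W: "x0 \<in> W" using \<delta> by (simp add: local_unstable_def br_diag)

lemma ball_u_iff: "z \<in> W \<Longrightarrow> z \<in> ball_u y n \<epsilon> \<longleftrightarrow> (\<forall>i<n. dist ((f ^^ i) z) ((f ^^ i) y) < \<epsilon>)"
  using local_subset_global_unstable[of br \<delta> x0 f] by (auto simp: unstable_bowen_ball_def)

text \<open>One admissible radius with its constant, the quotient cleared: every estimate below
  works at a single scale.\<close>

definition gibbs_scale :: "real \<Rightarrow> real \<Rightarrow> bool" where
  "gibbs_scale \<epsilon> K \<longleftrightarrow> 0 < \<epsilon> \<and> 0 < K \<and> (\<forall>y\<in>W. \<forall>n\<ge>1.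
     inverse K * exp (birkhoff_sum f G n y - real n * p) \<le> measure \<nu> (ball_u y n \<epsilon>) \<and>
     measure \<nu> (ball_u y n \<epsilon>) \<le> K * exp (birkhoff_sum f G n y - real n * p))"

lemma gibbs_scale_exists:
  assumes "0 < h"
  obtains \<epsilon> K where "gibbs_scale \<epsilon> K" "\<epsilon> < h"
proof -
  obtain b where b: "0 < b" "\<And>\<epsilon>. 0 < \<epsilon> \<Longrightarrow> \<epsilon> < b \<Longrightarrow> \<exists>K>0. \<forall>y \<in> W. \<forall>n\<ge>1.
        inverse K \<le> measure \<nu> (ball_u y n \<epsilon>) / exp (birkhoff_sum f G n y - real n * p) \<and>
        measure \<nu> (ball_u y n \<epsilon>) / exp (birkhoff_sum f G n y - real n * p) \<le> K"
    using gibbs unfolding conditional_gibbs_def eventually_at_right_field by auto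
  define \<epsilon> where "\<epsilon> = min b h / 2"
  have \<epsilon>: "0 < \<epsilon>" "\<epsilon> < b" "\<epsilon> < h" using b(1) assms by (auto simp: \<epsilon>_def)
  obtain K where "K > 0" "\<forall>y \<in> W. \<forall>n\<ge>1.
        inverse K \<le> measure \<nu> (ball_u y n \<epsilon>) / exp (birkhoff_sum f G n y - real n * p) \<and>
        measure \<nu> (ball_u y n \<epsilon>) / exp (birkhoff_sum f G n y - real n * p) \<le> K"
    using b(2)[OF \<epsilon>(1,2)] by blast
  then have "gibbs_scale \<epsilon> K"
    unfolding gibbs_scale_def using \<epsilon>(1) by (simp add: pos_le_divide_eq pos_divide_le_eq)
  then show thesis using that \<epsilon>(3) by blast
qed

text \<open>The real-valued \<open>measure\<close> is 0 on non-measurable sets and on sets of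
  infinite mass, so the positive lower Gibbs bound yields measurability and finiteness of the
  ball.\<close>

lemma ball_u_pos:
  assumes "gibbs_scale \<epsilon> K" "y \<in> W" "1 \<le> n"
  shows "0 < measure \<nu> (ball_u y n \<epsilon>)" "ball_u y n \<epsilon> \<in> sets \<nu>" "emeasure \<nu> (ball_u y n \<epsilon>) < \<infinity>"
proof -
  have "0 < inverse K * exp (birkhoff_sum f G n y - real n * p)" using assms(1) by (simp add: gibbs_scale_def)
  also have "\<dots> \<le> measure \<nu> (ball_u y n \<epsilon>)" using assms by (simp add: gibbs_scale_def)
  finally show pos: "0 < measure \<nu> (ball_u y n \<epsilon>)" .
  then show "ball_u y n \<epsilon> \<in> sets \<nu>" using measure_notin_sets by fastforce
  have "emeasure \<nu> (ball_u y n \<epsilon>) \<noteq> \<infinity>" using pos by (auto simp: measure_def)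
  then show "emeasure \<nu> (ball_u y n \<epsilon>) < \<infinity>" by (simp add: less_top)
qed

text \<open>By compactness finitely many Bowen balls of order 1 cover the leaf, and each has finite
  positive mass.\<close>

lemma finite_nu: "finite_measure \<nu>" and nu_pos: "0 < measure \<nu> UNIV"
proof -
  have sp: "space \<nu> = UNIV" using sets_eq_imp_space_eq[OF sets_nu] by simp
  obtain \<epsilon> K where g: "gibbs_scale \<epsilon> K" using gibbs_scale_exists[of 1] zero_less_one by blast
  then have "0 < \<epsilon>" by (simp add: gibbs_scale_def)
  obtain E where E: "finite E" "E \<subseteq> W" "bowen_spanning f 1 \<epsilon> W E"
    using separated_spanning_exists[OF compact_space cont_f \<open>0 < \<epsilon>\<close>, of W 1] by metis
  have meas: "ball_u y 1 \<epsilon> \<in> sets \<nu>" if "y \<in> E" for y using ball_u_pos(2)[OF g, of y 1] that E(2) by auto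
  have "AE y in \<nu>. y \<in> (\<Union>y\<in>E. ball_u y 1 \<epsilon>)"
    using AE_W
  proof eventually_elim
    case (elim z)
    then obtain y where "y \<in> E" "\<forall>i<1. dist ((f ^^ i) z) ((f ^^ i) y) < \<epsilon>"
      using E(3) unfolding bowen_spanning_def by blast
    then show ?case using ball_u_iff[OF elim] by blast
  qed
  then have "emeasure \<nu> UNIV \<le> emeasure \<nu> (\<Union>y\<in>E. ball_u y 1 \<epsilon>)"
    using meas E(1) by (intro emeasure_mono_AE) auto
  also have "\<dots> \<le> (\<Sum>y\<in>E. emeasure \<nu> (ball_u y 1 \<epsilon>))"
    using meas E(1) by (intro emeasure_subadditive_finite) auto
  also have "\<dots> < \<infinity>"
    using ball_u_pos(3)[OF g, of _ 1] E(1,2) by (auto simp: subset_iff)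
  finally have "emeasure \<nu> UNIV < \<infinity>" .
  then have "emeasure \<nu> (space \<nu>) \<noteq> \<infinity>" unfolding sp by (rule less_imp_neq)
  then show fin: "finite_measure \<nu>" by (rule finite_measureI)
  interpret finite_measure \<nu> by (rule fin)
  have "0 < measure \<nu> (ball_u x0 1 \<epsilon>)" by (rule ball_u_pos(1)[OF g x0_in_W]) simp
  also have "\<dots> \<le> measure \<nu> UNIV"
    using ball_u_pos(2)[OF g x0_in_W, of 1] sp by (intro finite_measure_mono) (auto simp: sets_nu)
  finally show "0 < measure \<nu> UNIV" .
qed

section \<open>Growth of the leaf integrals\<close>

definition part_fun :: "('a \<Rightarrow> real) \<Rightarrow> nat \<Rightarrow> real" where
  "part_fun g n = (\<integral>y. exp (birkhoff_sum f g n y) \<partial>\<nu>)"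

lemma set_integral_eq_part_fun:
  assumes "continuous_on UNIV g"
  shows "(LINT y:W|\<nu>. exp (birkhoff_sum f g n y)) = part_fun g n"
  unfolding part_fun_def set_lebesgue_integral_def
proof (rule integral_cong_AE)
  have "(\<lambda>y. exp (birkhoff_sum f g n y)) \<in> borel_measurable borel"
    by (intro borel_measurable_continuous_onI continuous_intros continuous_birkhoff_sum[OF cont_f assms])
  then show m: "(\<lambda>y. exp (birkhoff_sum f g n y)) \<in> borel_measurable \<nu>"
    using measurable_cong_sets[OF sets_nu refl] by blast
  have "W \<in> sets \<nu>" using borel_local_unstable[of \<delta> x0] \<delta> sets_nu by simp
  then show "(\<lambda>y. indicat_real W y *\<^sub>R exp (birkhoff_sum f g n y)) \<in> borel_measurable \<nu>"
    using m by (intro borel_measurable_scaleR borel_measurable_indicator)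
  show "AE y in \<nu>. indicat_real W y *\<^sub>R exp (birkhoff_sum f g n y) = exp (birkhoff_sum f g n y)"
    using AE_W by eventually_elim simp
qed

lemma integrable_exp_birkhoff:
  assumes "continuous_on UNIV g"
  shows "integrable \<nu> (\<lambda>y. exp (birkhoff_sum f g n y))"
  by (intro integrable_continuous_compact_space[OF compact_space finite_nu sets_nu] continuous_intros
      continuous_birkhoff_sum[OF cont_f assms])

text \<open>Crude bounds, used to show that the pressure of the second potential is finite.\<close>

lemma part_fun_bounds:
  assumes g: "continuous_on UNIV g" and B: "\<And>x. \<bar>g x\<bar> \<le> B"
  shows "exp (- (real n * B)) * measure \<nu> UNIV \<le> part_fun g n" "part_fun g n \<le> exp (real n * B) * measure \<nu> UNIV"
proof -
  interpret finite_measure \<nu> by (rule finite_nu)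
  have sp: "space \<nu> = UNIV" using sets_eq_imp_space_eq[OF sets_nu] by simp
  have b: "- (real n * B) \<le> birkhoff_sum f g n y" "birkhoff_sum f g n y \<le> real n * B" for y
    using birkhoff_sum_abs_le[where G = g, OF B, where f = f and n = n and x = y] by linarith+
  have "(\<integral>y. exp (- (real n * B)) \<partial>\<nu>) \<le> part_fun g n" "part_fun g n \<le> (\<integral>y. exp (real n * B) \<partial>\<nu>)"
    unfolding part_fun_def by (rule integral_mono; use b integrable_exp_birkhoff[OF g] in simp)+
  then show "exp (- (real n * B)) * measure \<nu> UNIV \<le> part_fun g n" "part_fun g n \<le> exp (real n * B) * measure \<nu> UNIV"
    using sp by (simp_all add: mult.commute)
qed

lemma part_fun_pos:
  assumes "continuous_on UNIV g"
  shows "0 < part_fun g n"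
proof -
  obtain B where "\<And>x. \<bar>g x\<bar> \<le> B" using continuous_compact_space_bounded[OF compact_space assms] by blast
  from part_fun_bounds(1)[OF assms this, of n] nu_pos show ?thesis
    by (meson exp_gt_zero less_le_trans mult_pos_pos)
qed

context
  fixes \<epsilon> K \<eta> :: real and G2 :: "'a \<Rightarrow> real" and n :: nat and E :: "'a set"
  assumes scale: "gibbs_scale \<epsilon> K"
    and osc: "\<And>u v. dist u v < \<epsilon> \<Longrightarrow> \<bar>(G2 u - G u) - (G2 v - G v)\<bar> \<le> \<eta>"
    and cont: "continuous_on UNIV (\<lambda>z. G2 z - G z)"
    and n: "1 \<le> n" and E: "finite E" "E \<subseteq> W"
begin

lemma birkhoff_near:
  assumes "z \<in> W" "z \<in> ball_u y n \<epsilon>"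
  shows "\<bar>birkhoff_sum f (\<lambda>z. G2 z - G z) n z - birkhoff_sum f (\<lambda>z. G2 z - G z) n y\<bar> \<le> real n * \<eta>"
  using ball_u_iff[OF assms(1)] assms(2) by (intro birkhoff_sum_diff_le[where G = "\<lambda>z. G2 z - G z", OF osc]) auto

lemma birkhoff_split: "birkhoff_sum f (\<lambda>z. G2 z - G z) n y = birkhoff_sum f G2 n y - birkhoff_sum f G n y"
  by (simp add: birkhoff_sum_def sum_subtractf)

lemma integral_ball_sum:
  shows "integrable \<nu> (\<lambda>z. \<Sum>y\<in>E. indicator (ball_u y n \<epsilon>) z * (c y :: real))"
    and "(\<integral>z. (\<Sum>y\<in>E. indicator (ball_u y n \<epsilon>) z * c y) \<partial>\<nu>) = (\<Sum>y\<in>E. measure \<nu> (ball_u y n \<epsilon>) * c y)"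
proof -
  have sp: "space \<nu> = UNIV" using sets_eq_imp_space_eq[OF sets_nu] by simp
  have b: "ball_u y n \<epsilon> \<in> sets \<nu>" "emeasure \<nu> (ball_u y n \<epsilon>) < \<infinity>" if "y \<in> E" for y
    using ball_u_pos(2,3)[OF scale _ n, of y] that E(2) by auto
  then have i: "integrable \<nu> (\<lambda>z. indicator (ball_u y n \<epsilon>) z * c y)" if "y \<in> E" for y
    using that by (intro integrable_mult_left) (simp add: integrable_indicator_iff)
  then show "integrable \<nu> (\<lambda>z. \<Sum>y\<in>E. indicator (ball_u y n \<epsilon>) z * c y)"
    by (rule Bochner_Integration.integrable_sum)
  show "(\<integral>z. (\<Sum>y\<in>E. indicator (ball_u y n \<epsilon>) z * c y) \<partial>\<nu>) = (\<Sum>y\<in>E. measure \<nu> (ball_u y n \<epsilon>) * c y)"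
    using b sp by (subst Bochner_Integration.integral_sum[OF i]) auto
qed

text \<open>The Gibbs mass of the ball about y carries exp of the Birkhoff sum of \<open>G\<close>,
  which cancels against the integrand and leaves that of \<open>G2\<close>. Spanning makes the balls
  cover the leaf, and each is charged with the maximum of the integrand up to oscillation \<eta> per
  step.\<close>

lemma part_fun_le_spanning_sum:
  assumes span: "bowen_spanning f n \<epsilon> W E"
  shows "part_fun (\<lambda>z. G2 z - G z) n \<le> K * exp (real n * \<eta> - real n * p) * (\<Sum>y\<in>E. exp (birkhoff_sum f G2 n y))"
proof -
  let ?S = "birkhoff_sum f (\<lambda>z. G2 z - G z) n"
  define c where "c y = exp (?S y + real n * \<eta>)" for y
  have "part_fun (\<lambda>z. G2 z - G z) n \<le> (\<integral>z. (\<Sum>y\<in>E. indicator (ball_u y n \<epsilon>) z * c y) \<partial>\<nu>)"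
    unfolding part_fun_def
  proof (rule integral_mono_AE[OF integrable_exp_birkhoff[OF cont] integral_ball_sum(1)])
    show "AE z in \<nu>. exp (?S z) \<le> (\<Sum>y\<in>E. indicator (ball_u y n \<epsilon>) z * c y)"
      using AE_W
    proof eventually_elim
      case (elim z)
      then obtain y where y: "y \<in> E" "z \<in> ball_u y n \<epsilon>"
        using span ball_u_iff[OF elim] unfolding bowen_spanning_def by blast
      have "exp (?S z) \<le> c y" unfolding c_def using birkhoff_near[OF elim y(2)] by simp
      also have "\<dots> = indicator (ball_u y n \<epsilon>) z * c y" using y(2) by simp
      also have "\<dots> \<le> (\<Sum>y\<in>E. indicator (ball_u y n \<epsilon>) z * c y)"
        using E(1) y(1) by (intro member_le_sum[of y E "\<lambda>y. indicator (ball_u y n \<epsilon>) z * c y"]) (auto simp: c_def)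
      finally show ?case .
    qed
  qed
  also have "\<dots> = (\<Sum>y\<in>E. measure \<nu> (ball_u y n \<epsilon>) * c y)" by (rule integral_ball_sum(2))
  also have "\<dots> \<le> (\<Sum>y\<in>E. (K * exp (birkhoff_sum f G n y - real n * p)) * c y)"
    using scale n E(2) by (intro sum_mono mult_right_mono) (auto simp: gibbs_scale_def c_def)
  also have "\<dots> = (\<Sum>y\<in>E. K * exp (real n * \<eta> - real n * p) * exp (birkhoff_sum f G2 n y))"
    by (intro sum.cong) (auto simp: c_def birkhoff_split exp_add[symmetric] mult.assoc)
  finally show ?thesis by (simp add: sum_distrib_left)
qed

text \<open>The same cancellation with the lower Gibbs bound. Points that are 2 * \<epsilon>
  separated have disjoint \<epsilon>-balls, so no part of the integral is counted twice.\<close>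

lemma separated_sum_le_part_fun:
  assumes sep: "bowen_separated f n (2 * \<epsilon>) E"
  shows "(\<Sum>y\<in>E. exp (birkhoff_sum f G2 n y)) \<le> K * exp (real n * \<eta> + real n * p) * part_fun (\<lambda>z. G2 z - G z) n"
proof -
  have K: "0 < K" using scale by (simp add: gibbs_scale_def)
  let ?S = "birkhoff_sum f (\<lambda>z. G2 z - G z) n"
  define c where "c y = exp (?S y - real n * \<eta>)" for y
  have "(\<Sum>y\<in>E. exp (birkhoff_sum f G2 n y))
      = (\<Sum>y\<in>E. K * exp (real n * \<eta> + real n * p) * (inverse K * exp (birkhoff_sum f G n y - real n * p) * c y))"
    using K by (intro sum.cong) (auto simp: c_def birkhoff_split exp_add[symmetric] exp_diff field_simps)
  also have "\<dots> = K * exp (real n * \<eta> + real n * p) * (\<Sum>y\<in>E. inverse K * exp (birkhoff_sum f G n y - real n * p) * c y)"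
    by (simp add: sum_distrib_left)
  also have "(\<Sum>y\<in>E. inverse K * exp (birkhoff_sum f G n y - real n * p) * c y) \<le> (\<Sum>y\<in>E. measure \<nu> (ball_u y n \<epsilon>) * c y)"
    using scale n E(2) by (intro sum_mono mult_right_mono) (auto simp: gibbs_scale_def c_def)
  also have "\<dots> = (\<integral>z. (\<Sum>y\<in>E. indicator (ball_u y n \<epsilon>) z * c y) \<partial>\<nu>)" by (rule integral_ball_sum(2)[symmetric])
  also have "\<dots> \<le> part_fun (\<lambda>z. G2 z - G z) n"
    unfolding part_fun_def
  proof (rule integral_mono_AE[OF integral_ball_sum(1) integrable_exp_birkhoff[OF cont]])
    show "AE z in \<nu>. (\<Sum>y\<in>E. indicator (ball_u y n \<epsilon>) z * c y) \<le> exp (?S z)"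
      using AE_W
    proof eventually_elim
      case (elim z)
      show ?case
      proof (cases "\<exists>y\<in>E. z \<in> ball_u y n \<epsilon>")
        case True
        then obtain y where y: "y \<in> E" "z \<in> ball_u y n \<epsilon>" by blast
        have "z \<notin> ball_u y' n \<epsilon>" if y': "y' \<in> E" "y' \<noteq> y" for y'
        proof
          assume "z \<in> ball_u y' n \<epsilon>"
          obtain i where i: "i < n" "2 * \<epsilon> \<le> dist ((f ^^ i) y') ((f ^^ i) y)"
            using sep y(1) y' unfolding bowen_separated_def by blast
          have "dist ((f ^^ i) z) ((f ^^ i) y) < \<epsilon>" "dist ((f ^^ i) z) ((f ^^ i) y') < \<epsilon>"
            using ball_u_iff[OF elim] y(2) \<open>z \<in> ball_u y' n \<epsilon>\<close> i(1) by blast+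
          then show False using i(2) dist_triangle3[of "(f ^^ i) y'" "(f ^^ i) y" "(f ^^ i) z"] by linarith
        qed
        then have "(\<Sum>y\<in>E. indicator (ball_u y n \<epsilon>) z * c y) = c y"
          using E(1) y by (subst sum.remove[of _ y]) (auto intro!: sum.neutral)
        also have "\<dots> \<le> exp (?S z)" unfolding c_def using birkhoff_near[OF elim y(2)] by simp
        finally show ?thesis .
      next
        case False
        then have "(\<Sum>y\<in>E. indicator (ball_u y n \<epsilon>) z * c y) = 0" by (intro sum.neutral) auto
        then show ?thesis by simp
      qed
    qed
  qed
  finally show ?thesis using K by simp
qed

end

text \<open>A maximal separated set is also spanning, so its weighted sum inherits the growth of the
  integral and feeds the bound by the pressure. The Gibbs constant enters once per n, as the
  additive constant ln K.\<close>

lemma pressure_ge_of_frequently: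
  assumes G: "continuous_on UNIV G" and G2: "continuous_on UNIV G2"
    and freq: "\<exists>\<^sub>F n in sequentially. real n * c \<le> ln (part_fun (\<lambda>z. G2 z - G z) n)"
  shows "ereal (c + p) \<le> pressure f G2"
proof -
  have cont: "continuous_on UNIV (\<lambda>z. G2 z - G z)" by (intro continuous_intros G G2)
  have le: "ereal (c + p - \<eta>) \<le> pressure f G2" if \<eta>: "0 < \<eta>" for \<eta>
  proof -
    obtain d where d: "0 < d" "\<And>u v. dist u v < d \<Longrightarrow> \<bar>(G2 u - G u) - (G2 v - G v)\<bar> \<le> \<eta>"
      using uniform_oscillation[OF compact_space cont \<eta>] by blast
    obtain \<epsilon> K where scale: "gibbs_scale \<epsilon> K" and "\<epsilon> < d" using gibbs_scale_exists[OF d(1)] by blast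
    then have \<epsilon>: "0 < \<epsilon>" "0 < K" and osc: "\<And>u v. dist u v < \<epsilon> \<Longrightarrow> \<bar>(G2 u - G u) - (G2 v - G v)\<bar> \<le> \<eta>"
      using d(2) by (auto simp: gibbs_scale_def)
    show ?thesis
    proof (rule separated_sums_le_pressure[OF compact_space cont_f G2 \<epsilon>(1), where C = "ln K"])
      have "\<exists>\<^sub>F n in sequentially. real n * c \<le> ln (part_fun (\<lambda>z. G2 z - G z) n) \<and> 1 \<le> n"
        using freq eventually_ge_at_top[of 1] by (rule frequently_eventually_frequently)
      then show "\<exists>\<^sub>F n in sequentially. \<exists>E. finite E \<and> E \<noteq> {} \<and>
          (\<forall>y\<in>E. \<forall>z\<in>E. y \<noteq> z \<longrightarrow> (\<exists>i<n. \<epsilon> \<le> dist ((f ^^ i) y) ((f ^^ i) z))) \<and>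
          real n * (c + p - \<eta>) - ln K \<le> ln (\<Sum>y\<in>E. exp (birkhoff_sum f G2 n y))"
      proof (rule frequently_elim1)
        fix n assume n: "real n * c \<le> ln (part_fun (\<lambda>z. G2 z - G z) n) \<and> 1 \<le> n"
        obtain E where E: "finite E" "E \<subseteq> W" "bowen_separated f n \<epsilon> E" "bowen_spanning f n \<epsilon> W E"
          using separated_spanning_exists[OF compact_space cont_f \<epsilon>(1)] by blast
        have "E \<noteq> {}" using E(4) x0_in_W by (auto simp: bowen_spanning_def)
        then have Z: "0 < (\<Sum>y\<in>E. exp (birkhoff_sum f G2 n y))" using E(1) by (intro sum_pos) auto
        have "part_fun (\<lambda>z. G2 z - G z) n \<le> K * exp (real n * \<eta> - real n * p) * (\<Sum>y\<in>E. exp (birkhoff_sum f G2 n y))"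
          by (rule part_fun_le_spanning_sum[OF scale osc cont _ E(1,2,4)]) (use n in auto)
        then have "ln (part_fun (\<lambda>z. G2 z - G z) n) \<le> ln (K * exp (real n * \<eta> - real n * p) * (\<Sum>y\<in>E. exp (birkhoff_sum f G2 n y)))"
          using part_fun_pos[OF cont, of n] by (simp add: ln_mono)
        also have "\<dots> = ln K + (real n * \<eta> - real n * p) + ln (\<Sum>y\<in>E. exp (birkhoff_sum f G2 n y))"
          using \<epsilon>(2) Z by (simp add: ln_mult_pos)
        finally have "real n * (c + p - \<eta>) - ln K \<le> ln (\<Sum>y\<in>E. exp (birkhoff_sum f G2 n y))"
          using n by (simp add: algebra_simps)
        then show "\<exists>E. finite E \<and> E \<noteq> {} \<and>
          (\<forall>y\<in>E. \<forall>z\<in>E. y \<noteq> z \<longrightarrow> (\<exists>i<n. \<epsilon> \<le> dist ((f ^^ i) y) ((f ^^ i) z))) \<and>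
          real n * (c + p - \<eta>) - ln K \<le> ln (\<Sum>y\<in>E. exp (birkhoff_sum f G2 n y))"
          using E(1,3) \<open>E \<noteq> {}\<close> unfolding bowen_separated_def by blast
      qed
    qed
  qed
  show ?thesis
  \<comment> \<open>Letting \<eta> tend to 0 needs a finite pressure; plus infinity is trivial and
    minus infinity contradicts the bound for \<eta> = 1.\<close>
  proof (cases "pressure f G2")
    case (real r)
    then have "c + p \<le> r + \<eta>" if "0 < \<eta>" for \<eta> using le[OF that] by simp
    then show ?thesis using field_le_epsilon[of "c + p" r] real by simp
  qed (use le[of 1] in auto)
qed

text \<open>Every partition of every invariant measure is tested against one separated and spanning
  subset of the leaf, whose images at time N shadow the whole space. Separation bounds its weighted
  sum by the integral over the leaf.\<close>

lemma pressure_le_of_frequently: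
  assumes G: "continuous_on UNIV G" and G2: "continuous_on UNIV G2"
    and freq: "\<exists>\<^sub>F n in sequentially. ln (part_fun (\<lambda>z. G2 z - G z) n) \<le> real n * c"
  shows "pressure f G2 \<le> ereal (c + p)"
  unfolding pressure_def[of f G2]
proof (rule SUP_least)
  have cont: "continuous_on UNIV (\<lambda>z. G2 z - G z)" by (intro continuous_intros G G2)
  fix M assume M: "M \<in> invariant_prob_measures f"
  then have sM: "sets M = sets borel" by (simp add: invariant_prob_measures_def)
  have sp: "space M = UNIV" using sets_eq_imp_space_eq[OF sM] by simp
  have "entropy_wrt_partition f M P \<le> c + p - (\<integral>x. G2 x \<partial>M)"
    if P: "finite P" "partition_on (space M) P" "P \<subseteq> sets M" for P
  proof (rule field_le_epsilon)
    fix \<theta> :: real assume \<theta>: "0 < \<theta>"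
    \<comment> \<open>One half is lost in the entropy estimate, the other to the oscillation of
      \<open>G2 - G\<close>.\<close>
    define \<eta> where "\<eta> = \<theta> / 2"
    have \<eta>: "0 < \<eta>" using \<theta> by (simp add: \<eta>_def)
    have P': "partition_on UNIV P" "P \<subseteq> sets borel" using P sp sM by auto
    let ?I = "\<integral>x. G2 x \<partial>M"
    obtain \<epsilon>0 B where \<epsilon>0: "0 < \<epsilon>0" and ent:
      "\<And>N n E. finite E \<Longrightarrow> (\<And>x. \<exists>y\<in>E. \<forall>i<n. dist ((f ^^ i) x) ((f ^^ (N + i)) y) < \<epsilon>0) \<Longrightarrow>
      word_entropy f P M n + real n * ?I \<le> ln (\<Sum>y\<in>E. exp (birkhoff_sum f G2 (N + n) y)) + real n * \<eta> + real N * B"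
      using word_entropy_le_spanning_sum[OF compact_space cont_f G2 M P' P(1) \<eta>] by blast
    obtain d where d: "0 < d" "\<And>u v. dist u v < d \<Longrightarrow> \<bar>(G2 u - G u) - (G2 v - G v)\<bar> \<le> \<eta>"
      using uniform_oscillation[OF compact_space cont \<eta>] by blast
    \<comment> \<open>The quarter is for the spanning radius 2 * \<epsilon>, which together with the
      shadowing error \<open>\<epsilon>0 / 2\<close> must stay below
      \<open>\<epsilon>0\<close>.\<close>
    have "0 < min d (\<epsilon>0 / 4)" using d(1) \<epsilon>0 by simp
    then obtain \<epsilon> K where scale: "gibbs_scale \<epsilon> K" and small: "\<epsilon> < min d (\<epsilon>0 / 4)"
      using gibbs_scale_exists by blast
    then have \<epsilon>: "0 < \<epsilon>" "0 < K" and osc: "\<And>u v. dist u v < \<epsilon> \<Longrightarrow> \<bar>(G2 u - G u) - (G2 v - G v)\<bar> \<le> \<eta>"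
      using d(2) by (auto simp: gibbs_scale_def)
    have "0 < \<epsilon>0 / 2" using \<epsilon>0 by simp
    then obtain N where N: "\<And>x. \<exists>y\<in>W. \<forall>i. dist ((f ^^ i) x) ((f ^^ (N + i)) y) < \<epsilon>0 / 2"
      using unstable_leaf_shadowing[OF mixing \<delta>(1)] by blast
    \<comment> \<open>Everything that does not depend on n, including the cost of the N extra
      steps.\<close>
    define A where "A = real N * (c + \<eta> + p) + ln K + real N * B"
    have bound: "word_entropy f P M n / real n + ?I \<le> c + p + \<theta> + A / real n"
      if n: "1 \<le> n" and Z: "ln (part_fun (\<lambda>z. G2 z - G z) (n + N)) \<le> real (n + N) * c" for n
    proof -
      obtain E where E: "finite E" "E \<subseteq> W" "bowen_separated f (N + n) (2 * \<epsilon>) E" "bowen_spanning f (N + n) (2 * \<epsilon>) W E"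
        using separated_spanning_exists[OF compact_space cont_f, of "2 * \<epsilon>" W "N + n"] \<epsilon>(1) by auto
      have "E \<noteq> {}" using E(4) x0_in_W by (auto simp: bowen_spanning_def)
      then have pos: "0 < (\<Sum>y\<in>E. exp (birkhoff_sum f G2 (N + n) y))" using E(1) by (intro sum_pos) auto
      have "word_entropy f P M n + real n * ?I \<le> ln (\<Sum>y\<in>E. exp (birkhoff_sum f G2 (N + n) y)) + real n * \<eta> + real N * B"
      proof (rule ent[OF E(1)])
        fix x
        obtain y' where y': "y' \<in> W" "\<And>i. dist ((f ^^ i) x) ((f ^^ (N + i)) y') < \<epsilon>0 / 2" using N by blast
        then obtain y where y: "y \<in> E" "\<And>i. i < N + n \<Longrightarrow> dist ((f ^^ i) y') ((f ^^ i) y) < 2 * \<epsilon>"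
          using E(4) unfolding bowen_spanning_def by blast
        have "dist ((f ^^ i) x) ((f ^^ (N + i)) y) < \<epsilon>0" if "i < n" for i
          using y'(2)[of i] y(2)[of "N + i"] that small
            dist_triangle[of "(f ^^ i) x" "(f ^^ (N + i)) y" "(f ^^ (N + i)) y'"] by simp
        then show "\<exists>y\<in>E. \<forall>i<n. dist ((f ^^ i) x) ((f ^^ (N + i)) y) < \<epsilon>0" using y(1) by blast
      qed
      also have "ln (\<Sum>y\<in>E. exp (birkhoff_sum f G2 (N + n) y)) \<le>
          ln (K * exp (real (N + n) * \<eta> + real (N + n) * p) * part_fun (\<lambda>z. G2 z - G z) (N + n))"
      proof (rule ln_mono)
        show "(\<Sum>y\<in>E. exp (birkhoff_sum f G2 (N + n) y)) \<le>
            K * exp (real (N + n) * \<eta> + real (N + n) * p) * part_fun (\<lambda>z. G2 z - G z) (N + n)"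
          by (rule separated_sum_le_part_fun[OF scale osc cont _ E(1,2,3)]) (use n in auto)
      qed (use pos in simp)
      also have "\<dots> = ln K + (real (N + n) * \<eta> + real (N + n) * p) + ln (part_fun (\<lambda>z. G2 z - G z) (N + n))"
        using \<epsilon>(2) part_fun_pos[OF cont] by (simp add: ln_mult_pos)
      finally have "word_entropy f P M n + real n * ?I \<le> real n * (c + p + \<theta>) + A"
        using Z by (simp add: A_def \<eta>_def algebra_simps add_divide_distrib)
      then have "(word_entropy f P M n + real n * ?I) / real n \<le> (real n * (c + p + \<theta>) + A) / real n"
        by (intro divide_right_mono) auto
      then show ?thesis using n by (simp add: add_divide_distrib)
    qed
    \<comment> \<open>The entropy quotients converge, so an inequality for infinitely many n already
      bounds their limit.\<close>
    let ?D = "\<lambda>n. (word_entropy f P M n / real n + ?I) - (c + p + \<theta> + A / real n)"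
    have lim: "?D \<longlonglongrightarrow> (entropy_wrt_partition f M P + ?I) - (c + p + \<theta> + 0)"
      by (intro tendsto_intros word_entropy_tendsto[OF cont_f M P' P(1)] lim_const_over_n)
    \<comment> \<open>The spanning sets have order N + n, so the hypothesis is read at shifted
      indices.\<close>
    have "\<exists>\<^sub>F n in sequentially. ln (part_fun (\<lambda>z. G2 z - G z) (n + N)) \<le> real (n + N) * c"
      using freq unfolding frequently_def
      by (subst eventually_sequentially_seg[of "\<lambda>n. \<not> ln (part_fun (\<lambda>z. G2 z - G z) n) \<le> real n * c"])
    from frequently_eventually_frequently[OF this eventually_ge_at_top[of 1]]
    have "\<exists>\<^sub>F n in sequentially. ?D n \<le> 0"
      by (rule frequently_elim1) (use bound in auto)
    then have "\<not> 0 < (entropy_wrt_partition f M P + ?I) - (c + p + \<theta> + 0)"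
      using order_tendstoD(1)[OF lim, of 0] by (auto simp: frequently_def not_le)
    then show "entropy_wrt_partition f M P \<le> c + p - ?I + \<theta>" by simp
  qed
  then have "measure_entropy f M \<le> ereal (c + p - (\<integral>x. G2 x \<partial>M))"
    unfolding measure_entropy_def by (intro SUP_least) auto
  then have "measure_entropy f M + ereal (\<integral>x. G2 x \<partial>M) \<le> ereal (c + p - (\<integral>x. G2 x \<partial>M)) + ereal (\<integral>x. G2 x \<partial>M)"
    by (rule add_right_mono)
  then show "measure_entropy f M + ereal (\<integral>x. G2 x \<partial>M) \<le> ereal (c + p)" by simp
qed

text \<open>If the rate failed to converge from one side, it would lie beyond some level a
  infinitely often, against the pressure inequality for that side. Finiteness of the pressure comes
  first, since \<open>real_of_ereal\<close> sends infinite values to 0.\<close>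

lemma part_fun_growth:
  assumes G: "continuous_on UNIV G" and G2: "continuous_on UNIV G2"
  shows "(\<lambda>n. 1 / real n * ln (part_fun (\<lambda>z. G2 z - G z) n)) \<longlonglongrightarrow> real_of_ereal (pressure f G2) - p"
proof -
  let ?g = "\<lambda>z. G2 z - G z"
  have cont: "continuous_on UNIV ?g" by (intro continuous_intros G G2)
  obtain B where B: "0 \<le> B" "\<And>x. \<bar>?g x\<bar> \<le> B" using continuous_compact_space_bounded[OF compact_space cont] by blast
  define V where "V = measure \<nu> UNIV"
  have V: "0 < V" using nu_pos by (simp add: V_def)
  have ln_bounds: "- (real n * B) + ln V \<le> ln (part_fun ?g n)" "ln (part_fun ?g n) \<le> real n * B + ln V" for n
  proof -
    have "ln (exp (- (real n * B)) * V) \<le> ln (part_fun ?g n)"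
      using part_fun_bounds(1)[OF cont B(2), of n] V by (intro ln_mono) (auto simp: V_def)
    then show "- (real n * B) + ln V \<le> ln (part_fun ?g n)" using V by (simp add: ln_mult_pos)
    have "ln (part_fun ?g n) \<le> ln (exp (real n * B) * V)"
      using part_fun_bounds(2)[OF cont B(2), of n] part_fun_pos[OF cont, of n] by (intro ln_mono) (auto simp: V_def)
    then show "ln (part_fun ?g n) \<le> real n * B + ln V" using V by (simp add: ln_mult_pos)
  qed
  \<comment> \<open>Eventually n absorbs the total mass of \<nu>, whence the bounds B + 1 and - B -
    1.\<close>
  have big: "\<forall>\<^sub>F n in sequentially. \<bar>ln V\<bar> \<le> real n"
    using filterlim_real_sequentially by (simp add: filterlim_at_top)
  have "\<forall>\<^sub>F n in sequentially. ln (part_fun ?g n) \<le> real n * (B + 1)"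
    using big
  proof eventually_elim
    case (elim n)
    then have "ln V \<le> real n" by linarith
    then show ?case using ln_bounds(2)[of n] by (simp add: distrib_left)
  qed
  then have up: "pressure f G2 \<le> ereal (B + 1 + p)"
    by (intro pressure_le_of_frequently[OF G G2] eventually_frequently) simp_all
  have "\<forall>\<^sub>F n in sequentially. real n * (- B - 1) \<le> ln (part_fun ?g n)"
    using big
  proof eventually_elim
    case (elim n)
    then have "- real n \<le> ln V" by linarith
    then show ?case using ln_bounds(1)[of n] by (simp add: right_diff_distrib)
  qed
  then have low: "ereal (- B - 1 + p) \<le> pressure f G2"
    by (intro pressure_ge_of_frequently[OF G G2] eventually_frequently) simp_all
  obtain P2 where P2: "pressure f G2 = ereal P2"
    using up low by (cases "pressure f G2") auto
  have "(\<lambda>n. 1 / real n * ln (part_fun ?g n)) \<longlonglongrightarrow> P2 - p"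
  proof (rule order_tendstoI)
    fix a assume a: "a < P2 - p"
    show "\<forall>\<^sub>F n in sequentially. a < 1 / real n * ln (part_fun ?g n)"
    proof (rule ccontr)
      assume "\<not> ?thesis"
      then have "\<exists>\<^sub>F n in sequentially. \<not> a < 1 / real n * ln (part_fun ?g n)" by (simp add: frequently_def)
      from frequently_eventually_frequently[OF this eventually_ge_at_top[of 1]]
      have "\<exists>\<^sub>F n in sequentially. ln (part_fun ?g n) \<le> real n * a"
        by (rule frequently_elim1) (auto simp: field_simps)
      from pressure_le_of_frequently[OF G G2 this] show False using a P2 by simp
    qed
  next
    fix a assume a: "P2 - p < a"
    show "\<forall>\<^sub>F n in sequentially. 1 / real n * ln (part_fun ?g n) < a"
    proof (rule ccontr)
      assume "\<not> ?thesis"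
      then have "\<exists>\<^sub>F n in sequentially. \<not> 1 / real n * ln (part_fun ?g n) < a" by (simp add: frequently_def)
      from frequently_eventually_frequently[OF this eventually_ge_at_top[of 1]]
      have "\<exists>\<^sub>F n in sequentially. real n * a \<le> ln (part_fun ?g n)"
        by (rule frequently_elim1) (auto simp: field_simps)
      from pressure_ge_of_frequently[OF G G2 this] show False using a P2 by simp
    qed
  qed
  then show ?thesis using P2 by simp
qed

end

lemma hoelder_continuous_imp_continuous_on:
  assumes "hoelder_continuous G"
  shows "continuous_on UNIV G"
proof -
  obtain C \<alpha> where C: "0 < \<alpha>" "\<And>x y. \<bar>G x - G y\<bar> \<le> C * dist x y powr \<alpha>"
    using assms unfolding hoelder_continuous_def by blast
  have "(G \<longlongrightarrow> G x) (at x)" for x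
  proof -
    have bound: "norm (G y - G x) \<le> C * dist x y powr \<alpha>" for y
      using C(2)[of x y] by (simp add: abs_minus_commute)
    have "((\<lambda>y. dist x y) \<longlongrightarrow> dist x x) (at x)"
      by (intro tendsto_dist tendsto_const tendsto_ident_at)
    then have "((\<lambda>y. dist x y powr \<alpha>) \<longlongrightarrow> 0) (at x)"
      by (intro tendsto_zero_powrI[OF _ tendsto_const _ C(1)]) simp_all
    from tendsto_mult_right_zero[OF this, of C]
    have "((\<lambda>y. G y - G x) \<longlongrightarrow> 0) (at x)"
      by (rule Lim_null_comparison[rotated]) (intro always_eventually allI bound)
    then show ?thesis by (simp add: LIM_zero_iff)
  qed
  then show ?thesis by (simp add: continuous_on_def)
qed

theorem lemma4p1:
  fixes f :: "'a::metric_space \<Rightarrow> 'a"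
    and br :: "'a \<Rightarrow> 'a \<Rightarrow> 'a"
    and eps0 lam :: real
    and G1 G2 :: "'a \<Rightarrow> real"
    and \<mu> :: "'a measure"
  assumes "smale_space f br eps0 lam"
    and "topologically_mixing f"
    and "hoelder_continuous G1"
    and "equilibrium_state f G1 \<mu>"
    and "continuous_on UNIV G2"
  shows "AE x in \<mu>. \<forall>\<^sub>F \<delta> in at_right 0. \<forall>\<nu>.
           borel_measure_supported_on (local_unstable br \<delta> x) \<nu> \<and>
           conditional_gibbs f br \<delta> x G1 \<nu> \<longrightarrow>
           (\<lambda>n. 1 / real n *
                ln (LINT y:local_unstable br \<delta> x|\<nu>. exp (birkhoff_sum f (\<lambda>z. G2 z - G1 z) n y)))
             \<longlonglongrightarrow> real_of_ereal (pressure f G2) - real_of_ereal (pressure f G1)"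
proof (rule AE_I2)
  fix x
  have G1: "continuous_on UNIV G1" using assms(3) by (rule hoelder_continuous_imp_continuous_on)
  have eps0: "0 < eps0" using assms(1) by (rule smale_space.eps0_pos)
  show "\<forall>\<^sub>F \<delta> in at_right 0. \<forall>\<nu>.
           borel_measure_supported_on (local_unstable br \<delta> x) \<nu> \<and>
           conditional_gibbs f br \<delta> x G1 \<nu> \<longrightarrow>
           (\<lambda>n. 1 / real n *
                ln (LINT y:local_unstable br \<delta> x|\<nu>. exp (birkhoff_sum f (\<lambda>z. G2 z - G1 z) n y)))
             \<longlonglongrightarrow> real_of_ereal (pressure f G2) - real_of_ereal (pressure f G1)"
    \<comment> \<open>Sufficiently small means 0 < \<delta> < \<open>eps0\<close>, the range of
      radii fixed in \<open>gibbs_leaf\<close>.\<close>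
    using eventually_at_right_less[of 0] order_tendstoD(2)[OF tendsto_ident_at eps0]
  proof eventually_elim
    case (elim \<delta>)
    show ?case
    proof (intro allI impI, elim conjE)
      fix \<nu> assume \<nu>: "borel_measure_supported_on (local_unstable br \<delta> x) \<nu>" "conditional_gibbs f br \<delta> x G1 \<nu>"
      interpret gibbs_leaf f br eps0 lam \<delta> x G1 \<nu>
        using assms(1,2) elim \<nu> by (simp add: gibbs_leaf_def gibbs_leaf_axioms_def)
      have "continuous_on UNIV (\<lambda>z. G2 z - G1 z)" by (intro continuous_intros G1 assms(5))
      then show "(\<lambda>n. 1 / real n *
                ln (LINT y:local_unstable br \<delta> x|\<nu>. exp (birkhoff_sum f (\<lambda>z. G2 z - G1 z) n y)))
             \<longlonglongrightarrow> real_of_ereal (pressure f G2) - real_of_ereal (pressure f G1)"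
        using part_fun_growth[OF G1 assms(5)] by (simp only: set_integral_eq_part_fun)
    qed
  qed
qed

end
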